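(* Let $a,b,c\in\mathbb{R}$, $1\le p<\infty$, $0<q,r<\infty$, and set $\breve\theta:=\left(1-\frac qr\right)\left(\frac q{p'}+1\right)^{-1}$. The subspace of radially symmetric functions of $\widetilde W^{1,(q,p)}_{\{a,b\}}$ is continuously embedded into $L^r(\mathbb{R}^N;|x|^cdx)$ (and hence into $\widetilde W^{1,(r,p)}_{\{c,b\}}$) if and only if one of the following holds: (i) $a$ and $b-p$ are on the same side of $-N$ (including $-N$), $\frac{a+N}q\ne\frac{b-p+N}p$, $c$ lies in the open interval with endpoints $c^0$ and $c^1$, and $\theta_c\ge\breve\theta$; (ii) $a$ and $b-p$ are strictly on opposite sides of $-N$, $c$ lies in the open interval with endpoints $c^0$ and $-N$, and $\theta_c\ge\breve\theta$; (iii) $r\ge p$, either ($a\le-N$ and $b-p<-N$) or ($a\ge-N$ and $b-p>-N$), and $c=c^1$; in this case there is $C>0$ with $\|u\|_{c,r}\le C\|\partial_\rho u\|_{b,p}$ for every radially symmetric $u\in\widetilde W^{1,(q,p)}_{\{a,b\}}$; (iv) either ($r=q$ and $c=a$) or ($p\ne q$, $\min\{p,q\}\le r\le\max\{p,q\}$, $\frac{a+N}q=\frac{b-p+N}p\ne0$ and $c=c^0$); in this case there is $C>0$ with $\|u\|_{c,r}\le C\|\partial_\rho u\|_{b,p}^\theta\|u\|_{a,q}^{1-\theta}$ for every radially symmetric $u\in\widetilde W^{1,(q,p)}_{\{a,b\}}$, where $\theta=0$ if $r=q$ and $c=a$, and $\theta=\frac{p(r-q)}{r(p-q)}$ otherwise;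 (v) $a=-N$, $b=p-N$, $r>q$ and $c=-N$; in this case there is $C>0$ with $\|u\|_{-N,r}\le C\|\partial_\rho u\|_{p-N,p}^{\breve\theta}\|u\|_{-N,q}^{1-\breve\theta}$ for every radially symmetric $u\in\widetilde W^{1,(q,p)}_{\{a,b\}}$.
   Context: $N\ge1$, $\mathbb{R}^N_*:=\mathbb{R}^N\setminus\{0\}$. For $d\in\mathbb{R}$, $0<s<\infty$, $\|u\|_{d,s}:=(\int_{\mathbb{R}^N}|x|^d|u|^s dx)^{1/s}$ ($\{0\}$ of measure $0$), $L^s(\mathbb{R}^N;|x|^ddx)$ the measurable $u$ with $\|u\|_{d,s}<\infty$. $\partial_\rho u:=\nabla u\cdot x/|x|$ for distributions on $\mathbb{R}^N_*$; $\widetilde W^{1,(q,p)}_{\{a,b\}}$ is the set of $u\in L^1_{loc}(\mathbb{R}^N_* )$ with $\|u\|_{a,q}<\infty$, $\|\partial_\rho u\|_{b,p}<\infty$, (quasi-)normed by $\|u\|_{a,q}+\|\partial_\rho u\|_{b,p}$. Radially symmetric: $u(x)$ depends only on $|x|$. $p'$ is the Hölder conjugate of $p$. $c^0:=\frac{r(a+N)}{q}-N$, $c^1:=\frac{r(b-p+N)}{p}-N$, $\theta_c:=\frac{c-c^0}{c^1-c^0}$ when $c^0\ne c^1$. *)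

theory Defs
  imports "HOL-Analysis.Analysis"
begin

text \<open>Weighted integral of |x|^d |u|^s (as an extended nonnegative real); the point 0
  is a null set, so the value of the weight there is irrelevant.\<close>
definition wint :: "real \<Rightarrow> real \<Rightarrow> (real^'n \<Rightarrow> real) \<Rightarrow> ennreal" where
  "wint d s u = (\<integral>\<^sup>+ x. ennreal (norm x powr d * \<bar>u x\<bar> powr s) \<partial>lebesgue)"

definition in_wL :: "real \<Rightarrow> real \<Rightarrow> (real^'n \<Rightarrow> real) \<Rightarrow> bool" where
  "in_wL d s u \<longleftrightarrow> u \<in> borel_measurable lebesgue \<and> wint d s u < \<infinity>"

text \<open>the (quasi-)norm ||u||_{d,s} (meaningful when in_wL d s u)\<close>
definition wnorm :: "real \<Rightarrow> real \<Rightarrow> (real^'n \<Rightarrow> real) \<Rightarrow> real" where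
  "wnorm d s u = (enn2real (wint d s u)) powr (1 / s)"

definition L1loc_punct :: "(real^'n \<Rightarrow> real) \<Rightarrow> bool" where
  "L1loc_punct u \<longleftrightarrow> u \<in> borel_measurable lebesgue \<and>
     (\<forall>K. compact K \<and> 0 \<notin> K \<longrightarrow> set_integrable lebesgue K u)"

text \<open>C^infinity functions: all iterated partial derivatives exist everywhere and are continuous.\<close>
definition smooth_fun :: "(real^'n \<Rightarrow> real) \<Rightarrow> bool" where
  "smooth_fun f \<longleftrightarrow> (\<exists>S. f \<in> S \<and> (\<forall>h\<in>S. continuous_on UNIV h) \<and>
     (\<forall>h\<in>S. \<forall>i. \<exists>h'\<in>S. \<forall>x. ((\<lambda>t. h (x + t *\<^sub>R axis i 1)) has_real_derivative h' x) (at 0)))"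

definition test_fun :: "(real^'n \<Rightarrow> real) \<Rightarrow> bool" where
  "test_fun \<phi> \<longleftrightarrow> smooth_fun \<phi> \<and> compact (closure {x. \<phi> x \<noteq> 0}) \<and> 0 \<notin> closure {x. \<phi> x \<noteq> 0}"

text \<open>g is the distributional radial derivative of u on R^N minus 0:
  <g, phi> = - <u, div(phi x/|x|)> = - <u, nabla phi . x/|x| + (N-1) phi/|x|>.\<close>
definition radial_deriv :: "(real^'n \<Rightarrow> real) \<Rightarrow> (real^'n \<Rightarrow> real) \<Rightarrow> bool" where
  "radial_deriv u g \<longleftrightarrow> L1loc_punct u \<and> L1loc_punct g \<and>
     (\<forall>\<phi>. test_fun \<phi> \<longrightarrow>
        (\<integral>x. g x * \<phi> x \<partial>lebesgue) =
        - (\<integral>x. u x * (deriv (\<lambda>t. \<phi> (x + t *\<^sub>R (x /\<^sub>R norm x))) 0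
                        + (real CARD('n) - 1) / norm x * \<phi> x) \<partial>lebesgue))"

definition inW :: "real \<Rightarrow> real \<Rightarrow> real \<Rightarrow> real \<Rightarrow> (real^'n \<Rightarrow> real) \<Rightarrow> (real^'n \<Rightarrow> real) \<Rightarrow> bool" where
  "inW a q b p u g \<longleftrightarrow> L1loc_punct u \<and> in_wL a q u \<and> radial_deriv u g \<and> in_wL b p g"

definition radial :: "(real^'n \<Rightarrow> real) \<Rightarrow> bool" where
  "radial u \<longleftrightarrow> (\<forall>x y. norm x = norm y \<longrightarrow> u x = u y)"

definition radial_embeds :: "'n::finite itself \<Rightarrow> real \<Rightarrow> real \<Rightarrow> real \<Rightarrow> real \<Rightarrow> real \<Rightarrow> real \<Rightarrow> bool" where
  "radial_embeds TYPE('n) a b c p q r \<longleftrightarrow>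
     (\<forall>(u::real^'n \<Rightarrow> real) g. radial u \<and> inW a q b p u g \<longrightarrow> in_wL c r u) \<and>
     (\<exists>C. \<forall>(u::real^'n \<Rightarrow> real) g. radial u \<and> inW a q b p u g \<longrightarrow>
          wnorm c r u \<le> C * (wnorm a q u + wnorm b p g))"

definition pw :: "real \<Rightarrow> real \<Rightarrow> real" where
  "pw x t = (if t = 0 then 1 else x powr t)"

end

theory Submission
  imports Defs "HOL-Real_Asymp.Real_Asymp"
begin

text \<open>
  In the variable $t = \ln |x|$ a radial function with radial derivative $g$ becomes
  $u(x) = v(\ln |x|)$, and with $\alpha = (a+N)/q$, $\beta = (b-p+N)/p$, $\gamma = (c+N)/r$ the three norms
  become $\| e^{\alpha t} v \|_q$, $\| e^{\beta t} v' \|_p$ and $\| e^{\gamma t} v \|_r$ on the line. The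
  measure $|x|^{-N} dx$ is pushed forward to a multiple of Lebesgue measure by $\ln |x|$, so
  it suffices to keep $h(x) = |x| |g(x)|$ on the original space and to know that the oscillation
  of $v$ over $[s,t]$ is at most the integral of $h$ over the annulus $s \le \ln |x| \le t$; no spherical average
  of $g$ is needed. This bound comes from the du Bois-Reymond lemma with test functions
  $|x|^{1-N} \zeta(\ln |x|)$.

  Sufficiency: Hoelder's inequality on intervals of length $\delta$ gives
  $|v(t)| \le C (\delta^{1-1/p} e^{-\beta t} + \delta^{-1/q} e^{-\alpha t})$, and $\delta$ is optimised; the
  end of the line where $v$ is controlled by $v'$ is handled by tail or growth estimates.
  Necessity: translated, concentrating and spreading bumps and functions that are constant near one end.
\<close>

section \<open>Weighted estimates on the line\<close>

text \<open>In these coordinates c^0, c^1 and -N correspond to \<gamma> = \<alpha>, \<gamma> =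
  \<beta> and \<gamma> = 0, so all alternatives are about the order of \<alpha>, \<beta>, \<gamma>
  and 0. The value breve theta comes from balancing the two terms of the pointwise bound: with k = 1
  - 1/p + 1/q the best length is e^{(\<beta>-\<alpha>)t/k}, which gives |v(t)| <= C e^{-(\<alpha> +
  (\<beta>-\<alpha>)/(qk)) t}, and qk = q/p' + 1. Spending this bound on |v|^{r-q} and the norm of u
  on |v|^q costs exactly the inequality between theta_c and breve theta. The balance works only at
  the end of the line where that length is at most 1, since over longer intervals the weights
  themselves vary too much; at the other end the signs of the exponents decide, because constants
  may have finite norm there. The derivative g is not assumed radial and u is only Lebesgue
  measurable, so a Borel profile of u must be constructed before any of this applies.\<close>

definition expint :: "real \<Rightarrow> real \<Rightarrow> (real \<Rightarrow> real) \<Rightarrow> ennreal" where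
  "expint k s f = (\<integral>\<^sup>+t. ennreal (exp (k * s * t) * \<bar>f t\<bar> powr s) \<partial>lborel)"

section \<open>Hoelder's inequality and exponential integrals\<close>

lemma powr_mult_le_convex_comb:
  fixes x y l :: real
  assumes "0 \<le> x" "0 \<le> y" "0 \<le> l" "l \<le> 1"
  shows "x powr l * y powr (1 - l) \<le> l * x + (1 - l) * y"
proof (cases "x = 0 \<or> y = 0")
  case True
  then show ?thesis using assms by auto
next
  case False
  then show ?thesis using Youngs_inequality_0[of l "1 - l" x y] assms by auto
qed

text \<open>Young's inequality for f / A and g / B is integrated. Upper bounds A and B stand where
  the textbook has the integrals themselves, so vanishing or infinite integrals need no separate
  treatment.\<close>

lemma nn_integral_Holder_powr_pos:
  fixes f g :: "'a \<Rightarrow> real"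
  assumes [measurable]: "f \<in> borel_measurable M" "g \<in> borel_measurable M"
    and nn: "\<And>x. 0 \<le> f x" "\<And>x. 0 \<le> g x"
    and le: "(\<integral>\<^sup>+x. ennreal (f x) \<partial>M) \<le> ennreal A" "(\<integral>\<^sup>+x. ennreal (g x) \<partial>M) \<le> ennreal B"
    and pos: "0 < A" "0 < B" and l: "0 \<le> l" "l \<le> 1"
  shows "(\<integral>\<^sup>+x. ennreal (f x powr l * g x powr (1 - l)) \<partial>M) \<le> ennreal (A powr l * B powr (1 - l))"
proof -
  let ?P = "A powr l * B powr (1 - l)"
  have P: "0 \<le> ?P" by simp
  have "f x powr l * g x powr (1 - l) \<le> ?P * l / A * f x + ?P * (1 - l) / B * g x" for x
  proof -
    have "(f x / A) powr l * (g x / B) powr (1 - l) \<le> l * (f x / A) + (1 - l) * (g x / B)"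
      by (intro powr_mult_le_convex_comb) (use nn pos l in auto)
    then have "?P * ((f x / A) powr l * (g x / B) powr (1 - l)) \<le> ?P * (l * (f x / A) + (1 - l) * (g x / B))"
      using P by (intro mult_left_mono)
    moreover have "?P * ((f x / A) powr l * (g x / B) powr (1 - l)) = f x powr l * g x powr (1 - l)"
      using pos nn[of x] by (simp add: powr_divide)
    ultimately show ?thesis by (simp add: algebra_simps)
  qed
  then have "(\<integral>\<^sup>+x. ennreal (f x powr l * g x powr (1 - l)) \<partial>M)
    \<le> (\<integral>\<^sup>+x. ennreal (?P * l / A) * ennreal (f x) + ennreal (?P * (1 - l) / B) * ennreal (g x) \<partial>M)"
    using pos l nn P by (intro nn_integral_mono)
      (auto simp: ennreal_mult[symmetric] ennreal_plus[symmetric] simp del: ennreal_plus intro!: ennreal_leI)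
  also have "\<dots> = ennreal (?P * l / A) * (\<integral>\<^sup>+x. ennreal (f x) \<partial>M) + ennreal (?P * (1 - l) / B) * (\<integral>\<^sup>+x. ennreal (g x) \<partial>M)"
    by (simp add: nn_integral_add nn_integral_cmult)
  also have "\<dots> \<le> ennreal (?P * l / A) * ennreal A + ennreal (?P * (1 - l) / B) * ennreal B"
    by (intro add_mono mult_left_mono le) auto
  also have "\<dots> = ennreal (?P * l / A * A + ?P * (1 - l) / B * B)"
    using pos l P by (simp add: ennreal_mult[symmetric] ennreal_plus[symmetric] del: ennreal_plus)
  also have "?P * l / A * A + ?P * (1 - l) / B * B = ?P"
    using pos by (simp add: field_simps)
  finally show ?thesis .
qed

text \<open>To admit A = 0, the previous bound is used with A + e and e tends to 0. The limit rests
  on l > 0: since \<open>0 powr 0 = 0\<close>, the function \<open>(A + e) powr 0\<close> would jump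
  at A + e = 0.\<close>

lemma nn_integral_Holder_powr:
  fixes f g :: "'a \<Rightarrow> real"
  assumes m: "f \<in> borel_measurable M" "g \<in> borel_measurable M"
    and nn: "\<And>x. 0 \<le> f x" "\<And>x. 0 \<le> g x"
    and le: "(\<integral>\<^sup>+x. ennreal (f x) \<partial>M) \<le> ennreal A" "(\<integral>\<^sup>+x. ennreal (g x) \<partial>M) \<le> ennreal B"
    and pos: "0 \<le> A" "0 < B" and l: "0 < l" "l \<le> 1"
  shows "(\<integral>\<^sup>+x. ennreal (f x powr l * g x powr (1 - l)) \<partial>M) \<le> ennreal (A powr l * B powr (1 - l))"
proof (rule tendsto_lowerbound)
  show "((\<lambda>e. ennreal ((A + e) powr l * B powr (1 - l))) \<longlongrightarrow> ennreal (A powr l * B powr (1 - l))) (at_right 0)"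
    by (rule tendsto_eq_intros refl | (use pos l in \<open>force simp: eventually_at_filter\<close>))+
  show "eventually (\<lambda>e. (\<integral>\<^sup>+x. ennreal (f x powr l * g x powr (1 - l)) \<partial>M) \<le> ennreal ((A + e) powr l * B powr (1 - l))) (at_right 0)"
    unfolding eventually_at_right_field
  proof (intro exI[of _ 1] conjI allI impI)
    fix e :: real assume e: "0 < e"
    show "(\<integral>\<^sup>+x. ennreal (f x powr l * g x powr (1 - l)) \<partial>M) \<le> ennreal ((A + e) powr l * B powr (1 - l))"
      by (rule nn_integral_Holder_powr_pos[OF m nn])
         (use e pos l in \<open>auto intro!: order_trans[OF le(1)] le(2) ennreal_leI\<close>)
  qed simp
qed simp

lemma nn_integral_exp_atLeast:
  assumes "0 < k"
  shows "(\<integral>\<^sup>+t. ennreal (indicator {a..} t * exp (- k * t)) \<partial>lborel) = ennreal (exp (- k * a) / k)"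
proof -
  have "(\<integral>\<^sup>+t. ennreal (exp (- k * t)) * indicator {a..} t \<partial>lborel) = ennreal (0 - (- exp (- k * a) / k))"
  proof (rule nn_integral_FTC_atLeast)
    show "((\<lambda>t. - exp (- k * t) / k) has_real_derivative exp (- k * x)) (at x)" for x
      using assms by (auto intro!: derivative_eq_intros)
    show "((\<lambda>t. - exp (- k * t) / k) \<longlongrightarrow> 0) at_top"
      using assms by real_asymp
  qed auto
  moreover have "ennreal (indicator {a..} t * exp (- k * t)) = ennreal (exp (- k * t)) * indicator {a..} t" for t
    by (simp add: indicator_def)
  ultimately show ?thesis by simp
qed

text \<open>This is the constant that Hoelder's inequality produces when the weight has integral e /
  b and the energy is at most e; the tail and the growth estimate both lead to it.\<close>

lemma divide_powr_mult_powr: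
  fixes b e p :: real
  assumes "0 < b" "0 < e"
  shows "(e / b) powr (1 - 1 / p) * e powr (1 / p) = b powr - (1 - 1 / p) * e"
proof -
  have "e powr (1 - 1 / p) * e powr (1 / p) = e"
    using assms by (subst powr_add[symmetric]) simp
  moreover have "(e / b) powr (1 - 1 / p) = b powr - (1 - 1 / p) * e powr (1 - 1 / p)"
    unfolding powr_minus_divide
    using assms by (simp add: powr_divide powr_minus_divide)
  ultimately show ?thesis by (simp add: mult.assoc)
qed

lemma emeasure_lborel_atLeast: "emeasure lborel {a::real..} = \<infinity>"
proof (rule ccontr)
  assume "emeasure lborel {a..} \<noteq> \<infinity>"
  then obtain x where x: "0 \<le> x" "emeasure lborel {a..} = ennreal x"
    by (cases "emeasure lborel {a..}") auto
  have "ennreal (x + 1) = emeasure lborel {a..a + (x + 1)}" using x by simp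
  also have "\<dots> \<le> emeasure lborel {a..}" by (intro emeasure_mono) auto
  finally show False using x by (simp add: ennreal_le_iff)
qed

lemma nn_integral_lborel_uminus:
  fixes f :: "real \<Rightarrow> ennreal"
  assumes [measurable]: "f \<in> borel_measurable borel"
  shows "(\<integral>\<^sup>+t. f (- t) \<partial>lborel) = (\<integral>\<^sup>+t. f t \<partial>lborel)"
  by (subst (2) lborel_distr_uminus[symmetric]) (simp add: nn_integral_distr)

lemma nn_integral_exp_atMost:
  assumes "0 < k"
  shows "(\<integral>\<^sup>+t. ennreal (indicator {..a} t * exp (k * t)) \<partial>lborel) = ennreal (exp (k * a) / k)"
proof -
  have "(\<integral>\<^sup>+t. ennreal (indicator {..a} t * exp (k * t)) \<partial>lborel)
      = (\<integral>\<^sup>+t. ennreal (indicator {..a} (-t) * exp (k * (-t))) \<partial>lborel)"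
    by (rule nn_integral_lborel_uminus[symmetric]) simp
  also have "\<dots> = (\<integral>\<^sup>+t. ennreal (indicator {-a..} t * exp (- k * t)) \<partial>lborel)"
    by (intro nn_integral_cong) (auto simp: indicator_def)
  finally show ?thesis using nn_integral_exp_atLeast[OF assms, of "-a"] by simp
qed

lemma expint_uminus:
  assumes "f \<in> borel_measurable borel"
  shows "expint k s (\<lambda>t. f (- t)) = expint (- k) s f"
  unfolding expint_def
  using nn_integral_lborel_uminus[of "\<lambda>t. ennreal (exp (- k * s * t) * \<bar>f t\<bar> powr s)"] assms by simp

lemma expint_scale:
  assumes "f \<in> borel_measurable borel" "0 < l"
  shows "expint k s (\<lambda>t. f t / l) = ennreal (l powr (-s)) * expint k s f"
  unfolding expint_def
  using assms by (subst nn_integral_cmult[symmetric])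
    (auto simp: ennreal_mult[symmetric] powr_divide powr_minus abs_mult field_simps intro!: nn_integral_cong arg_cong[where f=ennreal])

text \<open>\<open>T\<close> plays the role of ln |x| and \<open>h\<close> that of |x| |g(x)|, left
  on the original space. Since the weights depend on \<open>T\<close> alone, Hoelder's inequality is
  applied on \<open>M\<close> and only the integral of the weight is moved to the line by
  \<open>distr_T\<close>. The bound \<open>osc\<close> replaces the statement that \<open>v\<close>
  has a derivative of size \<open>h\<close>. Sigma-finiteness serves the exchange of integrals in
  Hardy's inequality.\<close>

locale fibred_primitive = sigma_finite_measure M for M :: "'a measure" +
  fixes T h :: "'a \<Rightarrow> real" and v :: "real \<Rightarrow> real"
  assumes T_meas[measurable]: "T \<in> borel_measurable M"
    and distr_T: "distr M borel T = lborel"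
    and h_meas[measurable]: "h \<in> borel_measurable M"
    and v_meas[measurable]: "v \<in> borel_measurable borel"
    and h_nonneg: "\<And>x. 0 \<le> h x"
    and osc: "\<And>s t. s \<le> t \<Longrightarrow> ennreal \<bar>v t - v s\<bar> \<le> (\<integral>\<^sup>+x. ennreal (indicator {s..t} (T x) * h x) \<partial>M)"

lemma fibred_primitive_scale:
  assumes "fibred_primitive M T h v" "0 < l"
  shows "fibred_primitive M T (\<lambda>x. h x / l) (\<lambda>t. v t / l)"
proof -
  interpret fibred_primitive M T h v by fact
  show ?thesis
  proof
    fix s t :: real assume st: "s \<le> t"
    have "ennreal \<bar>v t / l - v s / l\<bar> = ennreal (1 / l) * ennreal \<bar>v t - v s\<bar>"
      using assms(2) by (simp add: ennreal_mult[symmetric] abs_mult diff_divide_distrib[symmetric])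
    also have "\<dots> \<le> ennreal (1 / l) * (\<integral>\<^sup>+x. ennreal (indicator {s..t} (T x) * h x) \<partial>M)"
      by (intro mult_left_mono osc[OF st]) auto
    also have "\<dots> = (\<integral>\<^sup>+x. ennreal (indicator {s..t} (T x) * (h x / l)) \<partial>M)"
      using assms(2) h_nonneg by (subst nn_integral_cmult[symmetric])
        (auto simp: ennreal_mult[symmetric] intro!: nn_integral_cong)
    finally show "ennreal \<bar>v t / l - v s / l\<bar> \<le> (\<integral>\<^sup>+x. ennreal (indicator {s..t} (T x) * (h x / l)) \<partial>M)" .
  qed (use assms(2) h_nonneg distr_T in auto)
qed

text \<open>Reversing the line corresponds to inverting |x|. It changes the sign of all exponents,
  so that each estimate has to be proved for one ordering of them only.\<close>

lemma fibred_primitive_reflect: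
  assumes "fibred_primitive M T h v"
  shows "fibred_primitive M (\<lambda>x. - T x) h (\<lambda>t. v (- t))"
proof -
  interpret fibred_primitive M T h v by fact
  show ?thesis
  proof
    have "distr M borel (\<lambda>x. - T x) = distr (distr M borel T) borel uminus"
      by (subst distr_distr) (auto simp: comp_def)
    then show "distr M borel (\<lambda>x. - T x) = lborel"
      by (simp add: distr_T lborel_distr_uminus)
    fix s t :: real assume st: "s \<le> t"
    have "ennreal \<bar>v (-t) - v (-s)\<bar> \<le> (\<integral>\<^sup>+x. ennreal (indicator {-t..-s} (T x) * h x) \<partial>M)"
      using osc[of "-t" "-s"] st by (simp add: abs_minus_commute)
    also have "\<dots> = (\<integral>\<^sup>+x. ennreal (indicator {s..t} (- T x) * h x) \<partial>M)"
      by (intro nn_integral_cong) (auto simp: indicator_def)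
    finally show "ennreal \<bar>v (-t) - v (-s)\<bar> \<le> (\<integral>\<^sup>+x. ennreal (indicator {s..t} (- T x) * h x) \<partial>M)" .
  qed (use h_nonneg in auto)
qed

context fibred_primitive begin

lemma nn_integral_T:
  assumes "f \<in> borel_measurable borel"
  shows "(\<integral>\<^sup>+x. f (T x) \<partial>M) = (\<integral>\<^sup>+t. f t \<partial>lborel)"
  using assms by (subst distr_T[symmetric]) (simp add: nn_integral_distr)

text \<open>On \<open>S\<close>, h is the product of (e^{k(p-1)T} h^p)^{1/p} and (e^{-kT})^{1-1/p},
  with k at the caller's disposal: 0 on bounded intervals, b on a tail, an auxiliary negative b' for
  growth.\<close>

lemma integral_h_Holder:
  assumes p: "1 \<le> p" and S[measurable]: "S \<in> sets borel" and K: "0 < K"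
    and K1: "(\<integral>\<^sup>+t. ennreal (indicator S t * exp (- k * t)) \<partial>lborel) \<le> ennreal K"
    and L: "0 \<le> L" "(\<integral>\<^sup>+x. ennreal (indicator S (T x) * (exp (k * (p - 1) * T x) * h x powr p)) \<partial>M) \<le> ennreal L"
  shows "(\<integral>\<^sup>+x. ennreal (indicator S (T x) * h x) \<partial>M) \<le> ennreal (K powr (1 - 1 / p) * L powr (1 / p))"
proof -
  have "(\<integral>\<^sup>+x. ennreal (indicator S (T x) * h x) \<partial>M)
    = (\<integral>\<^sup>+x. ennreal ((indicator S (T x) * (exp (k * (p - 1) * T x) * h x powr p)) powr (1 / p) *
         (indicator S (T x) * exp (- k * T x)) powr (1 - 1 / p)) \<partial>M)"
  proof (intro nn_integral_cong arg_cong[where f=ennreal])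
    fix x
    have e: "exp (k * (p - 1) * T x) powr (1 / p) * exp (- k * T x) powr (1 - 1 / p) = 1"
      using p by (simp add: exp_powr_real exp_add[symmetric]) (simp add: field_simps)
    have "(h x powr p) powr (1 / p) = h x" using p h_nonneg[of x] by (simp add: powr_powr)
    with e show "indicator S (T x) * h x = (indicator S (T x) * (exp (k * (p - 1) * T x) * h x powr p)) powr (1 / p) *
         (indicator S (T x) * exp (- k * T x)) powr (1 - 1 / p)"
      by (simp add: indicator_def powr_mult mult.assoc mult.left_commute mult.commute)
  qed
  also have "\<dots> \<le> ennreal (L powr (1 / p) * K powr (1 - 1 / p))"
  proof (rule nn_integral_Holder_powr)
    have "(\<integral>\<^sup>+x. ennreal (indicator S (T x) * exp (- k * T x)) \<partial>M) = (\<integral>\<^sup>+t. ennreal (indicator S t * exp (- k * t)) \<partial>lborel)"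
      by (rule nn_integral_T) simp
    then show "(\<integral>\<^sup>+x. ennreal (indicator S (T x) * exp (- k * T x)) \<partial>M) \<le> ennreal K"
      using K1 by simp
  qed (use p K L in auto)
  finally show ?thesis by (simp add: mult.commute)
qed

lemma weighted_integral_le:
  assumes H: "(\<integral>\<^sup>+x. ennreal (exp (b * p * T x) * h x powr p) \<partial>M) \<le> 1"
    and [measurable]: "S \<in> sets borel" and C: "0 \<le> C"
    and le: "\<And>t. t \<in> S \<Longrightarrow> exp (k * t) \<le> C * exp (b * p * t)"
  shows "(\<integral>\<^sup>+x. ennreal (indicator S (T x) * (exp (k * T x) * h x powr p)) \<partial>M) \<le> ennreal C"
proof -
  have "(\<integral>\<^sup>+x. ennreal (indicator S (T x) * (exp (k * T x) * h x powr p)) \<partial>M)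
     \<le> (\<integral>\<^sup>+x. ennreal C * ennreal (exp (b * p * T x) * h x powr p) \<partial>M)"
    using C le by (intro nn_integral_mono)
      (auto simp: ennreal_mult[symmetric] indicator_def mult.assoc[symmetric] intro!: ennreal_leI mult_right_mono)
  also have "\<dots> = ennreal C * (\<integral>\<^sup>+x. ennreal (exp (b * p * T x) * h x powr p) \<partial>M)"
    by (simp add: nn_integral_cmult)
  also have "\<dots> \<le> ennreal C * 1" by (intro mult_left_mono H) auto
  finally show ?thesis by simp
qed

text \<open>Hoelder's inequality with k = b: on the tail e^{b(p-1)s} <= e^{-bt} e^{bps}, so the
  energy is at most e^{-bt}, of the same order as the weight integral e^{-bt} / b.\<close>

lemma integral_h_tail:
  assumes p: "1 \<le> p" and b: "0 < b" and H: "(\<integral>\<^sup>+x. ennreal (exp (b * p * T x) * h x powr p) \<partial>M) \<le> 1"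
  shows "(\<integral>\<^sup>+x. ennreal (indicator {t..} (T x) * h x) \<partial>M) \<le> ennreal (b powr - (1 - 1 / p) * exp (- b * t))"
proof -
  have "(\<integral>\<^sup>+x. ennreal (indicator {t..} (T x) * h x) \<partial>M)
      \<le> ennreal ((exp (- b * t) / b) powr (1 - 1 / p) * exp (- b * t) powr (1 / p))"
  proof (rule integral_h_Holder[OF p])
    show "(\<integral>\<^sup>+s. ennreal (indicator {t..} s * exp (- b * s)) \<partial>lborel) \<le> ennreal (exp (- b * t) / b)"
      using nn_integral_exp_atLeast[OF b, of t] by simp
    show "(\<integral>\<^sup>+x. ennreal (indicator {t..} (T x) * (exp (b * (p - 1) * T x) * h x powr p)) \<partial>M) \<le> ennreal (exp (- b * t))"
      using b by (intro weighted_integral_le[OF H]) (auto simp: exp_add[symmetric] algebra_simps)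
  qed (use b in auto)
  also have "(exp (- b * t) / b) powr (1 - 1 / p) * exp (- b * t) powr (1 / p) = b powr - (1 - 1 / p) * exp (- b * t)"
    using b by (intro divide_powr_mult_powr) auto
  finally show ?thesis .
qed

text \<open>With k = 0 the weight integral is the length d, and freezing the weight of the energy at
  t costs the factor e^{|b| d}. This factor is harmless for d <= 1 and absent for b = 0, the two
  situations in which the bound is used.\<close>

lemma osc_local:
  assumes p: "1 \<le> p" and d: "0 < d" and H: "(\<integral>\<^sup>+x. ennreal (exp (b * p * T x) * h x powr p) \<partial>M) \<le> 1"
    and s: "t \<le> s" "s \<le> t + d"
  shows "\<bar>v t - v s\<bar> \<le> d powr (1 - 1 / p) * exp (\<bar>b\<bar> * d - b * t)"
proof -
  have "ennreal \<bar>v t - v s\<bar> \<le> (\<integral>\<^sup>+x. ennreal (indicator {t..s} (T x) * h x) \<partial>M)"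
    using osc[OF s(1)] by (simp add: abs_minus_commute)
  also have "\<dots> \<le> (\<integral>\<^sup>+x. ennreal (indicator {t..t + d} (T x) * h x) \<partial>M)"
    using s h_nonneg by (intro nn_integral_mono ennreal_leI) (auto simp: indicator_def)
  also have "\<dots> \<le> ennreal (d powr (1 - 1 / p) * exp (p * (\<bar>b\<bar> * d - b * t)) powr (1 / p))"
  proof (rule integral_h_Holder[OF p, where k=0])
    have "(\<integral>\<^sup>+s. ennreal (indicator {t..t + d} s * exp (- 0 * s)) \<partial>lborel) = (\<integral>\<^sup>+s. indicator {t..t + d} s \<partial>lborel)"
      by (intro nn_integral_cong) (simp add: indicator_def)
    then show "(\<integral>\<^sup>+s. ennreal (indicator {t..t + d} s * exp (- 0 * s)) \<partial>lborel) \<le> ennreal d"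
      using d by simp
    have "0 \<le> \<bar>b\<bar> * d - b * t + b * s" if "t \<le> s" "s \<le> t + d" for s
    proof -
      have "b * (t - s) \<le> \<bar>b\<bar> * \<bar>t - s\<bar>" by (metis abs_ge_self abs_mult)
      also have "\<dots> \<le> \<bar>b\<bar> * d" using that by (intro mult_left_mono) auto
      finally show ?thesis by (simp add: algebra_simps)
    qed
    then have 0: "0 \<le> p * (\<bar>b\<bar> * d - b * t + b * s)" if "t \<le> s" "s \<le> t + d" for s
      using p that by simp
    have "exp (0 * (p - 1) * s) \<le> exp (p * (\<bar>b\<bar> * d - b * t)) * exp (b * p * s)" if "t \<le> s" "s \<le> t + d" for s
      using 0[of s] that by (subst exp_add[symmetric]) (simp add: ring_distribs mult_ac)
    then show "(\<integral>\<^sup>+x. ennreal (indicator {t..t + d} (T x) * (exp (0 * (p - 1) * T x) * h x powr p)) \<partial>M)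
        \<le> ennreal (exp (p * (\<bar>b\<bar> * d - b * t)))"
      using weighted_integral_le[OF H, of "{t..t+d}" "exp (p * (\<bar>b\<bar> * d - b * t))" 0] by simp
  qed (use d in auto)
  also have "exp (p * (\<bar>b\<bar> * d - b * t)) powr (1 / p) = exp (\<bar>b\<bar> * d - b * t)"
    using p by (simp add: exp_powr_real)
  finally show ?thesis by (subst (asm) ennreal_le_iff) auto
qed

text \<open>On [0, t] the exponent b may be lowered to b', and a negative b' makes the integral of
  e^{-b's} comparable to its value at the right end. The rate -b' is harmless as long as b' stays
  above the target exponent.\<close>

lemma osc_growth:
  assumes p: "1 \<le> p" and b: "b' < 0" "b' \<le> b" and H: "(\<integral>\<^sup>+x. ennreal (exp (b * p * T x) * h x powr p) \<partial>M) \<le> 1"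
    and t: "0 \<le> t"
  shows "\<bar>v t - v 0\<bar> \<le> (- b') powr - (1 - 1 / p) * exp (- b' * t)"
proof -
  have "ennreal \<bar>v t - v 0\<bar> \<le> (\<integral>\<^sup>+x. ennreal (indicator {0..t} (T x) * h x) \<partial>M)"
    using osc[OF t] .
  also have "\<dots> \<le> ennreal ((exp (- b' * t) / (- b')) powr (1 - 1 / p) * exp (- b' * t) powr (1 / p))"
  proof (rule integral_h_Holder[OF p, where k=b'])
    have "(\<integral>\<^sup>+s. ennreal (indicator {0..t} s * exp (- b' * s)) \<partial>lborel) \<le> (\<integral>\<^sup>+s. ennreal (indicator {..t} s * exp ((- b') * s)) \<partial>lborel)"
      by (intro nn_integral_mono ennreal_leI) (auto simp: indicator_def)
    also have "\<dots> = ennreal (exp (- b' * t) / (- b'))"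
      using nn_integral_exp_atMost[of "-b'" t] b by simp
    finally show "(\<integral>\<^sup>+s. ennreal (indicator {0..t} s * exp (- b' * s)) \<partial>lborel) \<le> ennreal (exp (- b' * t) / (- b'))" .
    show "(\<integral>\<^sup>+x. ennreal (indicator {0..t} (T x) * (exp (b' * (p - 1) * T x) * h x powr p)) \<partial>M) \<le> ennreal (exp (- b' * t))"
    proof (rule weighted_integral_le[OF H])
      fix s assume s: "s \<in> {0..t}"
      have "b' * (p * s) \<le> b * (p * s)" using b s p by (intro mult_right_mono) auto
      moreover have "b' * t \<le> b' * s" using b s by (intro mult_left_mono_neg) auto
      ultimately show "exp (b' * (p - 1) * s) \<le> exp (- b' * t) * exp (b * p * s)"
        by (subst exp_add[symmetric]) (simp add: algebra_simps)
    qed auto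
  qed (use b in \<open>auto intro: divide_pos_neg\<close>)
  also have "(exp (- b' * t) / (- b')) powr (1 - 1 / p) * exp (- b' * t) powr (1 / p) = (- b') powr - (1 - 1 / p) * exp (- b' * t)"
    using b by (intro divide_powr_mult_powr) auto
  finally show ?thesis by (subst (asm) ennreal_le_iff) auto
qed

text \<open>Chebyshev's inequality: if |v| exceeded the bound on the whole interval, the weighted
  integral would be at least 2 Q^q. The factor 2 in the constant is there to contradict the bound
  Q^q.\<close>

lemma ex_small_value:
  assumes q: "0 < q" and d: "0 < d" and Q: "0 < Q" and U: "expint a q v \<le> ennreal (Q powr q)"
  shows "\<exists>s. t \<le> s \<and> s \<le> t + d \<and> \<bar>v s\<bar> \<le> (2 / d) powr (1 / q) * Q * exp (\<bar>a\<bar> * d - a * t)"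
proof (rule ccontr)
  assume neg: "\<not> ?thesis"
  let ?X = "(2 / d) powr (1 / q) * Q * exp (\<bar>a\<bar> * d - a * t)"
  have X: "0 < ?X" using d Q by simp
  have low: "(2 / d) * Q powr q \<le> exp (a * q * s) * \<bar>v s\<bar> powr q" if "t \<le> s" "s \<le> t + d" for s
  proof -
    have "a * (t - s) \<le> \<bar>a\<bar> * \<bar>t - s\<bar>" by (metis abs_ge_self abs_mult)
    also have "\<dots> \<le> \<bar>a\<bar> * d" using that by (intro mult_left_mono) auto
    finally have "0 \<le> q * (\<bar>a\<bar> * d - a * t + a * s)"
      using q by (intro mult_nonneg_nonneg) (auto simp: right_diff_distrib)
    then have e: "1 \<le> exp (a * q * s) * exp (q * (\<bar>a\<bar> * d - a * t))"
      by (subst exp_add[symmetric]) (simp add: ring_distribs mult_ac)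
    have "?X powr q = (2 / d) * Q powr q * exp (q * (\<bar>a\<bar> * d - a * t))"
      using q d Q by (simp add: powr_mult powr_powr exp_powr_real mult.commute)
    then have "exp (a * q * s) * ?X powr q = (2 / d) * Q powr q * (exp (a * q * s) * exp (q * (\<bar>a\<bar> * d - a * t)))"
      by simp
    also have "\<dots> \<ge> (2 / d) * Q powr q * 1"
      using d e by (intro mult_left_mono) auto
    finally have "(2 / d) * Q powr q \<le> exp (a * q * s) * ?X powr q" by simp
    also have "\<dots> \<le> exp (a * q * s) * \<bar>v s\<bar> powr q"
      using neg that X q by (intro mult_left_mono powr_mono2) force+
    finally show ?thesis .
  qed
  have "ennreal (2 * Q powr q) = ennreal ((2 / d) * Q powr q) * emeasure lborel {t..t+d}"
    using d by (simp add: ennreal_mult[symmetric])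
  also have "\<dots> = (\<integral>\<^sup>+s. ennreal ((2 / d) * Q powr q) * indicator {t..t+d} s \<partial>lborel)"
    by (simp add: nn_integral_cmult)
  also have "\<dots> \<le> expint a q v"
    unfolding expint_def using low by (intro nn_integral_mono) (auto simp: indicator_def intro!: ennreal_leI)
  also have "\<dots> \<le> ennreal (Q powr q)" by fact
  finally show False using Q by (simp add: ennreal_le_iff)
qed

lemma pointwise_bound:
  assumes p: "1 \<le> p" and q: "0 < q" and d: "0 < d" and Q: "0 < Q"
    and U: "expint a q v \<le> ennreal (Q powr q)"
    and H: "(\<integral>\<^sup>+x. ennreal (exp (b * p * T x) * h x powr p) \<partial>M) \<le> 1"
  shows "\<bar>v t\<bar> \<le> d powr (1 - 1 / p) * exp (\<bar>b\<bar> * d - b * t) + (2 / d) powr (1 / q) * Q * exp (\<bar>a\<bar> * d - a * t)"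
proof -
  obtain s where s: "t \<le> s" "s \<le> t + d" "\<bar>v s\<bar> \<le> (2 / d) powr (1 / q) * Q * exp (\<bar>a\<bar> * d - a * t)"
    using ex_small_value[OF q d Q U] by blast
  show ?thesis using osc_local[OF p d H s(1,2)] s(3) by linarith
qed

text \<open>For a >= 0 a finite integral forbids |v| to stay above a positive level towards
  +infinity, so the value at t must be used up by the oscillation on [t, infinity).\<close>

lemma abs_le_integral_tail:
  assumes a: "0 \<le> a" and q: "0 < q" and U: "expint a q v < \<infinity>"
  shows "ennreal \<bar>v t\<bar> \<le> (\<integral>\<^sup>+x. ennreal (indicator {t..} (T x) * h x) \<partial>M)" (is "_ \<le> ?I")
proof (rule ccontr)
  assume "\<not> ?thesis"
  then have less: "?I < ennreal \<bar>v t\<bar>" by simp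
  then obtain x where x: "0 \<le> x" "?I = ennreal x"
    by (metis ennreal_cases less_top_ennreal order_less_trans top_greatest not_less_iff_gr_or_eq ennreal_less_top)
  define e where "e = \<bar>v t\<bar> - x"
  have e: "0 < e" using less x by (simp add: e_def ennreal_less_iff)
  have low: "e \<le> \<bar>v s\<bar>" if "t \<le> s" for s
  proof -
    have "ennreal \<bar>v s - v t\<bar> \<le> (\<integral>\<^sup>+x. ennreal (indicator {t..s} (T x) * h x) \<partial>M)"
      by (rule osc[OF that])
    also have "\<dots> \<le> ?I"
      using h_nonneg by (intro nn_integral_mono ennreal_leI) (auto simp: indicator_def)
    finally have "\<bar>v s - v t\<bar> \<le> x" using x by simp
    then show ?thesis unfolding e_def by linarith
  qed
  \<comment> \<open>The half-line starts at \<open>max t 0\<close> because \<open>low\<close> needs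
    s >= t while e^{aqs} >= 1 needs s >= 0.\<close>
  have "ennreal (e powr q) * emeasure lborel {max t 0..} = (\<integral>\<^sup>+s. ennreal (e powr q) * indicator {max t 0..} s \<partial>lborel)"
    by (simp add: nn_integral_cmult)
  also have "\<dots> \<le> expint a q v"
    unfolding expint_def
  proof (intro nn_integral_mono)
    fix s :: real
    have "e powr q \<le> exp (a * q * s) * \<bar>v s\<bar> powr q" if "t \<le> s" "0 \<le> s"
    proof -
      have "1 * e powr q \<le> exp (a * q * s) * \<bar>v s\<bar> powr q"
        using a q that e low[of s] by (intro mult_mono powr_mono2) auto
      then show ?thesis by simp
    qed
    then show "ennreal (e powr q) * indicator {max t 0..} s \<le> ennreal (exp (a * q * s) * \<bar>v s\<bar> powr q)"
      by (auto simp: indicator_def intro!: ennreal_leI)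
  qed
  finally have "ennreal (e powr q) * emeasure lborel {max t 0..} < \<infinity>" using U by (rule le_less_trans)
  moreover have "emeasure lborel {max t 0..} = \<infinity>" by (rule emeasure_lborel_atLeast)
  ultimately show False using e by (simp add: ennreal_mult_top)
qed

end

section \<open>Subcritical exponents\<close>

context fibred_primitive begin

lemma pointwise_bound_nonpos:
  assumes p: "1 \<le> p" and q: "0 < q" and ab: "a \<le> b" and t: "t \<le> 0"
    and U: "expint a q v \<le> 1"
    and H: "(\<integral>\<^sup>+x. ennreal (exp (b * p * T x) * h x powr p) \<partial>M) \<le> 1"
  shows "\<bar>v t\<bar> \<le> (exp \<bar>b\<bar> + 2 powr (1 / q) * exp \<bar>a\<bar>) * exp (- (a + (b - a) / (q * (1 - 1 / p) + 1)) * t)"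
proof -
  define k where "k = 1 - 1 / p + 1 / q"
  \<comment> \<open>The solution of d^{1-1/p} e^{-bt} = d^{-1/q} e^{-at}, which equalises the two
    terms of \<open>pointwise_bound\<close>. As a <= b and t <= 0 it is at most 1, so the factors
    e^{|b| d} and e^{|a| d} stay bounded.\<close>
  define d where "d = exp ((b - a) * t / k)"
  have k: "0 < k" using p q by (auto simp: k_def intro!: add_nonneg_pos)
  have kq: "q * (1 - 1 / p) + 1 = q * k" using q by (simp add: k_def algebra_simps)
  have d: "0 < d" "d \<le> 1" using ab t k by (auto simp: d_def divide_le_0_iff mult_le_0_iff)
  let ?g = "a + (b - a) / (q * (1 - 1 / p) + 1)"
  have g: "?g = a + (b - a) / (q * k)" using kq by simp
  have "(b - a) * t / k * (1 - 1 / p) = (b - a) * t / k * (k - 1 / q)" by (simp add: k_def)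
  also have "\<dots> = (b - a) * t - (b - a) * t / (q * k)" using k q by (simp add: field_simps)
  finally have e1: "(b - a) * t / k * (1 - 1 / p) + - b * t = - ?g * t"
    unfolding g by (simp add: algebra_simps)
  have "\<bar>v t\<bar> \<le> d powr (1 - 1 / p) * exp (\<bar>b\<bar> * d - b * t) + (2 / d) powr (1 / q) * 1 * exp (\<bar>a\<bar> * d - a * t)"
    using pointwise_bound[OF p q d(1) _ _ H, of 1 a t] U by simp
  also have "d powr (1 - 1 / p) * exp (\<bar>b\<bar> * d - b * t) = exp (\<bar>b\<bar> * d) * exp (- ?g * t)"
    unfolding d_def using e1 by (simp add: exp_powr_real exp_add[symmetric] algebra_simps)
  also have "(2 / d) powr (1 / q) * 1 * exp (\<bar>a\<bar> * d - a * t) = 2 powr (1 / q) * (d powr - (1 / q) * exp (\<bar>a\<bar> * d - a * t))"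
    using d unfolding powr_minus_divide by (simp add: powr_divide)
  also have "d powr - (1 / q) * exp (\<bar>a\<bar> * d - a * t) = exp (\<bar>a\<bar> * d) * exp (- ?g * t)"
    unfolding g using q k by (simp add: d_def exp_powr_real exp_add[symmetric]) (simp add: field_simps)
  also have "exp (\<bar>b\<bar> * d) * exp (- ?g * t) + 2 powr (1 / q) * (exp (\<bar>a\<bar> * d) * exp (- ?g * t))
     = (exp (\<bar>b\<bar> * d) + 2 powr (1 / q) * exp (\<bar>a\<bar> * d)) * exp (- ?g * t)"
    by (simp add: algebra_simps)
  also have "\<dots> \<le> (exp \<bar>b\<bar> + 2 powr (1 / q) * exp \<bar>a\<bar>) * exp (- ?g * t)"
    using d by (intro mult_right_mono add_mono mult_left_mono) (auto intro: mult_left_le)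
  finally show ?thesis .
qed

text \<open>For q < r the factor |v|^{r-q} is estimated pointwise and |v|^q is integrated. For r <=
  q the inequality y^r <= 1 + y^q with y = e^{at} |v(t)| is enough, because e^{(g-a)rt} is
  integrable on the negative half-line. The constant is a sum that covers both cases.\<close>

lemma expint_nonpos_bound:
  assumes p: "1 \<le> p" and q: "0 < q" and r: "0 < r" and ab: "a < b" and ag: "a < g"
    and th: "(1 - q / r) / (q * (1 - 1 / p) + 1) \<le> (g - a) / (b - a)"
    and U: "expint a q v \<le> 1"
    and H: "(\<integral>\<^sup>+x. ennreal (exp (b * p * T x) * h x powr p) \<partial>M) \<le> 1"
  shows "(\<integral>\<^sup>+t. ennreal (indicator {..0} t * (exp (g * r * t) * \<bar>v t\<bar> powr r)) \<partial>lborel)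
     \<le> ennreal ((exp \<bar>b\<bar> + 2 powr (1 / q) * exp \<bar>a\<bar>) powr (r - q) + 1 / ((g - a) * r) + 1)"
proof (cases "q < r")
  case True
  define k where "k = q * (1 - 1 / p) + 1"
  have k: "0 < k" using p q by (auto simp: k_def intro!: add_nonneg_pos)
  let ?C = "exp \<bar>b\<bar> + 2 powr (1 / q) * exp \<bar>a\<bar>"
  have C: "0 \<le> ?C" by simp
  have "(1 - q / r) / k * (r * (b - a)) \<le> (g - a) / (b - a) * (r * (b - a))"
    using th ab r unfolding k_def by (intro mult_right_mono) auto
  moreover have "(1 - q / r) / k * (r * (b - a)) = (b - a) / k * (r - q)"
    using r k by (simp add: field_simps)
  moreover have "(g - a) / (b - a) * (r * (b - a)) = (g - a) * r" using ab by simp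
  \<comment> \<open>The condition on theta, cleared of denominators. In this form it compares the
    exponents of the two weights for t <= 0.\<close>
  ultimately have ex: "(b - a) / k * (r - q) \<le> (g - a) * r" by linarith
  have pt: "exp (g * r * t) * \<bar>v t\<bar> powr r \<le> ?C powr (r - q) * (exp (a * q * t) * \<bar>v t\<bar> powr q)"
    if t: "t \<le> 0" for t
  proof -
    have "\<bar>v t\<bar> powr r = \<bar>v t\<bar> powr (r - q) * \<bar>v t\<bar> powr q" by (simp add: powr_add[symmetric])
    also have "\<dots> \<le> (?C * exp (- (a + (b - a) / k) * t)) powr (r - q) * \<bar>v t\<bar> powr q"
      using pointwise_bound_nonpos[OF p q less_imp_le[OF ab] t U H] True
      unfolding k_def by (intro mult_right_mono powr_mono2) auto
    also have "(?C * exp (- (a + (b - a) / k) * t)) powr (r - q) = ?C powr (r - q) * exp (- (a + (b - a) / k) * t * (r - q))"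
      using C by (simp add: powr_mult exp_powr_real)
    finally have "exp (g * r * t) * \<bar>v t\<bar> powr r \<le> exp (g * r * t) * (?C powr (r - q) * exp (- (a + (b - a) / k) * t * (r - q)) * \<bar>v t\<bar> powr q)"
      by (intro mult_left_mono) auto
    also have "\<dots> = ?C powr (r - q) * exp (g * r * t + - (a + (b - a) / k) * t * (r - q)) * \<bar>v t\<bar> powr q"
      by (simp only: exp_add ac_simps)
    also have "\<dots> \<le> ?C powr (r - q) * exp (a * q * t) * \<bar>v t\<bar> powr q"
    proof -
      have "((g - a) * r) * t \<le> ((b - a) / k * (r - q)) * t"
        using ex t by (intro mult_right_mono_neg) auto
      then have "g * r * t + - (a + (b - a) / k) * t * (r - q) \<le> a * q * t"
        by (simp add: algebra_simps)
      then show ?thesis by (intro mult_left_mono mult_right_mono) auto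
    qed
    finally show ?thesis by (simp only: ac_simps)
  qed
  have "(\<integral>\<^sup>+t. ennreal (indicator {..0} t * (exp (g * r * t) * \<bar>v t\<bar> powr r)) \<partial>lborel)
      \<le> (\<integral>\<^sup>+t. ennreal (?C powr (r - q)) * ennreal (exp (a * q * t) * \<bar>v t\<bar> powr q) \<partial>lborel)"
    using pt by (intro nn_integral_mono) (auto simp: indicator_def ennreal_mult[symmetric] intro!: ennreal_leI)
  also have "\<dots> = ennreal (?C powr (r - q)) * expint a q v"
    unfolding expint_def by (simp add: nn_integral_cmult)
  also have "\<dots> \<le> ennreal (?C powr (r - q)) * 1" by (intro mult_left_mono U) auto
  also have "\<dots> \<le> ennreal (?C powr (r - q) + 1 / ((g - a) * r) + 1)"
    using ag r by (auto intro!: ennreal_leI)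
  finally show ?thesis .
next
  case False
  have pos: "0 < (g - a) * r" using ag r by simp
  have pt: "exp (g * r * t) * \<bar>v t\<bar> powr r \<le> exp ((g - a) * r * t) + exp (a * q * t) * \<bar>v t\<bar> powr q"
    if t: "t \<le> 0" for t
  proof -
    let ?y = "exp (a * t) * \<bar>v t\<bar>"
    have y: "?y powr r \<le> 1 + ?y powr q"
    proof (cases "?y \<le> 1")
      case True
      then have "?y powr r \<le> 1" using r by (intro powr_le1) auto
      then show ?thesis using powr_ge_zero[of ?y q] by linarith
    next
      case y1: False
      then have "?y powr r \<le> ?y powr q" using False by (intro powr_mono) auto
      then show ?thesis by simp
    qed
    have "exp ((g - a) * r * t) * ?y powr r \<le> exp ((g - a) * r * t) * (1 + ?y powr q)"
      using y by (intro mult_left_mono) auto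
    also have "\<dots> \<le> exp ((g - a) * r * t) + ?y powr q"
    proof -
      have "exp ((g - a) * r * t) * ?y powr q \<le> 1 * ?y powr q"
        using pos t by (intro mult_right_mono) (auto simp: mult_nonneg_nonpos)
      then show ?thesis by (simp add: algebra_simps)
    qed
    also have "exp ((g - a) * r * t) * ?y powr r = exp (g * r * t) * \<bar>v t\<bar> powr r"
      by (simp add: powr_mult exp_powr_real mult.assoc[symmetric] exp_add[symmetric]) (simp add: algebra_simps)
    also have "?y powr q = exp (a * q * t) * \<bar>v t\<bar> powr q"
      by (simp add: powr_mult exp_powr_real mult_ac)
    finally show ?thesis .
  qed
  have "(\<integral>\<^sup>+t. ennreal (indicator {..0} t * (exp (g * r * t) * \<bar>v t\<bar> powr r)) \<partial>lborel)
      \<le> (\<integral>\<^sup>+t. ennreal (indicator {..0} t * exp ((g - a) * r * t)) + ennreal (exp (a * q * t) * \<bar>v t\<bar> powr q) \<partial>lborel)"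
    using pt by (intro nn_integral_mono) (auto simp: indicator_def ennreal_plus[symmetric] simp del: ennreal_plus intro!: ennreal_leI)
  also have "\<dots> = (\<integral>\<^sup>+t. ennreal (indicator {..0} t * exp ((g - a) * r * t)) \<partial>lborel) + expint a q v"
    unfolding expint_def by (simp add: nn_integral_add)
  also have "\<dots> \<le> ennreal (1 / ((g - a) * r)) + 1"
    using nn_integral_exp_atMost[OF pos, of 0] U by (intro add_mono) auto
  also have "\<dots> = ennreal (1 / ((g - a) * r) + 1)"
    using pos by (subst ennreal_plus) auto
  also have "\<dots> \<le> ennreal ((exp \<bar>b\<bar> + 2 powr (1 / q) * exp \<bar>a\<bar>) powr (r - q) + 1 / ((g - a) * r) + 1)"
    by (intro ennreal_leI) auto
  finally show ?thesis .
qed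

lemma expint_nonneg_bound:
  assumes r: "0 < r" and g: "g < g'" and K: "0 \<le> K"
    and le: "\<And>t. 0 \<le> t \<Longrightarrow> \<bar>v t\<bar> \<le> K * exp (- g' * t)"
  shows "(\<integral>\<^sup>+t. ennreal (indicator {0..} t * (exp (g * r * t) * \<bar>v t\<bar> powr r)) \<partial>lborel)
     \<le> ennreal (K powr r / ((g' - g) * r))"
proof -
  have pos: "0 < (g' - g) * r" using g r by simp
  have pt: "exp (g * r * t) * \<bar>v t\<bar> powr r \<le> K powr r * exp (- ((g' - g) * r) * t)" if "0 \<le> t" for t
  proof -
    have "\<bar>v t\<bar> powr r \<le> (K * exp (- g' * t)) powr r"
      using le[OF that] r by (intro powr_mono2) auto
    also have "\<dots> = K powr r * exp (- g' * t * r)" using K by (simp add: powr_mult exp_powr_real)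
    finally have "exp (g * r * t) * \<bar>v t\<bar> powr r \<le> exp (g * r * t) * (K powr r * exp (- g' * t * r))"
      by (intro mult_left_mono) auto
    also have "\<dots> = K powr r * exp (g * r * t + - g' * t * r)" by (simp only: exp_add ac_simps)
    also have "g * r * t + - g' * t * r = - ((g' - g) * r) * t" by (simp add: algebra_simps)
    finally show ?thesis .
  qed
  have "(\<integral>\<^sup>+t. ennreal (indicator {0..} t * (exp (g * r * t) * \<bar>v t\<bar> powr r)) \<partial>lborel)
     \<le> (\<integral>\<^sup>+t. ennreal (K powr r) * ennreal (indicator {0..} t * exp (- ((g' - g) * r) * t)) \<partial>lborel)"
    using pt by (intro nn_integral_mono) (auto simp: indicator_def ennreal_mult[symmetric] intro!: ennreal_leI)
  also have "\<dots> = ennreal (K powr r) * ennreal (exp (- ((g' - g) * r) * 0) / ((g' - g) * r))"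
    using nn_integral_exp_atLeast[OF pos, of 0] by (subst nn_integral_cmult) auto
  also have "\<dots> = ennreal (K powr r / ((g' - g) * r))"
    using pos by (subst ennreal_mult[symmetric]) auto
  finally show ?thesis .
qed

end

text \<open>Two mechanisms control the end where the balanced interval would be long. If g < 0, v
  may grow from its value at 0, but more slowly than e^{-gt}. If g >= 0, then a >= 0 and b > 0, and
  the tail estimate applies. K and g' stand before the quantifiers over the measure and the
  functions because the constant must be uniform.\<close>

lemma ex_decay_nonneg:
  assumes p: "1 \<le> p" and q: "0 < q" and ag: "a < g" and gb: "g < b" and sgn: "g < 0 \<or> 0 \<le> a"
  shows "\<exists>K g'. 0 \<le> K \<and> g < g' \<and> (\<forall>(M::'b measure) T h v t. fibred_primitive M T h v \<longrightarrow> expint a q v \<le> 1 \<longrightarrow>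
     (\<integral>\<^sup>+x. ennreal (exp (b * p * T x) * h x powr p) \<partial>M) \<le> 1 \<longrightarrow> 0 \<le> t \<longrightarrow> \<bar>v t\<bar> \<le> K * exp (- g' * t))"
proof (cases "g < 0")
  case True
  \<comment> \<open>The midpoint of g and min b 0 lies strictly above g, is negative and stays below
    b, as \<open>osc_growth\<close> and the integrability of the result require.\<close>
  define b' where "b' = (g + min b 0) / 2"
  have b': "g < b'" "b' < 0" "b' \<le> b" using True gb by (auto simp: b'_def min_def)
  let ?C = "exp \<bar>b\<bar> + 2 powr (1 / q) * exp \<bar>a\<bar>" and ?D = "(- b') powr - (1 - 1 / p)"
  show ?thesis
  proof (rule exI[of _ "?C + ?D"], rule exI[of _ b'], intro conjI allI impI)
    fix M :: "'b measure" and T h v and t :: real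
    assume fp: "fibred_primitive M T h v" and U: "expint a q v \<le> 1"
      and H: "(\<integral>\<^sup>+x. ennreal (exp (b * p * T x) * h x powr p) \<partial>M) \<le> 1" and t: "0 \<le> t"
    interpret F: fibred_primitive M T h v by fact
    have 0: "\<bar>v 0\<bar> \<le> ?C" using F.pointwise_bound_nonpos[OF p q _ _ U H, of 0] ag gb by simp
    have "?C * 1 \<le> ?C * exp (- b' * t)"
      using b' t by (intro mult_left_mono) (auto simp: mult_nonpos_nonneg)
    moreover have "\<bar>v t - v 0\<bar> \<le> ?D * exp (- b' * t)" by (rule F.osc_growth[OF p b'(2,3) H t])
    ultimately show "\<bar>v t\<bar> \<le> (?C + ?D) * exp (- b' * t)"
      using 0 unfolding distrib_right by linarith
  qed (use b' in auto)
next
  case False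
  then have a: "0 \<le> a" and b: "0 < b" using sgn ag gb by auto
  show ?thesis
  proof (rule exI[of _ "b powr - (1 - 1 / p)"], rule exI[of _ b], intro conjI allI impI)
    fix M :: "'b measure" and T h v and t :: real
    assume fp: "fibred_primitive M T h v" and U: "expint a q v \<le> 1"
      and H: "(\<integral>\<^sup>+x. ennreal (exp (b * p * T x) * h x powr p) \<partial>M) \<le> 1" and t: "0 \<le> t"
    interpret F: fibred_primitive M T h v by fact
    have "ennreal \<bar>v t\<bar> \<le> (\<integral>\<^sup>+x. ennreal (indicator {t..} (T x) * h x) \<partial>M)"
      by (rule F.abs_le_integral_tail[OF a q le_less_trans[OF U]]) simp
    also have "\<dots> \<le> ennreal (b powr - (1 - 1 / p) * exp (- b * t))"
      by (rule F.integral_h_tail[OF p b H])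
    finally have "ennreal \<bar>v t\<bar> \<le> ennreal (b powr - (1 - 1 / p) * exp (- b * t))" .
    then show "\<bar>v t\<bar> \<le> b powr - (1 - 1 / p) * exp (- b * t)" by (subst (asm) ennreal_le_iff) auto
  qed (use gb in auto)
qed

lemma subcritical_expint_bound_less:
  assumes p: "1 \<le> p" and q: "0 < q" and r: "0 < r" and ag: "a < g" and gb: "g < b" and sgn: "g < 0 \<or> 0 \<le> a"
    and th: "(1 - q / r) / (q * (1 - 1 / p) + 1) \<le> (g - a) / (b - a)"
  shows "\<exists>K\<ge>0. \<forall>(M::'b measure) T h v. fibred_primitive M T h v \<longrightarrow> expint a q v \<le> 1 \<longrightarrow>
     (\<integral>\<^sup>+x. ennreal (exp (b * p * T x) * h x powr p) \<partial>M) \<le> 1 \<longrightarrow> expint g r v \<le> ennreal K"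
proof -
  obtain K g' where K: "0 \<le> K" "g < g'" and bd: "\<And>(M::'b measure) T h v t. fibred_primitive M T h v \<Longrightarrow> expint a q v \<le> 1 \<Longrightarrow>
     (\<integral>\<^sup>+x. ennreal (exp (b * p * T x) * h x powr p) \<partial>M) \<le> 1 \<Longrightarrow> 0 \<le> t \<Longrightarrow> \<bar>v t\<bar> \<le> K * exp (- g' * t)"
    using ex_decay_nonneg[OF p q ag gb sgn] by blast
  let ?A = "(exp \<bar>b\<bar> + 2 powr (1 / q) * exp \<bar>a\<bar>) powr (r - q) + 1 / ((g - a) * r) + 1"
  let ?B = "K powr r / ((g' - g) * r)"
  have nn: "0 \<le> ?A" "0 \<le> ?B" using ag r K by (auto intro!: add_nonneg_nonneg)
  show ?thesis
  proof (intro exI[of _ "?A + ?B"] conjI allI impI)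
    fix M :: "'b measure" and T h v
    assume fp: "fibred_primitive M T h v" and U: "expint a q v \<le> 1"
      and H: "(\<integral>\<^sup>+x. ennreal (exp (b * p * T x) * h x powr p) \<partial>M) \<le> 1"
    interpret F: fibred_primitive M T h v by fact
    have "expint g r v \<le> (\<integral>\<^sup>+t. ennreal (indicator {..0} t * (exp (g * r * t) * \<bar>v t\<bar> powr r)) +
        ennreal (indicator {0..} t * (exp (g * r * t) * \<bar>v t\<bar> powr r)) \<partial>lborel)"
      unfolding expint_def by (intro nn_integral_mono) (auto simp: indicator_def)
    also have "\<dots> = (\<integral>\<^sup>+t. ennreal (indicator {..0} t * (exp (g * r * t) * \<bar>v t\<bar> powr r)) \<partial>lborel) +
        (\<integral>\<^sup>+t. ennreal (indicator {0..} t * (exp (g * r * t) * \<bar>v t\<bar> powr r)) \<partial>lborel)"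
      by (simp add: nn_integral_add)
    also have "\<dots> \<le> ennreal ?A + ennreal ?B"
      using ag gb by (intro add_mono F.expint_nonpos_bound[OF p q r _ _ th U H] F.expint_nonneg_bound[OF r K(2,1)] bd[OF fp U H]) auto
    also have "\<dots> = ennreal (?A + ?B)" by (rule ennreal_plus[symmetric]) (use nn in auto)
    finally show "expint g r v \<le> ennreal (?A + ?B)" .
  qed (use nn in auto)
qed

text \<open>The second ordering is the reflection of the first; the quotient (g - a) / (b - a) does
  not change when all three signs do.\<close>

theorem subcritical_expint_bound:
  assumes p: "1 \<le> p" and q: "0 < q" and r: "0 < r"
    and cases: "(a < g \<and> g < b \<and> (g < 0 \<or> 0 \<le> a)) \<or> (b < g \<and> g < a \<and> (0 < g \<or> a \<le> 0))"
    and th: "(1 - q / r) / (q * (1 - 1 / p) + 1) \<le> (g - a) / (b - a)"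
  shows "\<exists>K\<ge>0. \<forall>(M::'b measure) T h v. fibred_primitive M T h v \<longrightarrow> expint a q v \<le> 1 \<longrightarrow>
     (\<integral>\<^sup>+x. ennreal (exp (b * p * T x) * h x powr p) \<partial>M) \<le> 1 \<longrightarrow> expint g r v \<le> ennreal K"
  using cases
proof
  assume "a < g \<and> g < b \<and> (g < 0 \<or> 0 \<le> a)"
  then show ?thesis using subcritical_expint_bound_less[OF p q r _ _ _ th] by auto
next
  assume c: "b < g \<and> g < a \<and> (0 < g \<or> a \<le> 0)"
  have "(1 - q / r) / (q * (1 - 1 / p) + 1) \<le> (- g - - a) / (- b - - a)"
    using th by (metis add.inverse_inverse diff_minus_eq_add minus_diff_eq minus_divide_divide uminus_add_conv_diff)
  then obtain K where K: "0 \<le> K" and bd: "\<And>(M::'b measure) T h v. fibred_primitive M T h v \<Longrightarrow> expint (- a) q v \<le> 1 \<Longrightarrow>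
     (\<integral>\<^sup>+x. ennreal (exp (- b * p * T x) * h x powr p) \<partial>M) \<le> 1 \<Longrightarrow> expint (- g) r v \<le> ennreal K"
    using subcritical_expint_bound_less[OF p q r, of "- a" "- g" "- b"] c by auto
  show ?thesis
  proof (intro exI[of _ K] conjI allI impI K)
    fix M :: "'b measure" and T h v
    assume fp: "fibred_primitive M T h v" and U: "expint a q v \<le> 1"
      and H: "(\<integral>\<^sup>+x. ennreal (exp (b * p * T x) * h x powr p) \<partial>M) \<le> 1"
    interpret F: fibred_primitive M T h v by fact
    have "expint (- g) r (\<lambda>t. v (- t)) \<le> ennreal K"
      by (rule bd[OF fibred_primitive_reflect[OF fp]]) (use U H in \<open>simp_all add: expint_uminus\<close>)
    then show "expint g r v \<le> ennreal K" by (simp add: expint_uminus)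
  qed
qed

section \<open>Hardy's inequality\<close>

context fibred_primitive begin

text \<open>Hoelder's inequality with k = b on the tail gives e^{bpt} |v(t)|^p <= b^{-(p-1)} e^{bt}
  J(t), where J(t) is an energy over T >= t with the weight e^{b(p-1)T}. Integrating in t and
  exchanging the integrals restores the weight e^{bpT} with a factor 1 / b, so the constant for the
  norms is the classical 1 / b.\<close>

lemma Hardy_expint_pos:
  assumes p: "1 \<le> p" and q: "0 < q" and a: "0 \<le> a" and b: "0 < b" and U: "expint a q v < \<infinity>"
    and H: "(\<integral>\<^sup>+x. ennreal (exp (b * p * T x) * h x powr p) \<partial>M) \<le> 1"
  shows "expint b p v \<le> ennreal (b powr - p)"
proof -
  interpret P: pair_sigma_finite lborel M ..
  define J where "J t = (\<integral>\<^sup>+x. ennreal (indicator {t..} (T x) * (exp (b * (p - 1) * T x) * h x powr p)) \<partial>M)" for t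
  \<comment> \<open>The same function as \<open>J\<close>; writing it with the fixed set
    \<open>{0..}\<close> and the difference T x - t makes the integrand visibly measurable in t and
    x jointly.\<close>
  define J' where "J' t = (\<integral>\<^sup>+x. ennreal (indicator {0..} (T x - t) * (exp (b * (p - 1) * T x) * h x powr p)) \<partial>M)" for t
  have JJ: "J t = J' t" for t
    unfolding J_def J'_def by (intro nn_integral_cong) (simp add: indicator_def)
  have pt: "ennreal (exp (b * p * t) * \<bar>v t\<bar> powr p) \<le> ennreal (b powr - (p - 1)) * (ennreal (exp (b * t)) * J' t)" for t
  proof -
    have "J t \<le> ennreal (exp (- b * t))"
      unfolding J_def using b by (intro weighted_integral_le[OF H]) (auto simp: exp_add[symmetric] algebra_simps)
    then obtain L where L: "0 \<le> L" "J t = ennreal L"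
      by (metis ennreal_cases ennreal_less_top infinity_ennreal_def linorder_not_le)
    have "ennreal \<bar>v t\<bar> \<le> (\<integral>\<^sup>+x. ennreal (indicator {t..} (T x) * h x) \<partial>M)"
      by (rule abs_le_integral_tail[OF a q U])
    also have "\<dots> \<le> ennreal ((exp (- b * t) / b) powr (1 - 1 / p) * L powr (1 / p))"
    proof (rule integral_h_Holder[OF p])
      show "(\<integral>\<^sup>+s. ennreal (indicator {t..} s * exp (- b * s)) \<partial>lborel) \<le> ennreal (exp (- b * t) / b)"
        using nn_integral_exp_atLeast[OF b, of t] by simp
      show "(\<integral>\<^sup>+x. ennreal (indicator {t..} (T x) * (exp (b * (p - 1) * T x) * h x powr p)) \<partial>M) \<le> ennreal L"
        using L by (simp add: J_def)
    qed (use b L in auto)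
    finally have "\<bar>v t\<bar> \<le> (exp (- b * t) / b) powr (1 - 1 / p) * L powr (1 / p)"
      by (subst (asm) ennreal_le_iff) auto
    then have "\<bar>v t\<bar> powr p \<le> ((exp (- b * t) / b) powr (1 - 1 / p) * L powr (1 / p)) powr p"
      using p by (intro powr_mono2) auto
    also have "\<dots> = (exp (- b * t) / b) powr (p - 1) * L"
      using p L b by (simp add: powr_mult powr_powr algebra_simps)
    also have "(exp (- b * t) / b) powr (p - 1) = b powr - (p - 1) * exp (- b * t * (p - 1))"
      using b unfolding powr_minus_divide by (simp add: powr_divide exp_powr_real)
    finally have "exp (b * p * t) * \<bar>v t\<bar> powr p \<le> exp (b * p * t) * (b powr - (p - 1) * exp (- b * t * (p - 1)) * L)"
      by (intro mult_left_mono) auto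
    also have "\<dots> = b powr - (p - 1) * (exp (b * p * t + - b * t * (p - 1)) * L)" by (simp only: exp_add ac_simps)
    also have "b * p * t + - b * t * (p - 1) = b * t" by (simp add: algebra_simps)
    finally show ?thesis using L JJ[of t] by (simp add: ennreal_mult[symmetric] ennreal_leI)
  qed
  have [measurable]: "J' \<in> borel_measurable borel"
    unfolding J'_def by measurable
  have "expint b p v \<le> (\<integral>\<^sup>+t. ennreal (b powr - (p - 1)) * (ennreal (exp (b * t)) * J' t) \<partial>lborel)"
    unfolding expint_def by (intro nn_integral_mono pt)
  also have "\<dots> = ennreal (b powr - (p - 1)) * (\<integral>\<^sup>+t. ennreal (exp (b * t)) * J' t \<partial>lborel)"
    by (intro nn_integral_cmult) measurable
  also have "(\<integral>\<^sup>+t. ennreal (exp (b * t)) * J' t \<partial>lborel)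
     = (\<integral>\<^sup>+t. (\<integral>\<^sup>+x. ennreal (exp (b * t)) * ennreal (indicator {0..} (T x - t) * (exp (b * (p - 1) * T x) * h x powr p)) \<partial>M) \<partial>lborel)"
    unfolding J'_def by (intro nn_integral_cong nn_integral_cmult[symmetric]) measurable
  also have "\<dots> = (\<integral>\<^sup>+x. (\<integral>\<^sup>+t. ennreal (exp (b * t)) * ennreal (indicator {0..} (T x - t) * (exp (b * (p - 1) * T x) * h x powr p)) \<partial>lborel) \<partial>M)"
    by (intro P.Fubini'[symmetric]) measurable
  also have "\<dots> = (\<integral>\<^sup>+x. ennreal (1 / b) * ennreal (exp (b * p * T x) * h x powr p) \<partial>M)"
  proof (intro nn_integral_cong)
    fix x
    have "(\<integral>\<^sup>+t. ennreal (exp (b * t)) * ennreal (indicator {0..} (T x - t) * (exp (b * (p - 1) * T x) * h x powr p)) \<partial>lborel)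
      = (\<integral>\<^sup>+t. ennreal (exp (b * (p - 1) * T x) * h x powr p) * ennreal (indicator {..T x} t * exp (b * t)) \<partial>lborel)"
      by (intro nn_integral_cong) (auto simp: indicator_def ennreal_mult[symmetric] mult_ac)
    also have "\<dots> = ennreal (exp (b * (p - 1) * T x) * h x powr p) * ennreal (exp (b * T x) / b)"
      using nn_integral_exp_atMost[OF b, of "T x"] by (subst nn_integral_cmult) auto
    also have "\<dots> = ennreal (1 / b * (exp (b * (p - 1) * T x + b * T x) * h x powr p))"
      using b by (simp add: ennreal_mult[symmetric] exp_add)
    also have "b * (p - 1) * T x + b * T x = b * p * T x" by (simp add: algebra_simps)
    finally show "(\<integral>\<^sup>+t. ennreal (exp (b * t)) * ennreal (indicator {0..} (T x - t) * (exp (b * (p - 1) * T x) * h x powr p)) \<partial>lborel) =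
         ennreal (1 / b) * ennreal (exp (b * p * T x) * h x powr p)"
      using b by (simp add: ennreal_mult[symmetric])
  qed
  also have "\<dots> = ennreal (1 / b) * (\<integral>\<^sup>+x. ennreal (exp (b * p * T x) * h x powr p) \<partial>M)"
    by (intro nn_integral_cmult) measurable
  also have "ennreal (b powr - (p - 1)) * \<dots> \<le> ennreal (b powr - (p - 1)) * (ennreal (1 / b) * 1)"
    by (intro mult_left_mono H) auto
  also have "\<dots> = ennreal (b powr - p)"
    using b by (simp add: ennreal_mult[symmetric] powr_diff powr_minus divide_inverse)
  finally show ?thesis .
qed

text \<open>The surplus |v|^{r-p} is absorbed by the pointwise bound |v(t)| <= b^{-(1-1/p)} e^{-bt},
  after which the weight is exactly that of the case r = p.\<close>

lemma Hardy_expint_pos_ge: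
  assumes p: "1 \<le> p" and q: "0 < q" and pr: "p \<le> r" and a: "0 \<le> a" and b: "0 < b" and U: "expint a q v < \<infinity>"
    and H: "(\<integral>\<^sup>+x. ennreal (exp (b * p * T x) * h x powr p) \<partial>M) \<le> 1"
  shows "expint b r v \<le> ennreal (b powr (- (1 - 1 / p) * (r - p) - p))"
proof -
  let ?D = "b powr - (1 - 1 / p)"
  have pt: "exp (b * r * t) * \<bar>v t\<bar> powr r \<le> ?D powr (r - p) * (exp (b * p * t) * \<bar>v t\<bar> powr p)" for t
  proof -
    have "ennreal \<bar>v t\<bar> \<le> ennreal (?D * exp (- b * t))"
      using abs_le_integral_tail[OF a q U, of t] integral_h_tail[OF p b H, of t] by (rule order_trans)
    then have le: "\<bar>v t\<bar> \<le> ?D * exp (- b * t)" by (subst (asm) ennreal_le_iff) auto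
    have "\<bar>v t\<bar> powr r = \<bar>v t\<bar> powr (r - p) * \<bar>v t\<bar> powr p" by (simp add: powr_add[symmetric])
    also have "\<dots> \<le> (?D * exp (- b * t)) powr (r - p) * \<bar>v t\<bar> powr p"
      using le pr by (intro mult_right_mono powr_mono2) auto
    also have "(?D * exp (- b * t)) powr (r - p) = ?D powr (r - p) * exp (- b * t * (r - p))"
      by (simp add: powr_mult exp_powr_real)
    finally have "exp (b * r * t) * \<bar>v t\<bar> powr r \<le> exp (b * r * t) * (?D powr (r - p) * exp (- b * t * (r - p)) * \<bar>v t\<bar> powr p)"
      by (intro mult_left_mono) auto
    also have "\<dots> = ?D powr (r - p) * (exp (b * r * t + - b * t * (r - p)) * \<bar>v t\<bar> powr p)" by (simp only: exp_add ac_simps)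
    also have "b * r * t + - b * t * (r - p) = b * p * t" by (simp add: algebra_simps)
    finally show ?thesis .
  qed
  have "expint b r v \<le> (\<integral>\<^sup>+t. ennreal (?D powr (r - p)) * ennreal (exp (b * p * t) * \<bar>v t\<bar> powr p) \<partial>lborel)"
    unfolding expint_def using pt by (intro nn_integral_mono) (auto simp: ennreal_mult[symmetric] intro!: ennreal_leI)
  also have "\<dots> = ennreal (?D powr (r - p)) * expint b p v"
    unfolding expint_def by (simp add: nn_integral_cmult)
  also have "\<dots> \<le> ennreal (?D powr (r - p)) * ennreal (b powr - p)"
    by (intro mult_left_mono Hardy_expint_pos[OF p q a b U H]) auto
  also have "\<dots> = ennreal (b powr (- (1 - 1 / p) * (r - p) - p))"
    by (simp add: ennreal_mult[symmetric] powr_powr powr_add[symmetric])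
  finally show ?thesis .
qed

end

theorem Hardy_expint:
  assumes fp: "fibred_primitive M T h v"
    and p: "1 \<le> p" and q: "0 < q" and pr: "p \<le> r" and ab: "0 \<le> a \<and> 0 < b \<or> a \<le> 0 \<and> b < 0" and U: "expint a q v < \<infinity>"
    and H: "(\<integral>\<^sup>+x. ennreal (exp (b * p * T x) * h x powr p) \<partial>M) \<le> 1"
  shows "expint b r v \<le> ennreal (\<bar>b\<bar> powr (- (1 - 1 / p) * (r - p) - p))"
  using ab
proof
  assume "0 \<le> a \<and> 0 < b"
  then show ?thesis using fibred_primitive.Hardy_expint_pos_ge[OF fp p q pr _ _ U H] by simp
next
  assume c: "a \<le> 0 \<and> b < 0"
  interpret F: fibred_primitive M T h v by fact
  have "expint (- b) r (\<lambda>t. v (- t)) \<le> ennreal ((- b) powr (- (1 - 1 / p) * (r - p) - p))"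
    by (rule fibred_primitive.Hardy_expint_pos_ge[OF fibred_primitive_reflect[OF fp] p q pr, of "- a"])
       (use c U H in \<open>simp_all add: expint_uminus\<close>)
  then show ?thesis using c by (simp add: expint_uminus)
qed

section \<open>The case without weights\<close>

context fibred_primitive begin

theorem unweighted_expint_bound:
  assumes p: "1 \<le> p" and q: "0 < q" and qr: "q < r" and Q: "0 < Q" and U: "expint 0 q v \<le> ennreal (Q powr q)"
    and H: "(\<integral>\<^sup>+x. ennreal (h x powr p) \<partial>M) \<le> 1"
  defines "\<theta> \<equiv> (1 - q / r) / (q * (1 - 1 / p) + 1)"
  shows "expint 0 r v \<le> ennreal ((1 + 2 powr (1 / q)) powr (r - q) * Q powr (r * (1 - \<theta>)))"
proof -
  define k where "k = 1 - 1 / p + 1 / q"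
  have k: "0 < k" using p q by (auto simp: k_def intro!: add_nonneg_pos)
  \<comment> \<open>With both exponents 0 no length is excluded, so d balances d^{1-1/p} against
    d^{-1/q} Q for every Q > 0. Keeping the power of Q in the result yields a multiplicative
    inequality once Q is the ratio of the norms.\<close>
  define d where "d = Q powr (1 / k)"
  have d: "0 < d" using Q by (simp add: d_def)
  let ?e = "(1 - 1 / p) / k"
  have e: "1 - 1 / (q * k) = ?e" 
  proof -
    have "1 - 1 / p = k - 1 / q" by (simp add: k_def)
    then show ?thesis using k by (simp add: diff_divide_distrib)
  qed
  have bd: "\<bar>v t\<bar> \<le> (1 + 2 powr (1 / q)) * Q powr ?e" for t
  proof -
    have "\<bar>v t\<bar> \<le> d powr (1 - 1 / p) * exp (\<bar>0\<bar> * d - 0 * t) + (2 / d) powr (1 / q) * Q * exp (\<bar>0\<bar> * d - 0 * t)"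
      by (rule pointwise_bound[OF p q d Q U]) (use H in simp)
    also have "\<dots> = d powr (1 - 1 / p) + (2 / d) powr (1 / q) * Q" by simp
    also have "d powr (1 - 1 / p) = Q powr ?e" by (simp add: d_def powr_powr)
    also have "(2 / d) powr (1 / q) * Q = 2 powr (1 / q) * (Q powr - (1 / (q * k)) * Q powr 1)"
      using Q unfolding powr_minus_divide by (simp add: d_def powr_divide powr_powr mult.commute)
    also have "Q powr - (1 / (q * k)) * Q powr 1 = Q powr ?e"
      by (subst powr_add[symmetric]) (simp add: e[symmetric])
    finally show ?thesis by (simp add: algebra_simps)
  qed
  let ?C = "((1 + 2 powr (1 / q)) * Q powr ?e) powr (r - q)"
  have "expint 0 r v \<le> (\<integral>\<^sup>+t. ennreal ?C * ennreal (exp (0 * q * t) * \<bar>v t\<bar> powr q) \<partial>lborel)"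
    unfolding expint_def
  proof (intro nn_integral_mono)
    fix t
    have "\<bar>v t\<bar> powr r = \<bar>v t\<bar> powr (r - q) * \<bar>v t\<bar> powr q" by (simp add: powr_add[symmetric])
    also have "\<dots> \<le> ?C * \<bar>v t\<bar> powr q"
      using bd[of t] qr by (intro mult_right_mono powr_mono2) auto
    finally show "ennreal (exp (0 * r * t) * \<bar>v t\<bar> powr r) \<le> ennreal ?C * ennreal (exp (0 * q * t) * \<bar>v t\<bar> powr q)"
      by (simp add: ennreal_mult[symmetric] ennreal_leI)
  qed
  also have "\<dots> = ennreal ?C * expint 0 q v"
    unfolding expint_def by (rule nn_integral_cmult) measurable
  also have "\<dots> \<le> ennreal ?C * ennreal (Q powr q)" by (intro mult_left_mono U) auto
  also have "\<dots> = ennreal ((1 + 2 powr (1 / q)) powr (r - q) * (Q powr (?e * (r - q)) * Q powr q))"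
    by (simp add: ennreal_mult[symmetric] powr_mult powr_powr mult_ac)
  also have "Q powr (?e * (r - q)) * Q powr q = Q powr (r * (1 - \<theta>))"
  proof -
    have "q * (1 - 1 / p) + 1 = q * k" using q by (simp add: k_def algebra_simps)
    then have "r * (1 - \<theta>) = r - (r - q) * (1 / (q * k))"
      using qr q k by (simp add: \<theta>_def field_simps)
    also have "1 / (q * k) = 1 - ?e" using e by simp
    finally have "?e * (r - q) + q = r * (1 - \<theta>)" by (simp add: algebra_simps)
    then show ?thesis by (simp add: powr_add[symmetric])
  qed
  finally show ?thesis .
qed

end

section \<open>Necessary conditions from test profiles\<close>

text \<open>Upper bounds A and B replace the source norms, so a test profile needs only estimates
  from above at the source and from below at the target. Profiles of class C^1 suffice for all the
  tests.\<close>

definition profile_embeds :: "real \<Rightarrow> real \<Rightarrow> real \<Rightarrow> real \<Rightarrow> real \<Rightarrow> real \<Rightarrow> real \<Rightarrow> bool" where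
  "profile_embeds \<alpha> \<beta> \<gamma> p q r C \<longleftrightarrow> 0 < C \<and>
    (\<forall>V V' A B. (\<forall>t. (V has_real_derivative V' t) (at t)) \<longrightarrow> continuous_on UNIV V' \<longrightarrow> 0 \<le> A \<longrightarrow> 0 \<le> B \<longrightarrow>
      expint \<alpha> q V \<le> ennreal (A powr q) \<longrightarrow> expint \<beta> p V' \<le> ennreal (B powr p) \<longrightarrow>
      expint \<gamma> r V \<le> ennreal ((C * (A + B)) powr r))"

lemma profile_embedsD:
  assumes "profile_embeds \<alpha> \<beta> \<gamma> p q r C" "\<And>t. (V has_real_derivative V' t) (at t)" "continuous_on UNIV V'" "0 \<le> A" "0 \<le> B"
      "expint \<alpha> q V \<le> ennreal (A powr q)" "expint \<beta> p V' \<le> ennreal (B powr p)"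
  shows "expint \<gamma> r V \<le> ennreal ((C * (A + B)) powr r)"
  using assms unfolding profile_embeds_def by blast

lemma profile_embeds_reflect:
  assumes "profile_embeds \<alpha> \<beta> \<gamma> p q r C"
  shows "profile_embeds (- \<alpha>) (- \<beta>) (- \<gamma>) p q r C"
  unfolding profile_embeds_def
proof (intro conjI allI impI)
  show "0 < C" using assms by (simp add: profile_embeds_def)
  fix V V' :: "real \<Rightarrow> real" and A B :: real
  assume V: "\<forall>t. (V has_real_derivative V' t) (at t)" and c: "continuous_on UNIV V'" and AB: "0 \<le> A" "0 \<le> B"
    and e1: "expint (- \<alpha>) q V \<le> ennreal (A powr q)" and e2: "expint (- \<beta>) p V' \<le> ennreal (B powr p)"
  have "continuous_on UNIV V" using V by (meson DERIV_isCont continuous_at_imp_continuous_on)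
  then have m: "V \<in> borel_measurable borel" "V' \<in> borel_measurable borel"
    using c by (auto intro: borel_measurable_continuous_onI)
  have "expint \<gamma> r (\<lambda>t. V (- t)) \<le> ennreal ((C * (A + B)) powr r)"
  proof (rule profile_embedsD[OF assms _ _ AB, where V'="\<lambda>t. - V' (- t)"])
    show "((\<lambda>t. V (- t)) has_real_derivative - V' (- t)) (at t)" for t
    proof -
      have "((\<lambda>t. V (- t)) has_real_derivative V' (- t) * (- 1)) (at t)"
        by (rule DERIV_chain2[OF V[rule_format]]) (auto intro!: derivative_eq_intros)
      then show ?thesis by simp
    qed
    show "continuous_on UNIV (\<lambda>t. - V' (- t))"
      by (intro continuous_intros continuous_on_compose2[OF c]) auto
    show "expint \<alpha> q (\<lambda>t. V (- t)) \<le> ennreal (A powr q)" using e1 m by (simp add: expint_uminus)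
    have "expint \<beta> p (\<lambda>t. - V' (- t)) = expint \<beta> p (\<lambda>t. V' (- t))" by (simp add: expint_def)
    then show "expint \<beta> p (\<lambda>t. - V' (- t)) \<le> ennreal (B powr p)" using e2 m by (simp add: expint_uminus)
  qed
  then show "expint (- \<gamma>) r V \<le> ennreal ((C * (A + B)) powr r)" using m by (simp add: expint_uminus)
qed

text \<open>The bound is written as a norm raised to the power s, the shape in which
  \<open>profile_embeds\<close> takes A and B: D bounds f on its support, E bounds the exponent
  there, and w is the width.\<close>

lemma expint_le_interval:
  assumes s: "0 < s" and w: "0 \<le> w" and D: "0 \<le> D"
    and le: "\<And>t. l \<le> t \<Longrightarrow> t \<le> l + w \<Longrightarrow> \<bar>f t\<bar> \<le> D \<and> k * t \<le> E"
    and zero: "\<And>t. t < l \<or> l + w < t \<Longrightarrow> f t = 0"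
  shows "expint k s f \<le> ennreal ((exp E * D * w powr (1 / s)) powr s)"
proof -
  have "expint k s f \<le> (\<integral>\<^sup>+t. ennreal (exp (E * s) * D powr s) * indicator {l..l + w} t \<partial>lborel)"
    unfolding expint_def
  proof (intro nn_integral_mono)
    fix t
    show "ennreal (exp (k * s * t) * \<bar>f t\<bar> powr s) \<le> ennreal (exp (E * s) * D powr s) * indicator {l..l + w} t"
    proof (cases "l \<le> t \<and> t \<le> l + w")
      case True
      then have "k * t * s \<le> E * s" using le s by (intro mult_right_mono) auto
      then have "exp (k * s * t) * \<bar>f t\<bar> powr s \<le> exp (E * s) * D powr s"
        using le[of t] True s by (intro mult_mono powr_mono2) (auto simp: mult_ac)
      then show ?thesis using True by (simp add: ennreal_leI)
    next
      case False
      then have "f t = 0" by (intro zero) auto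
      then show ?thesis by simp
    qed
  qed
  also have "\<dots> = ennreal (exp (E * s) * D powr s) * ennreal w"
    using w by (simp add: nn_integral_cmult)
  also have "\<dots> = ennreal ((exp E * D * w powr (1 / s)) powr s)"
    using s w D by (simp add: ennreal_mult[symmetric] powr_mult powr_powr exp_powr_real)
  finally show ?thesis .
qed

lemma expint_ge_interval:
  assumes s: "0 < s" and w: "0 \<le> w" and D: "0 \<le> D"
    and ge: "\<And>t. l \<le> t \<Longrightarrow> t \<le> l + w \<Longrightarrow> D \<le> \<bar>f t\<bar> \<and> E \<le> k * t"
  shows "ennreal ((exp E * D * w powr (1 / s)) powr s) \<le> expint k s f"
proof -
  have "ennreal ((exp E * D * w powr (1 / s)) powr s) = ennreal (exp (E * s) * D powr s) * ennreal w"
    using s w D by (simp add: ennreal_mult[symmetric] powr_mult powr_powr exp_powr_real)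
  also have "\<dots> = (\<integral>\<^sup>+t. ennreal (exp (E * s) * D powr s) * indicator {l..l + w} t \<partial>lborel)"
    using w by (simp add: nn_integral_cmult)
  also have "\<dots> \<le> expint k s f"
    unfolding expint_def
  proof (intro nn_integral_mono)
    fix t
    show "ennreal (exp (E * s) * D powr s) * indicator {l..l + w} t \<le> ennreal (exp (k * s * t) * \<bar>f t\<bar> powr s)"
    proof (cases "l \<le> t \<and> t \<le> l + w")
      case True
      then have "E * s \<le> k * t * s" using ge s by (intro mult_right_mono) auto
      then have "exp (E * s) * D powr s \<le> exp (k * s * t) * \<bar>f t\<bar> powr s"
        using ge[of t] True s D by (intro mult_mono powr_mono2) (auto simp: mult_ac)
      then show ?thesis using True by (simp add: ennreal_leI)
    qed simp
  qed
  finally show ?thesis .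
qed

section \<open>Test profiles of class C^1\<close>

definition pos_sq :: "real \<Rightarrow> real" where "pos_sq y = (max 0 y)\<^sup>2"

lemma pos_sq_deriv: "(pos_sq has_real_derivative 2 * max 0 y) (at y)"
proof -
  consider "y < 0" | "y = 0" | "0 < y" by linarith
  then show ?thesis
  proof cases
    case 1
    have "(pos_sq has_real_derivative 0) (at y)"
      by (rule has_field_derivative_transform_within_open[where f="\<lambda>y. 0" and S="{..<0}"]) (use 1 in \<open>auto simp: pos_sq_def\<close>)
    then show ?thesis using 1 by simp
  next
    case 2
    have "((\<lambda>h. pos_sq h / h) \<longlongrightarrow> 0) (at 0)"
    proof (rule Lim_null_comparison)
      show "eventually (\<lambda>h. norm (pos_sq h / h) \<le> \<bar>h\<bar>) (at 0)"
        by (intro always_eventually allI) (auto simp: pos_sq_def power2_eq_square max_def abs_mult)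
      show "((\<lambda>h::real. \<bar>h\<bar>) \<longlongrightarrow> 0) (at 0)" by (intro tendsto_rabs_zero tendsto_ident_at)
    qed
    then show ?thesis using 2 by (simp add: DERIV_def pos_sq_def)
  next
    case 3
    have "((\<lambda>y. y\<^sup>2) has_real_derivative 2 * y) (at y)" by (auto intro!: derivative_eq_intros)
    then have "(pos_sq has_real_derivative 2 * y) (at y)"
      by (rule has_field_derivative_transform_within_open[where S="{0<..}"]) (use 3 in \<open>auto simp: pos_sq_def\<close>)
    then show ?thesis using 3 by simp
  qed
qed

text \<open>The square of the positive part of 1 - t^2. Squaring makes the truncation continuously
  differentiable at the end points 1 and -1.\<close>

definition hat :: "real \<Rightarrow> real" where "hat t = pos_sq (1 - t\<^sup>2)"
definition hat' :: "real \<Rightarrow> real" where "hat' t = 2 * max 0 (1 - t\<^sup>2) * (- 2 * t)"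

lemma hat_deriv: "(hat has_real_derivative hat' t) (at t)"
  unfolding hat_def[abs_def] hat'_def
  by (rule DERIV_chain2[OF pos_sq_deriv]) (auto intro!: derivative_eq_intros)

lemma hat'_continuous: "continuous_on A hat'"
  unfolding hat'_def[abs_def] by (intro continuous_intros)

lemma hat_zero: "1 < \<bar>t\<bar> \<Longrightarrow> hat t = 0 \<and> hat' t = 0"
  using abs_square_less_1[of t] abs_square_le_1[of t] by (auto simp: hat_def hat'_def pos_sq_def max_def)

lemma hat_bounds: "0 \<le> hat t" "hat t \<le> 1"
proof -
  show "0 \<le> hat t" by (simp add: hat_def pos_sq_def)
  have "max 0 (1 - t\<^sup>2) \<le> 1" by simp
  then show "hat t \<le> 1" by (simp add: hat_def pos_sq_def power_le_one)
qed

lemma hat'_bound: "\<bar>hat' t\<bar> \<le> 4"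
proof (cases "\<bar>t\<bar> \<le> 1")
  case True
  have "\<bar>max 0 (1 - t\<^sup>2)\<bar> * \<bar>t\<bar> \<le> 1 * 1" using True by (intro mult_mono) auto
  then show ?thesis by (simp add: hat'_def abs_mult)
qed (use hat_zero in auto)

lemma hat_half: "\<bar>t\<bar> \<le> 1 / 2 \<Longrightarrow> 1 / 2 \<le> hat t"
proof -
  assume "\<bar>t\<bar> \<le> 1 / 2"
  then have "\<bar>t\<bar>\<^sup>2 \<le> (1 / 2)\<^sup>2" by (intro power_mono) auto
  then have "t\<^sup>2 \<le> 1 / 4" by (simp add: power_divide)
  then have "3 / 4 \<le> max 0 (1 - t\<^sup>2)" by (simp add: le_max_iff_disj)
  then have "(3 / 4)\<^sup>2 \<le> (max 0 (1 - t\<^sup>2))\<^sup>2" by (rule power_mono) simp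
  moreover have "(1 / 2 :: real) \<le> (3 / 4)\<^sup>2" by (simp add: power_divide)
  ultimately show ?thesis unfolding hat_def pos_sq_def by (rule order_trans[rotated])
qed

section \<open>Tests by concentrated, spread and constant profiles\<close>

lemma powr_le_powr_iff_base:
  assumes "0 < r" "0 \<le> x" "0 \<le> y" "x powr r \<le> y powr r"
  shows "x \<le> (y::real)"
  using assms by (metis linorder_not_le powr_less_mono2)

lemma ennreal_powr_leD:
  assumes "ennreal (x powr r) \<le> ennreal (y powr r)" "0 < r" "0 \<le> x" "0 \<le> y"
  shows "x \<le> (y::real)"
proof (rule powr_le_powr_iff_base[OF assms(2-4)])
  show "x powr r \<le> y powr r" using assms(1) by (subst (asm) ennreal_le_iff) auto
qed

text \<open>For a bump of width \<delta> around \<tau> the three norms are of order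
  e^{\<alpha>\<tau>} \<delta>^{1/q}, e^{\<beta>\<tau>} \<delta>^{1/p-1} and e^{\<gamma>\<tau>}
  \<delta>^{1/r}, because for \<delta> <= 1 each weight changes over the support by a bounded factor
  only. Translation and concentration are both read off from this one inequality.\<close>

lemma profile_embeds_concentration:
  assumes emb: "profile_embeds \<alpha> \<beta> \<gamma> p q r C" and p: "1 \<le> p" and q: "0 < q" and r: "0 < r"
  shows "\<exists>K\<ge>0. \<forall>\<tau> \<delta>. 0 < \<delta> \<longrightarrow> \<delta> \<le> 1 \<longrightarrow>
     exp (\<gamma> * \<tau>) * \<delta> powr (1 / r) \<le> K * (exp (\<alpha> * \<tau>) * \<delta> powr (1 / q) + exp (\<beta> * \<tau>) * \<delta> powr (1 / p - 1))"
proof -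
  have C: "0 < C" using emb by (simp add: profile_embeds_def)
  \<comment> \<open>The support has width 2 \<delta>, the weights there are within e^{|\<alpha>|}
    and e^{|\<beta>|} of their values at \<tau>, and 4 bounds the slope of \<open>hat\<close>. The 2
    in K is due to \<open>hat\<close> being at least 1/2 on the middle interval of width
    \<delta>.\<close>
  define a where "a = exp \<bar>\<alpha>\<bar> * 2 powr (1 / q)"
  define b where "b = 4 * exp \<bar>\<beta>\<bar> * 2 powr (1 / p)"
  have ab: "0 \<le> a" "0 \<le> b" by (auto simp: a_def b_def)
  define K where "K = 2 * exp \<bar>\<gamma>\<bar> * (C * (a + b))"
  have "exp (\<gamma> * \<tau>) * \<delta> powr (1 / r) \<le> K * (exp (\<alpha> * \<tau>) * \<delta> powr (1 / q) + exp (\<beta> * \<tau>) * \<delta> powr (1 / p - 1))"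
    if \<delta>: "0 < \<delta>" "\<delta> \<le> 1" for \<tau> \<delta>
  proof -
    define V where "V t = hat ((t - \<tau>) / \<delta>)" for t
    define V' where "V' t = hat' ((t - \<tau>) / \<delta>) * (1 / \<delta>)" for t
    have near: "k * t \<le> k * \<tau> + \<bar>k\<bar> \<and> k * \<tau> - \<bar>k\<bar> \<le> k * t" if "\<tau> - \<delta> \<le> t" "t \<le> \<tau> + \<delta>" for k t
    proof -
      have "\<bar>k * (t - \<tau>)\<bar> \<le> \<bar>k\<bar> * 1" unfolding abs_mult using that \<delta> by (intro mult_left_mono) auto
      then show ?thesis by (simp add: algebra_simps abs_le_iff)
    qed
    have out: "1 < \<bar>(t - \<tau>) / \<delta>\<bar>" if "t < \<tau> - \<delta> \<or> \<tau> + \<delta> < t" for t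
      using that \<delta> by (auto simp: abs_divide field_simps)
    let ?A = "exp (\<alpha> * \<tau> + \<bar>\<alpha>\<bar>) * 1 * (2 * \<delta>) powr (1 / q)"
    let ?B = "exp (\<beta> * \<tau> + \<bar>\<beta>\<bar>) * (4 / \<delta>) * (2 * \<delta>) powr (1 / p)"
    have "expint \<gamma> r V \<le> ennreal ((C * (?A + ?B)) powr r)"
    proof (rule profile_embedsD[OF emb])
      show "(V has_real_derivative V' t) (at t)" for t
        unfolding V_def V'_def by (rule DERIV_chain2[OF hat_deriv]) (use \<delta> in \<open>auto intro!: derivative_eq_intros\<close>)
      show "continuous_on UNIV V'" unfolding V'_def
        by (intro continuous_intros continuous_on_compose2[OF hat'_continuous]) (use \<delta> in auto)
      show "0 \<le> ?A" "0 \<le> ?B" using \<delta> by auto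
      show "expint \<alpha> q V \<le> ennreal (?A powr q)"
        by (rule expint_le_interval[where l="\<tau> - \<delta>"])
           (use q \<delta> near[where k=\<alpha>] out hat_zero hat_bounds in \<open>auto simp: V_def\<close>)
      show "expint \<beta> p V' \<le> ennreal (?B powr p)"
      proof (rule expint_le_interval[where l="\<tau> - \<delta>"])
        show "\<bar>V' t\<bar> \<le> 4 / \<delta> \<and> \<beta> * t \<le> \<beta> * \<tau> + \<bar>\<beta>\<bar>" if "\<tau> - \<delta> \<le> t" "t \<le> \<tau> - \<delta> + 2 * \<delta>" for t
          using near[of t \<beta>] that \<delta> hat'_bound[of "(t - \<tau>) / \<delta>"] by (auto simp: V'_def abs_mult divide_right_mono)
      qed (use p \<delta> out hat_zero in \<open>auto simp: V'_def\<close>)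
    qed
    moreover have "ennreal ((exp (\<gamma> * \<tau> - \<bar>\<gamma>\<bar>) * (1 / 2) * \<delta> powr (1 / r)) powr r) \<le> expint \<gamma> r V"
    proof (rule expint_ge_interval[where l="\<tau> - \<delta> / 2"])
      fix t assume t: "\<tau> - \<delta> / 2 \<le> t" "t \<le> \<tau> - \<delta> / 2 + \<delta>"
      then have "\<bar>t - \<tau>\<bar> \<le> \<delta> / 2" unfolding abs_le_iff by linarith
      then have "\<bar>(t - \<tau>) / \<delta>\<bar> \<le> 1 / 2" using \<delta> by (simp add: abs_divide divide_le_eq)
      then have "1 / 2 \<le> \<bar>V t\<bar>" unfolding V_def using hat_half by fastforce
      then show "1 / 2 \<le> \<bar>V t\<bar> \<and> \<gamma> * \<tau> - \<bar>\<gamma>\<bar> \<le> \<gamma> * t" using near[of t \<gamma>] t \<delta> by auto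
    qed (use r \<delta> in auto)
    ultimately have "ennreal ((exp (\<gamma> * \<tau> - \<bar>\<gamma>\<bar>) * (1 / 2) * \<delta> powr (1 / r)) powr r) \<le> ennreal ((C * (?A + ?B)) powr r)"
      by (rule order_trans[rotated])
    then have le: "exp (\<gamma> * \<tau> - \<bar>\<gamma>\<bar>) * (1 / 2) * \<delta> powr (1 / r) \<le> C * (?A + ?B)"
      by (rule ennreal_powr_leD) (use r \<delta> C in auto)
    have A: "?A = a * (exp (\<alpha> * \<tau>) * \<delta> powr (1 / q))"
      using \<delta> by (simp add: a_def exp_add powr_mult)
    have "?B = b * (exp (\<beta> * \<tau>) * (\<delta> powr (1 / p) * \<delta> powr - 1))"
      using \<delta> by (simp add: b_def exp_add powr_mult powr_minus divide_inverse)
    also have "\<delta> powr (1 / p) * \<delta> powr - 1 = \<delta> powr (1 / p - 1)" by (subst powr_add[symmetric]) simp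
    finally have B: "?B = b * (exp (\<beta> * \<tau>) * \<delta> powr (1 / p - 1))" .
    have "exp (\<gamma> * \<tau>) * \<delta> powr (1 / r) = 2 * exp \<bar>\<gamma>\<bar> * (exp (\<gamma> * \<tau> - \<bar>\<gamma>\<bar>) * (1 / 2) * \<delta> powr (1 / r))"
      by (simp add: exp_diff)
    also have "\<dots> \<le> 2 * exp \<bar>\<gamma>\<bar> * (C * (?A + ?B))" by (intro mult_left_mono le) auto
    also have "\<dots> \<le> 2 * exp \<bar>\<gamma>\<bar> * (C * ((a + b) * (exp (\<alpha> * \<tau>) * \<delta> powr (1 / q) + exp (\<beta> * \<tau>) * \<delta> powr (1 / p - 1))))"
    proof -
      have "?A + ?B \<le> (a + b) * (exp (\<alpha> * \<tau>) * \<delta> powr (1 / q) + exp (\<beta> * \<tau>) * \<delta> powr (1 / p - 1))"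
        unfolding A B distrib_right distrib_left using ab by (intro add_mono) (auto intro!: add_increasing add_increasing2 mult_nonneg_nonneg)
      then show ?thesis using C by (intro mult_left_mono) auto
    qed
    finally show ?thesis by (simp add: K_def mult_ac)
  qed
  then show ?thesis using C ab by (intro exI[of _ K]) (auto simp: K_def)
qed

text \<open>The profile e^{-\<gamma>t} H(t), with H a bump on [0, 2L], cancels the target weight, so
  its target norm is of order L^{1/r}. The source norms then carry e^{(\<alpha>-\<gamma>)t} and
  e^{(\<beta>-\<gamma>)t}; with the support to the right of 0 their integrals stay bounded in L when
  the exponent is negative. Differentiating the exponential gives |\<gamma>|, differentiating H
  gives 4 / L.\<close>

lemma profile_embeds_spreading:
  assumes emb: "profile_embeds \<alpha> \<beta> \<gamma> p q r C" and p: "1 \<le> p" and q: "0 < q" and r: "0 < r"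
    and L: "1 \<le> L" and A: "0 \<le> A" and B: "0 \<le> B"
    and intA: "(\<integral>\<^sup>+t. ennreal (indicator {0..2 * L} t * exp ((\<alpha> - \<gamma>) * q * t)) \<partial>lborel) \<le> ennreal (A powr q)"
    and intB: "(\<integral>\<^sup>+t. ennreal (indicator {0..2 * L} t * exp ((\<beta> - \<gamma>) * p * t)) \<partial>lborel) \<le> ennreal (B powr p)"
  shows "L powr (1 / r) \<le> 2 * C * (A + (\<bar>\<gamma>\<bar> + 4 / L) * B)"
proof -
  have C: "0 < C" using emb by (simp add: profile_embeds_def)
  define H where "H t = hat ((t - L) / L)" for t
  define H' where "H' t = hat' ((t - L) / L) * (1 / L)" for t
  have H: "(H has_real_derivative H' t) (at t)" for t
    unfolding H_def[abs_def] H'_def by (rule DERIV_chain2[OF hat_deriv]) (use L in \<open>auto intro!: derivative_eq_intros\<close>)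
  have cH: "continuous_on UNIV H" by (meson H DERIV_isCont continuous_at_imp_continuous_on)
  have cH': "continuous_on UNIV H'" unfolding H'_def[abs_def]
    by (intro continuous_intros continuous_on_compose2[OF hat'_continuous]) (use L in auto)
  define V where "V t = exp (- \<gamma> * t) * H t" for t
  define V' where "V' t = exp (- \<gamma> * t) * (H' t - \<gamma> * H t)" for t
  have out: "H t = 0 \<and> H' t = 0" if "t < 0 \<or> 2 * L < t" for t
  proof -
    have "1 < \<bar>(t - L) / L\<bar>" using that L by (auto simp: abs_divide less_divide_eq)
    then show ?thesis using hat_zero by (simp add: H_def H'_def)
  qed
  have D: "0 \<le> \<bar>\<gamma>\<bar> + 4 / L" using L by simp
  have "expint \<gamma> r V \<le> ennreal ((C * (A + (\<bar>\<gamma>\<bar> + 4 / L) * B)) powr r)"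
  proof (rule profile_embedsD[OF emb])
    show "(V has_real_derivative V' t) (at t)" for t
    proof -
      have "((\<lambda>t. exp (- \<gamma> * t)) has_real_derivative (- \<gamma> * exp (- \<gamma> * t))) (at t)"
        by (auto intro!: derivative_eq_intros)
      from DERIV_mult[OF this H] show ?thesis by (simp add: V_def[abs_def] V'_def algebra_simps)
    qed
    show "continuous_on UNIV V'" unfolding V'_def[abs_def]
      by (intro continuous_intros cH cH')
    show "0 \<le> (\<bar>\<gamma>\<bar> + 4 / L) * B" using D B by simp
    have "expint \<alpha> q V \<le> (\<integral>\<^sup>+t. ennreal (indicator {0..2 * L} t * exp ((\<alpha> - \<gamma>) * q * t)) \<partial>lborel)"
      unfolding expint_def
    proof (intro nn_integral_mono ennreal_leI)
      fix t
      have "\<bar>H t\<bar> powr q \<le> indicator {0..2 * L} t"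
        using out[of t] hat_bounds[of "(t - L) / L"] q
        by (cases "t < 0 \<or> 2 * L < t") (auto simp: H_def indicator_def powr_le1)
      then have "exp ((\<alpha> - \<gamma>) * q * t) * \<bar>H t\<bar> powr q \<le> exp ((\<alpha> - \<gamma>) * q * t) * indicator {0..2 * L} t"
        by (intro mult_left_mono) auto
      also have "exp ((\<alpha> - \<gamma>) * q * t) * \<bar>H t\<bar> powr q = exp (\<alpha> * q * t) * \<bar>V t\<bar> powr q"
        by (simp add: V_def abs_mult powr_mult exp_powr_real mult.assoc[symmetric] exp_add[symmetric]) (simp add: algebra_simps)
      finally show "exp (\<alpha> * q * t) * \<bar>V t\<bar> powr q \<le> indicator {0..2 * L} t * exp ((\<alpha> - \<gamma>) * q * t)"
        by (simp add: mult.commute)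
    qed
    then show "expint \<alpha> q V \<le> ennreal (A powr q)" using intA by (rule order_trans)
    have "expint \<beta> p V' \<le> (\<integral>\<^sup>+t. ennreal ((\<bar>\<gamma>\<bar> + 4 / L) powr p) * ennreal (indicator {0..2 * L} t * exp ((\<beta> - \<gamma>) * p * t)) \<partial>lborel)"
      unfolding expint_def
    proof (intro nn_integral_mono)
      fix t
      have bd: "\<bar>H' t - \<gamma> * H t\<bar> \<le> \<bar>\<gamma>\<bar> + 4 / L"
      proof -
        have "\<bar>H' t\<bar> \<le> 4 / L" using hat'_bound[of "(t - L) / L"] L by (simp add: H'_def abs_mult divide_right_mono)
        moreover have "\<bar>\<gamma> * H t\<bar> \<le> \<bar>\<gamma>\<bar> * 1"
          unfolding abs_mult using hat_bounds[of "(t - L) / L"] by (intro mult_left_mono) (auto simp: H_def)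
        ultimately show ?thesis by linarith
      qed
      have "\<bar>H' t - \<gamma> * H t\<bar> powr p \<le> (\<bar>\<gamma>\<bar> + 4 / L) powr p * indicator {0..2 * L} t"
      proof (cases "t < 0 \<or> 2 * L < t")
        case True then show ?thesis using out[of t] by simp
      next
        case False then show ?thesis using bd p by (auto intro!: powr_mono2)
      qed
      then have "exp ((\<beta> - \<gamma>) * p * t) * \<bar>H' t - \<gamma> * H t\<bar> powr p \<le> exp ((\<beta> - \<gamma>) * p * t) * ((\<bar>\<gamma>\<bar> + 4 / L) powr p * indicator {0..2 * L} t)"
        by (intro mult_left_mono) auto
      also have "exp ((\<beta> - \<gamma>) * p * t) * \<bar>H' t - \<gamma> * H t\<bar> powr p = exp (\<beta> * p * t) * \<bar>V' t\<bar> powr p"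
        by (simp add: V'_def abs_mult powr_mult exp_powr_real mult.assoc[symmetric] exp_add[symmetric]) (simp add: algebra_simps)
      finally show "ennreal (exp (\<beta> * p * t) * \<bar>V' t\<bar> powr p) \<le> ennreal ((\<bar>\<gamma>\<bar> + 4 / L) powr p) * ennreal (indicator {0..2 * L} t * exp ((\<beta> - \<gamma>) * p * t))"
        by (simp add: ennreal_mult[symmetric] ennreal_leI mult_ac)
    qed
    also have "\<dots> = ennreal ((\<bar>\<gamma>\<bar> + 4 / L) powr p) * (\<integral>\<^sup>+t. ennreal (indicator {0..2 * L} t * exp ((\<beta> - \<gamma>) * p * t)) \<partial>lborel)"
      by (rule nn_integral_cmult) measurable
    also have "\<dots> \<le> ennreal ((\<bar>\<gamma>\<bar> + 4 / L) powr p) * ennreal (B powr p)"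
      by (intro mult_left_mono intB) auto
    also have "\<dots> = ennreal (((\<bar>\<gamma>\<bar> + 4 / L) * B) powr p)"
      using D B by (simp add: ennreal_mult[symmetric] powr_mult)
    finally show "expint \<beta> p V' \<le> ennreal (((\<bar>\<gamma>\<bar> + 4 / L) * B) powr p)" .
  qed (rule A)
  moreover have "ennreal ((exp 0 * (1 / 2) * L powr (1 / r)) powr r) \<le> expint 0 r H"
  proof (rule expint_ge_interval[where l="L / 2"])
    fix t assume t: "L / 2 \<le> t" "t \<le> L / 2 + L"
    then have "\<bar>t - L\<bar> \<le> L / 2" unfolding abs_le_iff by linarith
    then have "\<bar>(t - L) / L\<bar> \<le> 1 / 2" using L by (simp add: abs_divide divide_le_eq)
    then have "1 / 2 \<le> \<bar>H t\<bar>" unfolding H_def using hat_half by fastforce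
    then show "1 / 2 \<le> \<bar>H t\<bar> \<and> 0 \<le> 0 * t" by simp
  qed (use r L in auto)
  moreover have "expint 0 r H = expint \<gamma> r V"
    unfolding expint_def
  proof (intro nn_integral_cong arg_cong[where f=ennreal])
    fix t
    show "exp (0 * r * t) * \<bar>H t\<bar> powr r = exp (\<gamma> * r * t) * \<bar>V t\<bar> powr r"
      by (simp add: V_def abs_mult powr_mult exp_powr_real mult.assoc[symmetric] exp_add[symmetric])
  qed
  ultimately have "ennreal ((exp 0 * (1 / 2) * L powr (1 / r)) powr r) \<le> ennreal ((C * (A + (\<bar>\<gamma>\<bar> + 4 / L) * B)) powr r)"
    by (metis order_trans)
  then have "exp 0 * (1 / 2) * L powr (1 / r) \<le> C * (A + (\<bar>\<gamma>\<bar> + 4 / L) * B)"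
    by (rule ennreal_powr_leD) (use r L C A B D in auto)
  then show ?thesis by (simp add: mult_ac)
qed

text \<open>A profile equal to 1 on the left half-line and 0 from 1 on has finite source norms when
  \<alpha> > 0; its target norm can be finite only if e^{\<gamma>t} decays to the left.\<close>

lemma profile_embeds_constants:
  assumes emb: "profile_embeds \<alpha> \<beta> \<gamma> p q r C" and p: "1 \<le> p" and q: "0 < q" and r: "0 < r" and \<alpha>: "0 < \<alpha>"
  shows "0 < \<gamma>"
proof (rule ccontr)
  assume "\<not> 0 < \<gamma>"
  then have \<gamma>: "\<gamma> \<le> 0" by simp
  have C: "0 < C" using emb by (simp add: profile_embeds_def)
  define V where "V t = pos_sq (1 - pos_sq t)" for t
  define V' where "V' t = 2 * max 0 (1 - pos_sq t) * (- (2 * max 0 t))" for t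
  have cs: "continuous_on UNIV pos_sq" unfolding pos_sq_def[abs_def] by (intro continuous_intros)
  have big: "1 \<le> pos_sq t" if "1 \<le> t" for t using that by (simp add: pos_sq_def)
  have nn: "0 \<le> pos_sq t" for t by (simp add: pos_sq_def)
  have V0: "V t = 0" "V' t = 0" if "1 \<le> t" for t
    using big[OF that] by (auto simp: V_def V'_def pos_sq_def[of "1 - pos_sq t"])
  have V1: "\<bar>V t\<bar> \<le> 1" for t
  proof -
    have "max 0 (1 - pos_sq t) \<le> 1" using nn[of t] by simp
    then show ?thesis by (simp add: V_def pos_sq_def[of "1 - pos_sq t"] power_le_one)
  qed
  have V'4: "\<bar>V' t\<bar> \<le> 4" if "0 \<le> t" "t \<le> 1" for t
  proof -
    have "\<bar>max 0 (1 - pos_sq t)\<bar> * \<bar>max 0 t\<bar> \<le> 1 * 1" using that nn[of t] by (intro mult_mono) auto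
    then show ?thesis by (simp add: V'_def abs_mult)
  qed
  let ?A = "(exp (\<alpha> * q) / (\<alpha> * q)) powr (1 / q)" and ?B = "exp \<bar>\<beta>\<bar> * 4 * 1 powr (1 / p)"
  have "expint \<gamma> r V \<le> ennreal ((C * (?A + ?B)) powr r)"
  proof (rule profile_embedsD[OF emb])
    show "(V has_real_derivative V' t) (at t)" for t
      unfolding V_def[abs_def] V'_def
      by (rule DERIV_chain2[OF pos_sq_deriv]) (auto intro!: derivative_eq_intros pos_sq_deriv)
    show "continuous_on UNIV V'" unfolding V'_def[abs_def] by (intro continuous_intros cs)
    have "expint \<alpha> q V \<le> (\<integral>\<^sup>+t. ennreal (indicator {..1} t * exp (\<alpha> * q * t)) \<partial>lborel)"
      unfolding expint_def
    proof (intro nn_integral_mono ennreal_leI)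
      fix t
      have "\<bar>V t\<bar> powr q \<le> indicator {..1} t"
        using V0[of t] V1[of t] q by (cases "1 \<le> t") (auto simp: indicator_def powr_le1)
      then show "exp (\<alpha> * q * t) * \<bar>V t\<bar> powr q \<le> indicator {..1} t * exp (\<alpha> * q * t)"
        by (subst (2) mult.commute) (intro mult_left_mono, auto)
    qed
    also have "\<dots> = ennreal (exp (\<alpha> * q) / (\<alpha> * q))"
      using nn_integral_exp_atMost[of "\<alpha> * q" 1] \<alpha> q by simp
    also have "\<dots> = ennreal (?A powr q)" using \<alpha> q by (simp add: powr_powr)
    finally show "expint \<alpha> q V \<le> ennreal (?A powr q)" .
    show "expint \<beta> p V' \<le> ennreal (?B powr p)"
    proof (rule expint_le_interval[where l=0])
      show "\<bar>V' t\<bar> \<le> 4 \<and> \<beta> * t \<le> \<bar>\<beta>\<bar>" if "0 \<le> t" "t \<le> 0 + 1" for t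
      proof -
        have "\<beta> * t \<le> \<bar>\<beta>\<bar> * t" using that by (intro mult_right_mono) auto
        also have "\<dots> \<le> \<bar>\<beta>\<bar> * 1" using that by (intro mult_left_mono) auto
        finally show ?thesis using V'4 that by simp
      qed
      show "V' t = 0" if "t < 0 \<or> 0 + 1 < t" for t
        using that V0[of t] by (auto simp: V'_def)
    qed (use p in auto)
  qed auto
  \<comment> \<open>For \<gamma> <= 0 the weight is at least 1 on [-w, 0], so the target integral is
    at least w, for every w.\<close>
  moreover have "ennreal ((exp 0 * 1 * w powr (1 / r)) powr r) \<le> expint \<gamma> r V" if w: "0 \<le> w" for w
    by (rule expint_ge_interval[where l="- w"])
       (use r w \<gamma> in \<open>auto simp: V_def pos_sq_def mult_nonpos_nonpos\<close>)
  ultimately have "ennreal ((exp 0 * 1 * w powr (1 / r)) powr r) \<le> ennreal ((C * (?A + ?B)) powr r)" if "0 \<le> w" for w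
    using that order_trans by blast
  then have "w \<le> (C * (?A + ?B)) powr r" if "0 \<le> w" for w
    using that r by (auto simp: powr_powr ennreal_le_iff)
  from this[of "(C * (?A + ?B)) powr r + 1"] show False by simp
qed

text \<open>Every test below reduces to this comparison of exponents as L grows.\<close>

lemma powr_growth_exponent:
  assumes "\<And>L. 1 \<le> L \<Longrightarrow> L powr s \<le> K * (L powr x + L powr y)" and K: "0 \<le> K"
  shows "s \<le> max x (y::real)"
proof (rule ccontr)
  assume "\<not> ?thesis"
  then have m: "max x y < s" by (simp only: not_le)
  define e where "e = s - max x y"
  have e: "0 < e" using m by (simp add: e_def)
  \<comment> \<open>Chosen so that L^e = 2K + 1 exceeds 2K, the bound left after division by the
    larger power on the right; the summand 1 also secures L >= 1.\<close>
  define L where "L = (2 * K + 1) powr (1 / e)"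
  have L: "1 \<le> L" unfolding L_def using K e by (intro ge_one_powr_ge_zero) auto
  have "L powr s \<le> K * (L powr x + L powr y)" by (rule assms(1)[OF L])
  also have "\<dots> \<le> K * (L powr max x y + L powr max x y)"
    using L K by (intro mult_left_mono add_mono powr_mono) auto
  finally have "L powr s \<le> 2 * K * L powr max x y" by simp
  moreover have "L powr s = L powr e * L powr max x y" by (simp add: e_def powr_add[symmetric])
  moreover have "0 < L powr max x y" using L by simp
  ultimately have "L powr e \<le> 2 * K" by simp
  moreover have "L powr e = 2 * K + 1" using K e by (simp add: L_def powr_powr)
  ultimately show False by simp
qed

text \<open>Bumps of width 1 at \<tau> = ln L turn the exponentials into powers of L.\<close>

lemma profile_embeds_translation:
  assumes emb: "profile_embeds \<alpha> \<beta> \<gamma> p q r C" and p: "1 \<le> p" and q: "0 < q" and r: "0 < r"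
  shows "\<gamma> \<le> max \<alpha> \<beta>"
proof -
  obtain K where K: "0 \<le> K" and le: "\<And>\<tau> \<delta>. 0 < \<delta> \<Longrightarrow> \<delta> \<le> 1 \<Longrightarrow>
     exp (\<gamma> * \<tau>) * \<delta> powr (1 / r) \<le> K * (exp (\<alpha> * \<tau>) * \<delta> powr (1 / q) + exp (\<beta> * \<tau>) * \<delta> powr (1 / p - 1))"
    using profile_embeds_concentration[OF emb p q r] by blast
  show ?thesis
  proof (rule powr_growth_exponent[OF _ K])
    fix L :: real assume "1 \<le> L"
    then show "L powr \<gamma> \<le> K * (L powr \<alpha> + L powr \<beta>)"
      using le[of 1 "ln L"] by (simp add: powr_def)
  qed
qed

lemma profile_embeds_theta:
  assumes emb: "profile_embeds \<alpha> \<beta> \<gamma> p q r C" and p: "1 \<le> p" and q: "0 < q" and r: "0 < r" and ne: "\<alpha> \<noteq> \<beta>"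
  shows "(1 - q / r) / (q * (1 - 1 / p) + 1) \<le> (\<gamma> - \<alpha>) / (\<beta> - \<alpha>)"
proof -
  obtain K where K: "0 \<le> K" and le: "\<And>\<tau> \<delta>. 0 < \<delta> \<Longrightarrow> \<delta> \<le> 1 \<Longrightarrow>
     exp (\<gamma> * \<tau>) * \<delta> powr (1 / r) \<le> K * (exp (\<alpha> * \<tau>) * \<delta> powr (1 / q) + exp (\<beta> * \<tau>) * \<delta> powr (1 / p - 1))"
    using profile_embeds_concentration[OF emb p q r] by blast
  define k where "k = 1 - 1 / p + 1 / q"
  have k: "0 < k" using p q by (auto simp: k_def intro!: add_nonneg_pos)
  have kq: "q * (1 - 1 / p) + 1 = q * k" using q by (simp add: k_def algebra_simps)
  \<comment> \<open>Bumps of width 1 / L are placed at \<rho> ln L. This \<rho> gives both terms on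
    the right the same power of L, so that the maximum of the two exponents is a single explicit
    number.\<close>
  define \<rho> where "\<rho> = k / (\<alpha> - \<beta>)"
  have "\<gamma> * \<rho> - 1 / r \<le> max (\<alpha> * \<rho> - 1 / q) (\<beta> * \<rho> - (1 / p - 1))"
  proof (rule powr_growth_exponent[OF _ K])
    fix L :: real assume L: "1 \<le> L"
    have "exp (x * (\<rho> * ln L)) * (1 / L) powr y = L powr (x * \<rho> - y)" for x y
    proof -
      have "exp (x * (\<rho> * ln L)) = L powr (x * \<rho>)" using L by (simp add: powr_def mult.assoc)
      moreover have "(1 / L) powr y = L powr - y" using L by (simp add: powr_minus_divide powr_divide)
      ultimately show ?thesis by (simp add: powr_add[symmetric])
    qed
    then show "L powr (\<gamma> * \<rho> - 1 / r) \<le> K * (L powr (\<alpha> * \<rho> - 1 / q) + L powr (\<beta> * \<rho> - (1 / p - 1)))"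
      using le[of "1 / L" "\<rho> * ln L"] L by simp
  qed
  moreover have "(\<alpha> - \<beta>) * \<rho> = k" using ne by (simp add: \<rho>_def)
  then have "\<beta> * \<rho> - (1 / p - 1) = \<alpha> * \<rho> - 1 / q" by (simp add: k_def algebra_simps)
  ultimately have "(\<gamma> - \<alpha>) * \<rho> \<le> 1 / r - 1 / q" by (simp add: algebra_simps)
  then have "(1 / q - 1 / r) / k \<le> - ((\<gamma> - \<alpha>) * \<rho>) / k" using k by (intro divide_right_mono) auto
  also have "- ((\<gamma> - \<alpha>) * \<rho>) / k = (\<gamma> - \<alpha>) / (\<beta> - \<alpha>)"
    using k ne by (simp add: \<rho>_def divide_simps) (simp add: algebra_simps)
  also have "(1 / q - 1 / r) / k = (1 - q / r) / (q * (1 - 1 / p) + 1)"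
    unfolding kq using q k r by (simp add: field_simps)
  finally show ?thesis .
qed

lemma interval_exp_integral_le:
  assumes "k < 0"
  shows "(\<integral>\<^sup>+t. ennreal (indicator {0..L} t * exp (k * t)) \<partial>lborel) \<le> ennreal (1 / (- k))"
proof -
  have "(\<integral>\<^sup>+t. ennreal (indicator {0..L} t * exp (k * t)) \<partial>lborel) \<le> (\<integral>\<^sup>+t. ennreal (indicator {0..} t * exp (- (- k) * t)) \<partial>lborel)"
    by (intro nn_integral_mono ennreal_leI) (auto simp: indicator_def)
  also have "\<dots> = ennreal (1 / (- k))" using nn_integral_exp_atLeast[of "- k" 0] assms by simp
  finally show ?thesis .
qed

lemma interval_exp_integral_0:
  assumes "0 \<le> L" "k = 0"
  shows "(\<integral>\<^sup>+t. ennreal (indicator {0..L} t * exp (k * t)) \<partial>lborel) = ennreal L"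
proof -
  have "(\<integral>\<^sup>+t. ennreal (indicator {0..L} t * exp (k * t)) \<partial>lborel) = (\<integral>\<^sup>+t. indicator {0..L} t \<partial>lborel)"
    using assms by (intro nn_integral_cong) (simp add: indicator_def)
  then show ?thesis using assms by simp
qed

text \<open>Spreading with \<gamma> = \<alpha>: the norm of the profile grows like L^{1/q}, while
  the derivative norm stays bounded, either because e^{(\<beta>-\<alpha>)t} decays or, without
  weights, because p >= 1 lets the slope 4 / L compensate for (2L)^{1/p}.\<close>

lemma profile_embeds_spread_alpha:
  assumes emb: "profile_embeds \<alpha> \<beta> \<alpha> p q r C" and p: "1 \<le> p" and q: "0 < q" and r: "0 < r" and lt: "\<beta> < \<alpha> \<or> \<alpha> = 0 \<and> \<beta> = 0"
  shows "q \<le> r"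
proof -
  have C: "0 < C" using emb by (simp add: profile_embeds_def)
  obtain D where D: "0 \<le> D" and le: "\<And>L. 1 \<le> L \<Longrightarrow> L powr (1 / r) \<le> 2 * C * (2 powr (1 / q) * L powr (1 / q) + D)"
  proof (cases "\<beta> < \<alpha>")
    case True
    let ?B = "(1 / (- ((\<beta> - \<alpha>) * p))) powr (1 / p)"
    have neg: "(\<beta> - \<alpha>) * p < 0" using True p by (simp add: mult_neg_pos)
    show ?thesis
    proof (rule that[of "(\<bar>\<alpha>\<bar> + 4) * ?B"])
      fix L :: real assume L: "1 \<le> L"
      have "L powr (1 / r) \<le> 2 * C * ((2 * L) powr (1 / q) + (\<bar>\<alpha>\<bar> + 4 / L) * ?B)"
      proof (rule profile_embeds_spreading[OF emb p q r L])
        show "(\<integral>\<^sup>+t. ennreal (indicator {0..2 * L} t * exp ((\<alpha> - \<alpha>) * q * t)) \<partial>lborel) \<le> ennreal (((2 * L) powr (1 / q)) powr q)"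
          using interval_exp_integral_0[of "2 * L" "(\<alpha> - \<alpha>) * q"] q L by (simp add: powr_powr)
        have "?B powr p = 1 / (- ((\<beta> - \<alpha>) * p))" using p neg by (simp add: powr_powr divide_nonneg_neg)
        then show "(\<integral>\<^sup>+t. ennreal (indicator {0..2 * L} t * exp ((\<beta> - \<alpha>) * p * t)) \<partial>lborel) \<le> ennreal (?B powr p)"
          using interval_exp_integral_le[OF neg, of "2 * L"] by (simp only:)
      qed auto
      also have "\<dots> \<le> 2 * C * ((2 * L) powr (1 / q) + (\<bar>\<alpha>\<bar> + 4) * ?B)"
        using C L by (intro mult_left_mono add_left_mono mult_right_mono) (auto simp: divide_le_eq)
      finally show "L powr (1 / r) \<le> 2 * C * (2 powr (1 / q) * L powr (1 / q) + (\<bar>\<alpha>\<bar> + 4) * ?B)"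
        using L by (simp add: powr_mult)
    qed auto
  next
    case False
    then have z: "\<alpha> = 0" "\<beta> = 0" using lt by auto
    show ?thesis
    \<comment> \<open>8 is 4 / L times 2L, the derivative term after (2L)^{1/p} <= 2L.\<close>
    proof (rule that[of 8])
      fix L :: real assume L: "1 \<le> L"
      have "L powr (1 / r) \<le> 2 * C * ((2 * L) powr (1 / q) + (\<bar>\<alpha>\<bar> + 4 / L) * (2 * L) powr (1 / p))"
      proof (rule profile_embeds_spreading[OF emb p q r L])
        show "(\<integral>\<^sup>+t. ennreal (indicator {0..2 * L} t * exp ((\<alpha> - \<alpha>) * q * t)) \<partial>lborel) \<le> ennreal (((2 * L) powr (1 / q)) powr q)"
          using interval_exp_integral_0[of "2 * L" "(\<alpha> - \<alpha>) * q"] q L by (simp add: powr_powr)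
        show "(\<integral>\<^sup>+t. ennreal (indicator {0..2 * L} t * exp ((\<beta> - \<alpha>) * p * t)) \<partial>lborel) \<le> ennreal (((2 * L) powr (1 / p)) powr p)"
          using interval_exp_integral_0[of "2 * L" "(\<beta> - \<alpha>) * p"] p L z by (simp add: powr_powr)
      qed auto
      also have "(2 * L) powr (1 / p) \<le> (2 * L) powr 1" using p L by (intro powr_mono) auto
      then have "2 * C * ((2 * L) powr (1 / q) + (\<bar>\<alpha>\<bar> + 4 / L) * (2 * L) powr (1 / p)) \<le> 2 * C * ((2 * L) powr (1 / q) + (\<bar>\<alpha>\<bar> + 4 / L) * (2 * L))"
        using C L by (intro mult_left_mono add_left_mono) auto
      also have "\<dots> = 2 * C * (2 powr (1 / q) * L powr (1 / q) + 8)" using L z by (simp add: powr_mult)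
      finally show "L powr (1 / r) \<le> 2 * C * (2 powr (1 / q) * L powr (1 / q) + 8)" .
    qed auto
  qed
  have "1 / r \<le> max (1 / q) 0"
  proof (rule powr_growth_exponent[where K="2 * C * (2 powr (1 / q) + D)"])
    fix L :: real assume L: "1 \<le> L"
    have "2 powr (1 / q) * L powr (1 / q) + D * 1 \<le> (2 powr (1 / q) + D) * (L powr (1 / q) + L powr 0)"
      using L D by (simp add: algebra_simps)
    then have "2 * C * (2 powr (1 / q) * L powr (1 / q) + D) \<le> 2 * C * ((2 powr (1 / q) + D) * (L powr (1 / q) + L powr 0))"
      using C by (intro mult_left_mono) auto
    then show "L powr (1 / r) \<le> 2 * C * (2 powr (1 / q) + D) * (L powr (1 / q) + L powr 0)"
      using le[OF L] by (simp only: mult.assoc)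
  qed (use C D in auto)
  then show ?thesis using q r by (simp add: max_def divide_le_cancel split: if_splits) (simp add: field_simps)
qed

text \<open>Spreading with \<gamma> = \<beta> > \<alpha>: now the norm of the profile stays bounded
  and the derivative norm grows like L^{1/p}.\<close>

lemma profile_embeds_spread_beta:
  assumes emb: "profile_embeds \<alpha> \<beta> \<beta> p q r C" and p: "1 \<le> p" and q: "0 < q" and r: "0 < r" and lt: "\<alpha> < \<beta>"
  shows "p \<le> r"
proof -
  have C: "0 < C" using emb by (simp add: profile_embeds_def)
  let ?A = "(1 / (- ((\<alpha> - \<beta>) * q))) powr (1 / q)"
  have neg: "(\<alpha> - \<beta>) * q < 0" using lt q by (simp add: mult_neg_pos)
  have le: "L powr (1 / r) \<le> 2 * C * (?A + (\<bar>\<beta>\<bar> + 4) * (2 powr (1 / p) * L powr (1 / p)))" if L: "1 \<le> L" for L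
  proof -
    have "L powr (1 / r) \<le> 2 * C * (?A + (\<bar>\<beta>\<bar> + 4 / L) * (2 * L) powr (1 / p))"
    proof (rule profile_embeds_spreading[OF emb p q r L])
      show "(\<integral>\<^sup>+t. ennreal (indicator {0..2 * L} t * exp ((\<beta> - \<beta>) * p * t)) \<partial>lborel) \<le> ennreal (((2 * L) powr (1 / p)) powr p)"
        using interval_exp_integral_0[of "2 * L" "(\<beta> - \<beta>) * p"] p L by (simp add: powr_powr)
      have "?A powr q = 1 / (- ((\<alpha> - \<beta>) * q))" using q neg by (simp add: powr_powr divide_nonneg_neg)
      then show "(\<integral>\<^sup>+t. ennreal (indicator {0..2 * L} t * exp ((\<alpha> - \<beta>) * q * t)) \<partial>lborel) \<le> ennreal (?A powr q)"
        using interval_exp_integral_le[OF neg, of "2 * L"] by (simp only:)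
    qed auto
    also have "\<dots> \<le> 2 * C * (?A + (\<bar>\<beta>\<bar> + 4) * (2 * L) powr (1 / p))"
      using C L by (intro mult_left_mono add_left_mono mult_right_mono) (auto simp: divide_le_eq)
    finally show ?thesis using L by (simp add: powr_mult)
  qed
  let ?D = "(\<bar>\<beta>\<bar> + 4) * 2 powr (1 / p)"
  have "1 / r \<le> max 0 (1 / p)"
  proof (rule powr_growth_exponent[where K="2 * C * (?A + ?D)"])
    fix L :: real assume L: "1 \<le> L"
    have "?A * 1 + ?D * L powr (1 / p) \<le> (?A + ?D) * (L powr 0 + L powr (1 / p))"
      using L by (simp add: algebra_simps add_nonneg_nonneg)
    then have "2 * C * (?A * 1 + ?D * L powr (1 / p)) \<le> 2 * C * ((?A + ?D) * (L powr 0 + L powr (1 / p)))"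
      using C by (intro mult_left_mono) auto
    then show "L powr (1 / r) \<le> 2 * C * (?A + ?D) * (L powr 0 + L powr (1 / p))"
      using le[OF L] by (simp only: mult.assoc mult_1_right)
  qed (use C in auto)
  then show ?thesis using p r by (simp add: max_def divide_le_cancel split: if_splits) (simp add: field_simps)
qed

text \<open>With all exponents equal both source norms grow with L, so 1 / r can be compared only
  with the larger of 1 / q and 1 / p.\<close>

lemma profile_embeds_spread_both:
  assumes emb: "profile_embeds \<alpha> \<alpha> \<alpha> p q r C" and p: "1 \<le> p" and q: "0 < q" and r: "0 < r"
  shows "min p q \<le> r"
proof -
  have C: "0 < C" using emb by (simp add: profile_embeds_def)
  let ?D = "2 powr (1 / q) + (\<bar>\<alpha>\<bar> + 4) * 2 powr (1 / p)"
  have "1 / r \<le> max (1 / q) (1 / p)"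
  proof (rule powr_growth_exponent[where K="2 * C * ?D"])
    fix L :: real assume L: "1 \<le> L"
    have "L powr (1 / r) \<le> 2 * C * ((2 * L) powr (1 / q) + (\<bar>\<alpha>\<bar> + 4 / L) * (2 * L) powr (1 / p))"
    proof (rule profile_embeds_spreading[OF emb p q r L])
      show "(\<integral>\<^sup>+t. ennreal (indicator {0..2 * L} t * exp ((\<alpha> - \<alpha>) * q * t)) \<partial>lborel) \<le> ennreal (((2 * L) powr (1 / q)) powr q)"
        using interval_exp_integral_0[of "2 * L" "(\<alpha> - \<alpha>) * q"] q L by (simp add: powr_powr)
      show "(\<integral>\<^sup>+t. ennreal (indicator {0..2 * L} t * exp ((\<alpha> - \<alpha>) * p * t)) \<partial>lborel) \<le> ennreal (((2 * L) powr (1 / p)) powr p)"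
        using interval_exp_integral_0[of "2 * L" "(\<alpha> - \<alpha>) * p"] p L by (simp add: powr_powr)
    qed auto
    also have "\<dots> \<le> 2 * C * ((2 * L) powr (1 / q) + (\<bar>\<alpha>\<bar> + 4) * (2 * L) powr (1 / p))"
      using C L by (intro mult_left_mono add_left_mono mult_right_mono) (auto simp: divide_le_eq)
    also have "\<dots> = 2 * C * (2 powr (1 / q) * L powr (1 / q) + (\<bar>\<alpha>\<bar> + 4) * 2 powr (1 / p) * L powr (1 / p))"
      using L by (simp add: powr_mult)
    also have "\<dots> \<le> 2 * C * (?D * (L powr (1 / q) + L powr (1 / p)))"
    proof -
      have "x * u + y * w \<le> (x + y) * (u + w)" if "0 \<le> x" "0 \<le> y" "0 \<le> u" "0 \<le> w" for x y u w :: real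
        using that by (simp add: algebra_simps)
      then show ?thesis using C by (intro mult_left_mono) auto
    qed
    finally show "L powr (1 / r) \<le> 2 * C * ?D * (L powr (1 / q) + L powr (1 / p))" by (simp only: mult.assoc)
  qed (use C in auto)
  then have "1 / r \<le> 1 / q \<or> 1 / r \<le> 1 / p" by (auto simp: max_def split: if_splits)
  then show ?thesis using p q r by (auto simp: min_def field_simps)
qed

text \<open>Translation in both directions confines \<gamma> to the closed interval between \<alpha>
  and \<beta>. For \<alpha> \<noteq> \<beta>: at \<gamma> = \<alpha> concentration gives r <= q and
  spreading q <= r; at \<gamma> = \<beta> spreading gives p <= r; in the interior concentration
  gives the theta condition, and the sign that constant profiles impose on \<gamma> confines it to
  the side of 0 on which \<alpha> lies.\<close>

theorem profile_embeds_necessary: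
  assumes emb: "profile_embeds \<alpha> \<beta> \<gamma> p q r C" and p: "1 \<le> p" and q: "0 < q" and r: "0 < r"
  shows "(((\<alpha> \<le> 0 \<and> \<beta> \<le> 0) \<or> (0 \<le> \<alpha> \<and> 0 \<le> \<beta>)) \<and> \<alpha> \<noteq> \<beta> \<and> min \<alpha> \<beta> < \<gamma> \<and> \<gamma> < max \<alpha> \<beta>
          \<and> (1 - q / r) / (q * (1 - 1 / p) + 1) \<le> (\<gamma> - \<alpha>) / (\<beta> - \<alpha>))
    \<or> (((\<alpha> < 0 \<and> 0 < \<beta>) \<or> (0 < \<alpha> \<and> \<beta> < 0)) \<and> min \<alpha> 0 < \<gamma> \<and> \<gamma> < max \<alpha> 0
          \<and> (1 - q / r) / (q * (1 - 1 / p) + 1) \<le> (\<gamma> - \<alpha>) / (\<beta> - \<alpha>))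
    \<or> (p \<le> r \<and> ((\<alpha> \<le> 0 \<and> \<beta> < 0) \<or> (0 \<le> \<alpha> \<and> 0 < \<beta>)) \<and> \<gamma> = \<beta>)
    \<or> (r = q \<and> \<gamma> = \<alpha>)
    \<or> (p \<noteq> q \<and> min p q \<le> r \<and> r \<le> max p q \<and> \<alpha> = \<beta> \<and> \<alpha> \<noteq> 0 \<and> \<gamma> = \<alpha>)
    \<or> (\<alpha> = 0 \<and> \<beta> = 0 \<and> q < r \<and> \<gamma> = 0)"
proof -
  note emb' = profile_embeds_reflect[OF emb]
  have hi: "\<gamma> \<le> max \<alpha> \<beta>" by (rule profile_embeds_translation[OF emb p q r])
  have "- \<gamma> \<le> max (- \<alpha>) (- \<beta>)" by (rule profile_embeds_translation[OF emb' p q r])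
  then have lo: "min \<alpha> \<beta> \<le> \<gamma>" by (auto simp: min_def max_def split: if_splits)
  have c1: "0 < \<alpha> \<Longrightarrow> 0 < \<gamma>" by (rule profile_embeds_constants[OF emb p q r])
  have c2: "\<alpha> < 0 \<Longrightarrow> \<gamma> < 0" using profile_embeds_constants[OF emb' p q r] by simp
  show ?thesis
  proof (cases "\<alpha> = \<beta>")
    case True
    then have \<gamma>: "\<gamma> = \<alpha>" using hi lo by simp
    show ?thesis
    proof (cases "\<alpha> = 0")
      case z: True
      have "q \<le> r" by (rule profile_embeds_spread_alpha[of \<alpha> \<beta>]) (use emb \<gamma> p q r True z in auto)
      then show ?thesis using \<gamma> z True by auto
    next
      case False
      \<comment> \<open>Here \<alpha> = \<beta> \<noteq> 0. Values of r above max p q, and the case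
        p = q, satisfy p <= r and thus belong to the Hardy alternative.\<close>
      have "min p q \<le> r" by (rule profile_embeds_spread_both[of \<alpha>]) (use emb \<gamma> p q r True in auto)
      then show ?thesis using \<gamma> False True by (auto simp: min_def max_def split: if_splits)
    qed
  next
    case False
    note th = profile_embeds_theta[OF emb p q r False]
    have "\<gamma> = \<alpha> \<or> \<gamma> = \<beta> \<or> min \<alpha> \<beta> < \<gamma> \<and> \<gamma> < max \<alpha> \<beta>"
      using hi lo by (cases "\<alpha> \<le> \<beta>"; simp add: min_def max_def; linarith)
    then consider "\<gamma> = \<alpha>" | "\<gamma> = \<beta>" | "min \<alpha> \<beta> < \<gamma>" "\<gamma> < max \<alpha> \<beta>" by blast
    then show ?thesis
    proof cases
      case 1
      have "q \<le> r"
      proof (cases "\<beta> < \<alpha>")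
        case True
        show ?thesis by (rule profile_embeds_spread_alpha[of \<alpha> \<beta>]) (use emb 1 p q r True in auto)
      next
        case f: False
        show ?thesis by (rule profile_embeds_spread_alpha[of "- \<alpha>" "- \<beta>"]) (use emb' 1 p q r f False in auto)
      qed
      moreover have "r \<le> q"
      proof -
        have pos: "0 < q * (1 - 1 / p) + 1" using p q by (auto intro!: add_nonneg_pos)
        have "(1 - q / r) / (q * (1 - 1 / p) + 1) \<le> 0" using th 1 by simp
        then have "1 - q / r \<le> 0" using pos by (simp add: divide_le_0_iff)
        then show ?thesis using r by (simp add: field_simps)
      qed
      ultimately show ?thesis using 1 by simp
    next
      case 2
      have "p \<le> r"
      proof (cases "\<alpha> < \<beta>")
        case True
        show ?thesis by (rule profile_embeds_spread_beta[of \<alpha> \<beta>]) (use emb 2 p q r True in auto)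
      next
        case f: False
        show ?thesis by (rule profile_embeds_spread_beta[of "- \<alpha>" "- \<beta>"]) (use emb' 2 p q r f False in auto)
      qed
      \<comment> \<open>For \<alpha> \<noteq> 0 the constant profiles give \<gamma> = \<beta> the
        strict sign of \<alpha>, which excludes opposite signs as well as \<beta> = 0.\<close>
      then show ?thesis using 2 c1 c2 False by (cases "\<alpha> = 0"; cases "0 < \<alpha>"; cases "0 < \<beta>") auto
    next
      case 3
      then show ?thesis using th c1 c2 False by (auto simp: min_def max_def split: if_splits)
    qed
  qed
qed

section \<open>The scale-invariant measure\<close>

definition sphere_area :: "'n::finite itself \<Rightarrow> real" where
  "sphere_area _ = real CARD('n) * unit_ball_vol (real CARD('n))"

lemma sphere_area_pos: "0 < sphere_area TYPE('n::finite)"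
  by (simp add: sphere_area_def)

text \<open>The density |x|^{-N} makes the measure invariant under dilations, hence invariant under
  translations of ln |x|; division by the area of the sphere normalises the image to
  \<open>lborel\<close> exactly.\<close>

definition log_measure :: "(real^'n) measure" where
  "log_measure = density lebesgue (\<lambda>x. ennreal (norm x powr - real CARD('n) / sphere_area TYPE('n)))"

text \<open>The value at the origin carries no meaning, which is why the identities below assume x
  \<noteq> 0 or hold almost everywhere.\<close>

definition log_norm :: "real^'n \<Rightarrow> real" where "log_norm x = ln (norm x)"

lemma log_norm_borel [measurable]: "log_norm \<in> borel_measurable borel"
  unfolding log_norm_def by measurable

lemma borel_imp_lebesgue: "f \<in> borel_measurable borel \<Longrightarrow> f \<in> borel_measurable lebesgue"
  by (simp add: measurable_completion)

lemma log_norm_lebesgue [measurable]: "log_norm \<in> borel_measurable lebesgue"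
  by (rule borel_imp_lebesgue) measurable

lemma norm_lebesgue [measurable]: "(norm :: real^'n \<Rightarrow> real) \<in> borel_measurable lebesgue"
  by (rule borel_imp_lebesgue) measurable

lemma sets_log_measure [measurable_cong, simp]: "sets log_measure = sets lebesgue"
  by (simp add: log_measure_def)

lemma space_log_measure [simp]: "space log_measure = UNIV"
  by (simp add: log_measure_def)

lemma exp_log_norm: "x \<noteq> 0 \<Longrightarrow> exp (log_norm x) = norm x"
  by (simp add: log_norm_def)

lemma exp_mult_log_norm: "x \<noteq> 0 \<Longrightarrow> exp (k * log_norm x) = norm x powr k"
  by (simp add: log_norm_def powr_def)

lemma AE_lebesgue_neq_0: "AE x in lebesgue. (x::real^'n) \<noteq> 0"
proof -
  have "{0::real^'n} \<in> null_sets lebesgue" by (simp add: null_sets_def)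
  then show ?thesis by (rule AE_I') auto
qed

text \<open>The density is positive off the origin, and the origin is a null set.\<close>

lemma AE_log_measure: "(AE x in log_measure. P x) \<longleftrightarrow> (AE x in lebesgue. P (x::real^'n))"
proof -
  have "(AE x in log_measure. P x) \<longleftrightarrow> (AE x in lebesgue. 0 < ennreal ((norm x::real) powr - real CARD('n) / sphere_area TYPE('n)) \<longrightarrow> P (x::real^'n))"
    unfolding log_measure_def by (rule AE_density) measurable
  also have "\<dots> \<longleftrightarrow> (AE x in lebesgue. P x)"
  proof
    assume "AE x in lebesgue. 0 < ennreal (norm x powr - real CARD('n) / sphere_area TYPE('n)) \<longrightarrow> P (x::real^'n)"
    then show "AE x in lebesgue. P x"
      using AE_lebesgue_neq_0 by eventually_elim (simp add: sphere_area_pos)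
  qed auto
  finally show ?thesis .
qed

lemma nn_integral_log_measure:
  assumes "f \<in> borel_measurable lebesgue"
  shows "(\<integral>\<^sup>+x. f x \<partial>log_measure) = (\<integral>\<^sup>+x. ennreal (norm (x::real^'n) powr - real CARD('n) / sphere_area TYPE('n)) * f x \<partial>lebesgue)"
  unfolding log_measure_def using assms by (intro nn_integral_density) measurable

lemma integral_log_measure:
  fixes f :: "real^'n \<Rightarrow> real"
  assumes "f \<in> borel_measurable lebesgue"
  shows "(\<integral>x. f x \<partial>log_measure) = (\<integral>x. norm x powr - real CARD('n) / sphere_area TYPE('n) * f x \<partial>lebesgue)"
  unfolding log_measure_def using assms sphere_area_pos[where 'n='n]
  by (subst integral_density) (auto simp: less_imp_le)

lemma integrable_log_measure_iff:
  fixes f :: "real^'n \<Rightarrow> real"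
  assumes "f \<in> borel_measurable lebesgue"
  shows "integrable log_measure f \<longleftrightarrow> integrable lebesgue (\<lambda>x. norm x powr - real CARD('n) / sphere_area TYPE('n) * f x)"
  unfolding log_measure_def using assms sphere_area_pos[where 'n='n]
  by (subst integrable_density) (auto simp: less_imp_le)

lemma emeasure_log_norm_le:
  "emeasure lebesgue {x::real^'n. log_norm x \<le> t} = ennreal (unit_ball_vol (real CARD('n)) * exp (real CARD('n) * t))"
proof -
  have "emeasure lebesgue {x::real^'n. log_norm x \<le> t} = emeasure lebesgue (cball (0::real^'n) (exp t))"
  proof (rule emeasure_eq_AE)
    show "AE x in lebesgue. x \<in> {x::real^'n. log_norm x \<le> t} \<longleftrightarrow> x \<in> cball 0 (exp t)"
      using AE_lebesgue_neq_0
      by eventually_elim (simp, metis exp_le_cancel_iff exp_log_norm)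
    have "{x \<in> space lebesgue. log_norm (x::real^'n) \<le> t} \<in> sets lebesgue" by measurable
    then show "{x::real^'n. log_norm x \<le> t} \<in> sets lebesgue" by simp
  qed auto
  also have "\<dots> = ennreal (unit_ball_vol (real CARD('n)) * exp t ^ CARD('n))"
    by (simp add: emeasure_cball)
  also have "exp t ^ CARD('n) = exp (real CARD('n) * t)" by (simp add: exp_of_nat_mult)
  finally show ?thesis .
qed

text \<open>Both measures are compared on the half-lines \<open>{..t}\<close>, where the volume of a
  ball is all that has to be known. This takes the place of polar coordinates and involves no
  measure on the sphere.\<close>

lemma distr_log_norm:
  "distr lebesgue borel (log_norm :: real^'n \<Rightarrow> real) = density lborel (\<lambda>t. ennreal (sphere_area TYPE('n) * exp (real CARD('n) * t)))"
  (is "?F = ?G")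
proof -
  let ?N = "real CARD('n)"
  have N: "0 < ?N" by simp
  have F: "emeasure ?F {..t} = ennreal (unit_ball_vol ?N * exp (?N * t))" for t
    using emeasure_log_norm_le[where 'n='n, of t]
    by (subst emeasure_distr) (auto simp: vimage_def)
  have G: "emeasure ?G {..t} = ennreal (unit_ball_vol ?N * exp (?N * t))" for t
  proof -
    have "emeasure ?G {..t} = (\<integral>\<^sup>+s. ennreal (sphere_area TYPE('n) * exp (?N * s)) * indicator {..t} s \<partial>lborel)"
      by (rule emeasure_density) auto
    also have "\<dots> = (\<integral>\<^sup>+s. ennreal (sphere_area TYPE('n)) * ennreal (indicator {..t} s * exp (?N * s)) \<partial>lborel)"
      using sphere_area_pos[where 'n='n]
      by (intro nn_integral_cong) (auto simp: indicator_def ennreal_mult[symmetric])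
    also have "\<dots> = ennreal (sphere_area TYPE('n)) * ennreal (exp (?N * t) / ?N)"
      using nn_integral_exp_atMost[OF N, of t] by (subst nn_integral_cmult) auto
    also have "\<dots> = ennreal (unit_ball_vol ?N * exp (?N * t))"
      by (simp add: ennreal_mult[symmetric] sphere_area_def)
    finally show ?thesis .
  qed
  show ?thesis
  proof (rule measure_eqI_generator_eq[where E="range atMost" and \<Omega>=UNIV and A="\<lambda>i. {..real i}"])
    show "Int_stable (range atMost :: real set set)"
      by (auto simp: Int_stable_def)
    show "sets ?F = sigma_sets UNIV (range atMost)" "sets ?G = sigma_sets UNIV (range atMost)"
      by (simp_all add: borel_eq_atMost)
    show "(\<Union>i. {..real i}) = UNIV" by (auto intro: real_arch_simple)
  qed (auto simp: F G)
qed

lemma distr_log_measure: "distr log_measure borel (log_norm :: real^'n \<Rightarrow> real) = lborel"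
proof -
  let ?N = "real CARD('n)" and ?s = "sphere_area TYPE('n)"
  let ?g = "\<lambda>t. ennreal (exp (- ?N * t) / ?s)"
  have s: "0 < ?s" by (rule sphere_area_pos)
  have "log_measure = density lebesgue (\<lambda>x::real^'n. ?g (log_norm x))"
    unfolding log_measure_def
  proof (rule density_cong)
    show "AE x in lebesgue. ennreal (norm (x::real^'n) powr - ?N / ?s) = ?g (log_norm x)"
      using AE_lebesgue_neq_0 by eventually_elim (subst exp_mult_log_norm, auto)
  qed measurable
  then have "distr log_measure borel (log_norm :: real^'n \<Rightarrow> real) = distr (density lebesgue (\<lambda>x::real^'n. ?g (log_norm x))) borel log_norm"
    by simp
  also have "\<dots> = density (distr lebesgue borel (log_norm :: real^'n \<Rightarrow> real)) ?g"
    by (subst density_distr) auto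
  also have "\<dots> = density lborel (\<lambda>t. ennreal (?s * exp (?N * t)) * ?g t)"
    unfolding distr_log_norm by (subst density_density_eq) auto
  also have "(\<lambda>t. ennreal (?s * exp (?N * t)) * ?g t) = (\<lambda>t. 1)"
    using s by (auto simp: ennreal_mult[symmetric] exp_minus)
  also have "density lborel (\<lambda>t::real. 1) = lborel" by (rule density_1)
  finally show ?thesis .
qed

lemma sigma_finite_of_distr_lborel:
  fixes T :: "'a \<Rightarrow> real"
  assumes [measurable]: "T \<in> borel_measurable M" and d: "distr M borel T = lborel"
  shows "sigma_finite_measure M"
proof
  let ?A = "\<lambda>i::nat. T -` {- real i..real i} \<inter> space M"
  have "emeasure M (?A i) = emeasure (distr M borel T) {- real i..real i}" for i
    by (subst emeasure_distr) auto
  then have "emeasure M (?A i) \<noteq> \<infinity>" for i by (simp add: d)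
  moreover have "(\<Union>i. ?A i) = space M"
  proof (intro equalityI subsetI)
    fix x assume "x \<in> space M"
    moreover obtain i :: nat where "\<bar>T x\<bar> \<le> real i" using real_arch_simple by blast
    ultimately show "x \<in> (\<Union>i. ?A i)" by (auto simp: abs_le_iff intro!: exI[of _ i])
  qed auto
  ultimately show "\<exists>A. countable A \<and> A \<subseteq> sets M \<and> \<Union> A = space M \<and> (\<forall>a\<in>A. emeasure M a \<noteq> \<infinity>)"
    by (intro exI[of _ "range ?A"]) auto
qed

lemma log_norm_log_measure [measurable]: "log_norm \<in> borel_measurable log_measure"
  by (simp add: measurable_cong_sets[OF sets_log_measure refl])

lemma sigma_finite_log_measure: "sigma_finite_measure log_measure"
  by (rule sigma_finite_of_distr_lborel[OF log_norm_log_measure distr_log_measure])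

lemma wint_eq_log_measure:
  fixes u :: "real^'n \<Rightarrow> real"
  assumes "u \<in> borel_measurable lebesgue"
  shows "wint d s u = ennreal (sphere_area TYPE('n)) *
     (\<integral>\<^sup>+x. ennreal (exp ((d + real CARD('n)) * log_norm x) * \<bar>u x\<bar> powr s) \<partial>log_measure)"
proof -
  have "(\<integral>\<^sup>+x. ennreal (exp ((d + real CARD('n)) * log_norm x) * \<bar>u x\<bar> powr s) \<partial>log_measure)
     = (\<integral>\<^sup>+x. ennreal (norm x powr - real CARD('n) / sphere_area TYPE('n)) * ennreal (exp ((d + real CARD('n)) * log_norm x) * \<bar>u x\<bar> powr s) \<partial>lebesgue)"
    using assms by (intro nn_integral_log_measure) measurable
  also have "\<dots> = (\<integral>\<^sup>+x. ennreal (1 / sphere_area TYPE('n)) * ennreal (norm x powr d * \<bar>u x\<bar> powr s) \<partial>lebesgue)"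
  proof (rule nn_integral_cong_AE)
    show "AE x in lebesgue. ennreal (norm x powr - real CARD('n) / sphere_area TYPE('n)) * ennreal (exp ((d + real CARD('n)) * log_norm x) * \<bar>u x\<bar> powr s)
       = ennreal (1 / sphere_area TYPE('n)) * ennreal (norm x powr d * \<bar>u x\<bar> powr s)"
      using AE_lebesgue_neq_0
    proof eventually_elim
      case (elim x)
      have "norm x powr - real CARD('n) * norm x powr (d + real CARD('n)) = norm x powr d"
        by (subst powr_add[symmetric]) simp
      then show ?case
        using sphere_area_pos[where 'n='n] elim
        by (simp add: exp_mult_log_norm ennreal_mult[symmetric] mult.assoc[symmetric])
    qed
  qed
  also have "\<dots> = ennreal (1 / sphere_area TYPE('n)) * wint d s u"
    unfolding wint_def using assms by (intro nn_integral_cmult) measurable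
  finally show ?thesis
    using sphere_area_pos[where 'n='n] by (simp add: mult.assoc[symmetric] ennreal_mult[symmetric])
qed

lemma wint_log_norm:
  fixes u :: "real^'n \<Rightarrow> real"
  assumes u: "u \<in> borel_measurable lebesgue" and v[measurable]: "v \<in> borel_measurable borel"
    and uv: "AE x in lebesgue. u x = v (log_norm x)" and k: "k * s = d + real CARD('n)"
  shows "wint d s u = ennreal (sphere_area TYPE('n)) * expint k s v"
proof -
  have "(\<integral>\<^sup>+x. ennreal (exp ((d + real CARD('n)) * log_norm x) * \<bar>u x\<bar> powr s) \<partial>log_measure)
    = (\<integral>\<^sup>+x. ennreal (exp (k * s * log_norm x) * \<bar>v (log_norm (x::real^'n))\<bar> powr s) \<partial>log_measure)"
  proof (rule nn_integral_cong_AE, unfold AE_log_measure)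
    show "AE x in lebesgue. ennreal (exp ((d + real CARD('n)) * log_norm x) * \<bar>u x\<bar> powr s) = ennreal (exp (k * s * log_norm x) * \<bar>v (log_norm (x::real^'n))\<bar> powr s)"
      using uv by eventually_elim (simp add: k)
  qed
  also have "\<dots> = expint k s v"
    unfolding expint_def by (subst distr_log_measure[where 'n='n, symmetric]) (simp add: nn_integral_distr)
  finally show ?thesis using wint_eq_log_measure[OF u] by simp
qed

section \<open>Smooth radial test functions\<close>

text \<open>Smoothness is witnessed by a set closed under differentiation, as in
  \<open>smooth_fun\<close>; since all its members vanish beyond the same R, derivatives inherit the
  bound on the support. A negative R leaves only the zero function, hence the |R| in the
  proofs.\<close>

definition cc_smooth :: "real \<Rightarrow> (real \<Rightarrow> real) \<Rightarrow> bool" where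
  "cc_smooth R f \<longleftrightarrow> (\<exists>S. f \<in> S \<and> (\<forall>h\<in>S. (\<forall>x. R < \<bar>x\<bar> \<longrightarrow> h x = 0) \<and> (\<exists>h'\<in>S. \<forall>x. (h has_real_derivative h' x) (at x))))"

lemma cc_smooth_zero: "cc_smooth R f \<Longrightarrow> R < \<bar>x\<bar> \<Longrightarrow> f x = 0"
  unfolding cc_smooth_def by blast

lemma cc_smooth_deriv:
  assumes "cc_smooth R f"
  obtains f' where "cc_smooth R f'" "\<And>x. (f has_real_derivative f' x) (at x)"
proof -
  from assms obtain S where S: "f \<in> S" "\<forall>h\<in>S. (\<forall>x. R < \<bar>x\<bar> \<longrightarrow> h x = 0) \<and> (\<exists>h'\<in>S. \<forall>x. (h has_real_derivative h' x) (at x))"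
    unfolding cc_smooth_def by blast
  then obtain f' where "f' \<in> S" "\<forall>x. (f has_real_derivative f' x) (at x)" by blast
  then show ?thesis using S that[of f'] unfolding cc_smooth_def by blast
qed

lemma cc_smooth_antideriv:
  assumes "cc_smooth R f'" "\<And>x. (f has_real_derivative f' x) (at x)" "\<And>x. R < \<bar>x\<bar> \<Longrightarrow> f x = 0"
  shows "cc_smooth R f"
proof -
  from assms(1) obtain S where S: "f' \<in> S" "\<forall>h\<in>S. (\<forall>x. R < \<bar>x\<bar> \<longrightarrow> h x = 0) \<and> (\<exists>h'\<in>S. \<forall>x. (h has_real_derivative h' x) (at x))"
    unfolding cc_smooth_def by blast
  show ?thesis
    unfolding cc_smooth_def by (rule exI[of _ "insert f S"]) (use S assms(2,3) in blast)
qed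

lemma cc_smooth_continuous: "cc_smooth R f \<Longrightarrow> continuous_on UNIV f"
  by (metis DERIV_isCont cc_smooth_deriv continuous_at_imp_continuous_on)

lemma cc_smooth_borel: "cc_smooth R f \<Longrightarrow> f \<in> borel_measurable borel"
  by (intro borel_measurable_continuous_onI cc_smooth_continuous)

lemma cc_smooth_bounded:
  assumes "cc_smooth R f"
  obtains B where "0 \<le> B" "\<And>x. \<bar>f x\<bar> \<le> B"
proof -
  have "compact (f ` {-\<bar>R\<bar>..\<bar>R\<bar>})"
    by (intro compact_continuous_image continuous_on_subset[OF cc_smooth_continuous[OF assms]]) auto
  then obtain B where B: "\<And>y. y \<in> f ` {-\<bar>R\<bar>..\<bar>R\<bar>} \<Longrightarrow> \<bar>y\<bar> \<le> B"
    using compact_imp_bounded[of "f ` {-\<bar>R\<bar>..\<bar>R\<bar>}"] unfolding bounded_iff real_norm_def by blast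
  have "\<bar>f x\<bar> \<le> max 0 B" for x
  proof (cases "x \<in> {-\<bar>R\<bar>..\<bar>R\<bar>}")
    case True then show ?thesis using B[of "f x"] by auto
  next
    case False
    then have "R < \<bar>x\<bar>" by auto
    then show ?thesis using cc_smooth_zero[OF assms] by auto
  qed
  then show ?thesis using that[of "max 0 B"] by auto
qed

text \<open>The powers y^k make the family closed under differentiation up to linear combinations,
  as e^{-c/y} has the derivative c e^{-c/y} / y^2. The parameter c is kept because bumps with c
  tending to 0 increase to the indicator of their interval.\<close>

definition bump_pow :: "real \<Rightarrow> nat \<Rightarrow> real \<Rightarrow> real" where
  "bump_pow c k y = (if 0 < y then exp (- c / y) / y ^ k else 0)"

text \<open>This is the difference quotient at the junction y = 0, where the exponential beats every
  power of 1 / y.\<close>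

lemma bump_pow_quotient_tendsto_0:
  assumes "0 < c"
  shows "((\<lambda>h. bump_pow c k h / h) \<longlongrightarrow> 0) (at 0)"
proof -
  have "filterlim (\<lambda>h::real. c * inverse h) at_top (at_right 0)"
    using assms by (intro filterlim_tendsto_pos_mult_at_top[OF tendsto_const] filterlim_inverse_at_top_right) auto
  then have "((\<lambda>h. (c * inverse h) ^ (k + 1) / exp (c * inverse h)) \<longlongrightarrow> 0) (at_right 0)"
    by (rule filterlim_compose[OF tendsto_power_div_exp_0])
  then have "((\<lambda>h. (1 / c ^ (k + 1)) * ((c * inverse h) ^ (k + 1) / exp (c * inverse h))) \<longlongrightarrow> (1 / c ^ (k + 1)) * 0) (at_right 0)"
    by (rule tendsto_mult_left)
  then have "((\<lambda>h. (1 / c ^ (k + 1)) * ((c * inverse h) ^ (k + 1) / exp (c * inverse h))) \<longlongrightarrow> 0) (at_right 0)"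
    by simp
  then have "((\<lambda>h. bump_pow c k h / h) \<longlongrightarrow> 0) (at_right 0)"
  proof (rule Lim_transform_eventually)
    show "eventually (\<lambda>h. (1 / c ^ (k + 1)) * ((c * inverse h) ^ (k + 1) / exp (c * inverse h)) = bump_pow c k h / h) (at_right 0)"
      unfolding eventually_at_right_field
      using assms by (intro exI[of _ 1])
        (auto simp: bump_pow_def power_mult_distrib exp_minus divide_inverse power_inverse mult_ac)
  qed
  moreover have "((\<lambda>h. bump_pow c k h / h) \<longlongrightarrow> 0) (at_left 0)"
    by (rule Lim_transform_eventually[OF tendsto_const])
       (auto simp: eventually_at_left_field bump_pow_def intro!: exI[of _ "-1"])
  ultimately show ?thesis by (simp add: filterlim_split_at_real)
qed

lemma bump_pow_deriv:
  assumes "0 < c"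
  shows "(bump_pow c k has_real_derivative (c * bump_pow c (k + 2) y - real k * bump_pow c (k + 1) y)) (at y)"
proof -
  consider "y < 0" | "y = 0" | "0 < y" by linarith
  then show ?thesis
  proof cases
    case 1
    have "((\<lambda>y. 0) has_real_derivative 0) (at y)" by simp
    then have "(bump_pow c k has_real_derivative 0) (at y)"
      by (rule has_field_derivative_transform_within_open[where S="{..<0}"]) (use 1 in \<open>auto simp: bump_pow_def\<close>)
    then show ?thesis using 1 by (simp add: bump_pow_def)
  next
    case 2
    then show ?thesis
      using bump_pow_quotient_tendsto_0[OF assms, of k] by (simp add: DERIV_def bump_pow_def)
  next
    case 3
    have "((\<lambda>y. exp (- c / y) / y ^ k) has_real_derivative (c * bump_pow c (k + 2) y - real k * bump_pow c (k + 1) y)) (at y)"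
    proof (cases k)
      case 0
      then show ?thesis using 3
        by (auto intro!: derivative_eq_intros simp: bump_pow_def power2_eq_square divide_simps)
    next
      case (Suc j)
      have "((\<lambda>y. exp (- c / y)) has_real_derivative exp (- c / y) * (c / y\<^sup>2)) (at y)"
        using 3 by (auto intro!: derivative_eq_intros simp: power2_eq_square)
      moreover have "((\<lambda>y. y ^ Suc j) has_real_derivative real (Suc j) * y ^ j) (at y)"
        using DERIV_pow[of "Suc j" y] by simp
      moreover have "y ^ Suc j \<noteq> 0" using 3 by simp
      ultimately have "((\<lambda>y. exp (- c / y) / y ^ Suc j) has_real_derivative
          (exp (- c / y) * (c / y\<^sup>2) * y ^ Suc j - exp (- c / y) * (real (Suc j) * y ^ j)) / (y ^ Suc j * y ^ Suc j)) (at y)"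
        by (rule DERIV_divide)
      moreover have "(exp (- c / y) * (c / y\<^sup>2) * y ^ Suc j - exp (- c / y) * (real (Suc j) * y ^ j)) / (y ^ Suc j * y ^ Suc j)
          = c * bump_pow c (k + 2) y - real k * bump_pow c (k + 1) y"
        using 3 Suc by (simp add: bump_pow_def power2_eq_square divide_simps) (simp add: algebra_simps)
      ultimately show ?thesis using Suc by simp
    qed
    then show ?thesis
      by (rule has_field_derivative_transform_within_open[where S="{0<..}"]) (use 3 in \<open>auto simp: bump_pow_def\<close>)
  qed
qed

text \<open>A witness set for smoothness that contains all bumps. For a < b the quadratic (x - a)(b
  - x) is positive exactly between a and b; constants and the identity are included for its
  derivative.\<close>

inductive_set bump_alg :: "(real \<Rightarrow> real) set" where
  base: "0 < c \<Longrightarrow> (\<lambda>x. bump_pow c k ((x - a) * (b - x))) \<in> bump_alg"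
| const: "(\<lambda>x. d) \<in> bump_alg"
| id: "(\<lambda>x. x) \<in> bump_alg"
| add: "f \<in> bump_alg \<Longrightarrow> g \<in> bump_alg \<Longrightarrow> (\<lambda>x. f x + g x) \<in> bump_alg"
| mult: "f \<in> bump_alg \<Longrightarrow> g \<in> bump_alg \<Longrightarrow> (\<lambda>x. f x * g x) \<in> bump_alg"

lemma bump_alg_deriv:
  assumes "f \<in> bump_alg"
  shows "\<exists>f'\<in>bump_alg. \<forall>x. (f has_real_derivative f' x) (at x)"
  using assms
proof induction
  case (base c k a b)
  let ?f' = "\<lambda>x. (c * bump_pow c (k + 2) ((x - a) * (b - x)) + (- real k) * bump_pow c (k + 1) ((x - a) * (b - x))) * (a + b + (- 2) * x)"
  show ?case
  proof (intro bexI[of _ ?f'] allI)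
    fix x
    have "((\<lambda>x. (x - a) * (b - x)) has_real_derivative (a + b + (- 2) * x)) (at x)"
      by (auto intro!: derivative_eq_intros)
    from DERIV_chain2[OF bump_pow_deriv[OF base] this]
    show "((\<lambda>x. bump_pow c k ((x - a) * (b - x))) has_real_derivative ?f' x) (at x)"
      by simp
    show "?f' \<in> bump_alg"
      using base by (intro bump_alg.intros)
  qed
next
  case (const d)
  show ?case by (intro bexI[of _ "\<lambda>x. 0"]) (auto intro: bump_alg.const)
next
  case id
  show ?case by (intro bexI[of _ "\<lambda>x. 1"]) (auto intro: bump_alg.const)
next
  case (add f g)
  then obtain f' g' where *: "f' \<in> bump_alg" "\<forall>x. (f has_real_derivative f' x) (at x)"
    "g' \<in> bump_alg" "\<forall>x. (g has_real_derivative g' x) (at x)" by blast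
  then show ?case by (intro bexI[of _ "\<lambda>x. f' x + g' x"]) (auto intro: bump_alg.add DERIV_add)
next
  case (mult f g)
  then obtain f' g' where *: "f' \<in> bump_alg" "\<forall>x. (f has_real_derivative f' x) (at x)"
    "g' \<in> bump_alg" "\<forall>x. (g has_real_derivative g' x) (at x)" by blast
  then show ?case using mult(1,2)
    by (intro bexI[of _ "\<lambda>x. f' x * g x + g' x * f x"]) (auto intro!: bump_alg.intros DERIV_mult)
qed

text \<open>The witness consists of the members of \<open>bump_alg\<close> that vanish beyond R; on
  that open set they are locally zero, and so are their derivatives.\<close>

lemma cc_smooth_bump_alg:
  assumes "f \<in> bump_alg" "\<And>x. R < \<bar>x\<bar> \<Longrightarrow> f x = 0"
  shows "cc_smooth R f"
  unfolding cc_smooth_def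
proof (intro exI[of _ "{h \<in> bump_alg. \<forall>x. R < \<bar>x\<bar> \<longrightarrow> h x = 0}"] conjI ballI)
  fix h assume h: "h \<in> {h \<in> bump_alg. \<forall>x. R < \<bar>x\<bar> \<longrightarrow> h x = 0}"
  then obtain h' where h': "h' \<in> bump_alg" "\<forall>x. (h has_real_derivative h' x) (at x)"
    using bump_alg_deriv by blast
  have "h' x = 0" if "R < \<bar>x\<bar>" for x
  proof -
    have "open ({..< - R} \<union> {R<..})" by auto
    then have "(h has_real_derivative 0) (at x)"
      by (rule has_field_derivative_transform_within_open[where f="\<lambda>x. 0", rotated]) (use that h in auto)
    then show ?thesis using h' DERIV_unique by blast
  qed
  then show "\<exists>h'\<in>{h \<in> bump_alg. \<forall>x. R < \<bar>x\<bar> \<longrightarrow> h x = 0}. \<forall>x. (h has_real_derivative h' x) (at x)"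
    using h' by blast
qed (use assms in auto)

definition bump :: "real \<Rightarrow> real \<Rightarrow> real \<Rightarrow> real \<Rightarrow> real" where
  "bump a b c x = bump_pow c 0 ((x - a) * (b - x))"

lemma bump_alg_bump: "0 < c \<Longrightarrow> bump a b c \<in> bump_alg"
  unfolding bump_def[abs_def] by (rule bump_alg.base)

lemma bump_eq:
  assumes "a < b"
  shows "bump a b c x = (if a < x \<and> x < b then exp (- c / ((x - a) * (b - x))) else 0)"
proof -
  have "0 < (x - a) * (b - x) \<longleftrightarrow> a < x \<and> x < b"
    using assms by (auto simp: zero_less_mult_iff)
  then show ?thesis by (simp add: bump_def bump_pow_def)
qed

lemma bump_bounds: "a < b \<Longrightarrow> 0 < c \<Longrightarrow> 0 \<le> bump a b c x \<and> bump a b c x \<le> indicator {a<..<b} x"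
  by (auto simp: bump_eq indicator_def divide_le_0_iff zero_le_mult_iff)

lemma bump_borel [measurable]: "bump a b c \<in> borel_measurable borel"
  unfolding bump_def bump_pow_def by measurable

lemma cc_smooth_integrable: "cc_smooth R f \<Longrightarrow> integrable lborel f"
proof -
  assume f: "cc_smooth R f"
  obtain B where B: "0 \<le> B" "\<And>x. \<bar>f x\<bar> \<le> B" using cc_smooth_bounded[OF f] by blast
  show ?thesis
  proof (rule Bochner_Integration.integrable_bound)
    show "integrable lborel (\<lambda>x. B * indicator {-\<bar>R\<bar>..\<bar>R\<bar>} x :: real)" by simp
    show "f \<in> borel_measurable lborel" using cc_smooth_borel[OF f] by simp
    show "AE x in lborel. norm (f x) \<le> norm (B * indicator {-\<bar>R\<bar>..\<bar>R\<bar>} x :: real)"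
    proof (rule AE_I2)
      fix x
      show "norm (f x) \<le> norm (B * indicator {-\<bar>R\<bar>..\<bar>R\<bar>} x :: real)"
      proof (cases "x \<in> {-\<bar>R\<bar>..\<bar>R\<bar>}")
        case False
        then have "R < \<bar>x\<bar>" by auto
        then show ?thesis using cc_smooth_zero[OF f] by auto
      qed (use B in auto)
    qed
  qed
qed

text \<open>A primitive started to the left of the support vanishes to the right of it because the
  total integral is 0. Mean-zero test functions are therefore derivatives of test functions, which
  is where du Bois-Reymond's argument starts.\<close>

lemma cc_smooth_primitive:
  assumes f: "cc_smooth R f" and zero: "(\<integral>x. f x \<partial>lborel) = 0"
  obtains F where "cc_smooth R F" "\<And>x. (F has_real_derivative f x) (at x)"
proof -
  \<comment> \<open>The extra 1 puts every x <= a strictly to the left of the support, where F is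
    locally zero; this settles differentiability at the end point a itself.\<close>
  define a where "a = - \<bar>R\<bar> - 1"
  define F where "F x = integral {a..x} f" for x
  have cont: "continuous_on S f" for S
    using cc_smooth_continuous[OF f] continuous_on_subset by blast
  have F0: "F x = 0" if "x < - \<bar>R\<bar>" for x
  proof -
    have "F x = integral {a..x} (\<lambda>x. 0)"
      unfolding F_def using that by (intro Henstock_Kurzweil_Integration.integral_cong cc_smooth_zero[OF f]) auto
    then show ?thesis by simp
  qed
  have F1: "F x = 0" if "\<bar>R\<bar> < x" for x
  proof -
    have "(f has_integral integral {a..x} f) {a..x}"
      by (intro integrable_integral integrable_continuous_interval cont)
    then have "(f has_integral integral {a..x} f) UNIV"
    proof (rule has_integral_on_superset)
      fix y assume "y \<notin> {a..x}"
      then have "R < \<bar>y\<bar>" using that by (auto simp: a_def)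
      then show "f y = 0" by (rule cc_smooth_zero[OF f])
    qed auto
    moreover have "(f has_integral 0) UNIV"
      using has_integral_integral_lborel[OF cc_smooth_integrable[OF f]] zero by simp
    ultimately show ?thesis unfolding F_def by (rule has_integral_unique)
  qed
  have deriv: "(F has_real_derivative f x) (at x)" for x
  proof (cases "a < x")
    case True
    have "((\<lambda>u. integral {a..u} f) has_real_derivative f x) (at x within {a..x + 1})"
      using True by (intro integral_has_real_derivative cont) auto
    moreover have "at x within {a..x + 1} = at x" using True by (intro at_within_interior) auto
    ultimately show ?thesis by (simp add: F_def[abs_def])
  next
    case False
    then have x: "x < - \<bar>R\<bar>" by (simp add: a_def)
    have "(F has_real_derivative 0) (at x)"
      by (rule has_field_derivative_transform_within_open[where f="\<lambda>x. 0" and S="{..< - \<bar>R\<bar>}"]) (use x F0 in auto)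
    moreover have "f x = 0" using x by (intro cc_smooth_zero[OF f]) auto
    ultimately show ?thesis by simp
  qed
  have "cc_smooth R F"
  proof (rule cc_smooth_antideriv[OF f deriv])
    fix x assume "R < \<bar>x\<bar>"
    show "F x = 0"
    proof (cases "0 \<le> R")
      case True
      then have "x < - \<bar>R\<bar> \<or> \<bar>R\<bar> < x" using \<open>R < \<bar>x\<bar>\<close> by auto
      then show ?thesis using F0 F1 by auto
    next
      case False
      then have "f = (\<lambda>y. 0)" by (intro ext cc_smooth_zero[OF f]) auto
      then show ?thesis unfolding F_def by simp
    qed
  qed
  then show ?thesis using deriv that by blast
qed

text \<open>The i-th partial derivative of |x|^m f(ln |x|) is x_i |x|^{m-2} times (m f + f')(ln
  |x|). Closure under differentiation thus requires the coordinates and an arbitrary exponent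
  m.\<close>

inductive_set log_radial_alg :: "(real^'n \<Rightarrow> real) set" where
  base: "cc_smooth R f \<Longrightarrow> (\<lambda>x. norm x powr m * f (log_norm x)) \<in> log_radial_alg"
| const: "(\<lambda>x. d) \<in> log_radial_alg"
| coord: "(\<lambda>x. x $ i) \<in> log_radial_alg"
| add: "f \<in> log_radial_alg \<Longrightarrow> g \<in> log_radial_alg \<Longrightarrow> (\<lambda>x. f x + g x) \<in> log_radial_alg"
| mult: "f \<in> log_radial_alg \<Longrightarrow> g \<in> log_radial_alg \<Longrightarrow> (\<lambda>x. f x * g x) \<in> log_radial_alg"

lemma has_real_derivative_norm_line:
  fixes x e :: "'a::real_inner"
  assumes "x \<noteq> 0"
  shows "((\<lambda>s. norm (x + s *\<^sub>R e)) has_real_derivative (inner x e / norm x)) (at 0)"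
proof -
  have "norm (x + s *\<^sub>R e) = sqrt (inner x x + 2 * s * inner x e + s\<^sup>2 * inner e e)" for s
    by (simp add: norm_eq_sqrt_inner inner_add inner_commute power2_eq_square algebra_simps)
  moreover have "((\<lambda>s. sqrt (inner x x + 2 * s * inner x e + s\<^sup>2 * inner e e)) has_real_derivative (inner x e / norm x)) (at 0)"
    using assms by (auto intro!: derivative_eq_intros simp: norm_eq_sqrt_inner divide_simps) (use inner_ge_zero[of x] in linarith)
  ultimately show ?thesis by simp
qed

lemma has_real_derivative_powr_ln:
  assumes "0 < y" "(f has_real_derivative f' ) (at (ln y))"
  shows "((\<lambda>y. y powr m * f (ln y)) has_real_derivative (y powr (m - 1) * (m * f (ln y) + f'))) (at y)"
proof -
  have "((\<lambda>y. f (ln y)) has_real_derivative (f' * (1 / y))) (at y)"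
    using DERIV_chain2[OF assms(2) DERIV_ln_divide[OF assms(1)]] .
  moreover have "((\<lambda>y. y powr m) has_real_derivative (m * y powr (m - 1))) (at y)"
    using has_real_derivative_powr[OF assms(1)] .
  ultimately have "((\<lambda>y. y powr m * f (ln y)) has_real_derivative (m * y powr (m - 1) * f (ln y) + f' * (1 / y) * y powr m)) (at y)"
    by (rule DERIV_mult[rotated])
  moreover have "y powr m = y powr (m - 1) * y" using assms(1) by (simp add: powr_diff)
  ultimately show ?thesis using assms(1) by (simp add: algebra_simps)
qed

text \<open>The bound on the support of f turns into a neighbourhood of the origin on which the
  product vanishes, so the power of |x| is never singular.\<close>

lemma log_radial_near_0:
  assumes "cc_smooth R f" "norm (x::real^'n) < exp (- \<bar>R\<bar>)"
  shows "norm x powr m * f (log_norm x) = 0"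
proof (cases "x = 0")
  case False
  have "log_norm x < - \<bar>R\<bar>"
    using assms(2) False by (metis exp_less_cancel_iff exp_log_norm)
  then have "R < \<bar>log_norm x\<bar>" by auto
  then show ?thesis using cc_smooth_zero[OF assms(1)] by simp
qed simp

lemma log_radial_alg_deriv:
  assumes "h \<in> (log_radial_alg :: (real^'n \<Rightarrow> real) set)"
  shows "\<exists>h'\<in>log_radial_alg. \<forall>x. ((\<lambda>t. h (x + t *\<^sub>R axis i 1)) has_real_derivative h' x) (at 0)"
  using assms
proof induction
  case (base R f m)
  obtain f' where f': "cc_smooth R f'" "\<And>x. (f has_real_derivative f' x) (at x)"
    using cc_smooth_deriv[OF base] by blast
  let ?h' = "\<lambda>x. x $ i * (m * (norm x powr (m - 2) * f (log_norm x)) + norm x powr (m - 2) * f' (log_norm x))"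
  show ?case
  proof (intro bexI[of _ ?h'] allI)
    fix x :: "real^'n"
    show "((\<lambda>t. norm (x + t *\<^sub>R axis i 1) powr m * f (log_norm (x + t *\<^sub>R axis i 1))) has_real_derivative ?h' x) (at 0)"
    proof (cases "x = 0")
      case True
      have "((\<lambda>t. norm (x + t *\<^sub>R axis i 1) powr m * f (log_norm (x + t *\<^sub>R axis i 1))) has_real_derivative 0) (at 0)"
      proof (rule has_field_derivative_transform_within_open[where f="\<lambda>t. 0" and S="{- exp (- \<bar>R\<bar>)<..<exp (- \<bar>R\<bar>)}"])
        fix t assume "t \<in> {- exp (- \<bar>R\<bar>)<..<exp (- \<bar>R\<bar>)}"
        then show "0 = norm (x + t *\<^sub>R axis i 1) powr m * f (log_norm (x + t *\<^sub>R axis i 1))"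
          using True by (intro log_radial_near_0[OF base, symmetric]) auto
      qed auto
      then show ?thesis using True by simp
    next
      case False
      then have pos: "0 < norm x" by simp
      have "((\<lambda>t. norm (x + t *\<^sub>R axis i 1) powr m * f (ln (norm (x + t *\<^sub>R axis i 1)))) has_real_derivative
         (norm x powr (m - 1) * (m * f (ln (norm x)) + f' (ln (norm x)))) * (inner x (axis i 1) / norm x)) (at 0)"
        by (rule DERIV_chain2[where f="\<lambda>y. y powr m * f (ln y)", OF _ has_real_derivative_norm_line[OF False]])
           (simp only: scaleR_zero_left add_0_right, rule has_real_derivative_powr_ln[OF pos f'(2)])
      moreover have "norm x powr (m - 1) = norm x powr (m - 2) * norm x"
        using pos powr_add[of "norm x" "m - 2" 1] by simp
      ultimately show ?thesis
        using pos by (simp add: log_norm_def inner_axis algebra_simps)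
    qed
    show "?h' \<in> log_radial_alg"
      by (rule log_radial_alg.mult[OF log_radial_alg.coord log_radial_alg.add[OF
           log_radial_alg.mult[OF log_radial_alg.const log_radial_alg.base[OF base]] log_radial_alg.base[OF f'(1)]]])
  qed
next
  case (const d)
  show ?case by (intro bexI[of _ "\<lambda>x. 0"]) (auto intro: log_radial_alg.const)
next
  case (coord j)
  show ?case
    by (intro bexI[of _ "\<lambda>x. axis i 1 $ j"]) (auto intro!: log_radial_alg.const derivative_eq_intros)
next
  case (add f g)
  then obtain f' g' where *: "f' \<in> log_radial_alg" "\<forall>x. ((\<lambda>t. f (x + t *\<^sub>R axis i 1)) has_real_derivative f' x) (at 0)"
    "g' \<in> log_radial_alg" "\<forall>x. ((\<lambda>t. g (x + t *\<^sub>R axis i 1)) has_real_derivative g' x) (at 0)" by blast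
  then show ?case by (intro bexI[of _ "\<lambda>x. f' x + g' x"]) (auto intro: log_radial_alg.add DERIV_add)
next
  case (mult f g)
  then obtain f' g' where *: "f' \<in> log_radial_alg" "\<forall>x. ((\<lambda>t. f (x + t *\<^sub>R axis i 1)) has_real_derivative f' x) (at 0)"
    "g' \<in> log_radial_alg" "\<forall>x. ((\<lambda>t. g (x + t *\<^sub>R axis i 1)) has_real_derivative g' x) (at 0)" by blast
  show ?case
  proof (intro bexI[of _ "\<lambda>x. f' x * g x + g' x * f x"] allI)
    fix x
    show "((\<lambda>t. f (x + t *\<^sub>R axis i 1) * g (x + t *\<^sub>R axis i 1)) has_real_derivative f' x * g x + g' x * f x) (at 0)"
      using DERIV_mult[OF *(2)[rule_format, of x] *(4)[rule_format, of x]] by simp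
  qed (use * mult in \<open>auto intro!: log_radial_alg.intros\<close>)
qed

lemma log_radial_alg_continuous:
  assumes "h \<in> (log_radial_alg :: (real^'n \<Rightarrow> real) set)"
  shows "continuous_on UNIV h"
  using assms
proof induction
  case (base R f m)
  let ?h = "\<lambda>x::real^'n. norm x powr m * f (log_norm x)"
  have "continuous_on (- {0} \<union> ball 0 (exp (- \<bar>R\<bar>))) ?h"
  proof (rule continuous_on_open_Un)
    show "continuous_on (- {0}) ?h"
      unfolding log_norm_def
      by (intro continuous_intros continuous_on_compose2[OF cc_smooth_continuous[OF base]]) auto
    have "continuous_on (ball 0 (exp (- \<bar>R\<bar>))) (\<lambda>x::real^'n. 0::real)" by simp
    then show "continuous_on (ball 0 (exp (- \<bar>R\<bar>))) ?h"
      by (rule continuous_on_eq) (auto simp: log_radial_near_0[OF base])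
  qed auto
  moreover have "- {0} \<union> ball 0 (exp (- \<bar>R\<bar>)) = (UNIV :: (real^'n) set)" by auto
  ultimately show ?case by (simp only:)
qed (auto intro!: continuous_intros)

lemma test_fun_log_radial:
  assumes f: "cc_smooth R f"
  shows "test_fun (\<lambda>x::real^'n. norm x powr m * f (log_norm x))"
proof -
  let ?h = "\<lambda>x::real^'n. norm x powr m * f (log_norm x)"
  let ?A = "{x::real^'n. exp (- \<bar>R\<bar>) \<le> norm x \<and> norm x \<le> exp \<bar>R\<bar>}"
  have "?h x = 0" if "x \<notin> ?A" for x
  proof (cases "norm x < exp (- \<bar>R\<bar>)")
    case True then show ?thesis by (rule log_radial_near_0[OF f])
  next
    case False
    then have "exp \<bar>R\<bar> < norm x" using that by auto
    then have "\<bar>R\<bar> < log_norm x"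
      by (metis exp_gt_zero less_trans log_norm_def ln_exp ln_less_cancel_iff)
    then show ?thesis using cc_smooth_zero[OF f, of "log_norm x"] by auto
  qed
  then have sub: "{x. ?h x \<noteq> 0} \<subseteq> ?A" by blast
  have cl: "closed ?A"
    by (intro closed_Collect_conj closed_Collect_le continuous_intros)
  have clsub: "closure {x. ?h x \<noteq> 0} \<subseteq> ?A" using sub cl by (rule closure_minimal)
  have "?A \<subseteq> cball 0 (exp \<bar>R\<bar>)" by auto
  then have "bounded ?A" using bounded_cball bounded_subset by blast
  then have "compact ?A" using cl by (simp add: compact_eq_bounded_closed)
  then have "compact (closure {x. ?h x \<noteq> 0})"
    using clsub by (meson bounded_subset closed_closure compact_eq_bounded_closed)
  moreover have "0 \<notin> closure {x. ?h x \<noteq> 0}" using clsub by (auto simp: not_le)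
  moreover have "smooth_fun ?h"
    unfolding smooth_fun_def
    by (intro exI[of _ log_radial_alg] conjI ballI allI log_radial_alg_continuous log_radial_alg_deriv log_radial_alg.base[OF f])
  ultimately show ?thesis unfolding test_fun_def by blast
qed

text \<open>For \<phi> = |x|^{1-N} f(ln |x|) the divergence of \<phi> x / |x| is |x|^{-N} f'(ln
  |x|): the power 1 - N cancels the term (N - 1) / |x|, and what remains is, up to the area of the
  sphere, the density of \<open>log_measure\<close>. The distributional identity becomes a weak
  derivative in the variable ln |x|.\<close>

lemma radial_deriv_log_test:
  fixes u g :: "real^'n \<Rightarrow> real"
  assumes rd: "radial_deriv u g" and f: "cc_smooth R f" and f': "\<And>t. (f has_real_derivative f' t) (at t)"
    and m: "u \<in> borel_measurable lebesgue" "g \<in> borel_measurable lebesgue"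
  shows "(\<integral>x. (norm x * g x) * f (log_norm x) \<partial>log_measure) = - (\<integral>x. u x * f' (log_norm x) \<partial>log_measure)"
proof -
  let ?N = "real CARD('n)" and ?s = "sphere_area TYPE('n)"
  let ?p = "\<lambda>x::real^'n. norm x powr (1 - ?N) * f (log_norm x)"
  have s: "0 < ?s" by (rule sphere_area_pos)
  note [measurable] = m
  obtain f2 where f2: "cc_smooth R f2" "\<And>t. (f has_real_derivative f2 t) (at t)" using cc_smooth_deriv[OF f] by blast
  have "f' = f2" using f' f2(2) DERIV_unique by blast
  then have f'b: "cc_smooth R f'" using f2 by simp
  have [measurable]: "f \<in> borel_measurable borel" "f' \<in> borel_measurable borel"
    using cc_smooth_borel f f'b by auto
  have eq: "(\<integral>x. g x * ?p x \<partial>lebesgue) =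
        - (\<integral>x. u x * (deriv (\<lambda>t. ?p (x + t *\<^sub>R (x /\<^sub>R norm x))) 0
                        + (real CARD('n) - 1) / norm x * ?p x) \<partial>lebesgue)"
    using rd test_fun_log_radial[OF f, of "1 - ?N"] unfolding radial_deriv_def by blast
  have D: "deriv (\<lambda>t. ?p (x + t *\<^sub>R (x /\<^sub>R norm x))) 0 + (?N - 1) / norm x * ?p x = norm x powr - ?N * f' (log_norm x)"
    if x: "x \<noteq> 0" for x
  proof -
    have pos: "0 < norm x" using x by simp
    have "((\<lambda>t. norm (x + t *\<^sub>R (x /\<^sub>R norm x)) powr (1 - ?N) * f (ln (norm (x + t *\<^sub>R (x /\<^sub>R norm x))))) has_real_derivative
         (norm x powr (1 - ?N - 1) * ((1 - ?N) * f (ln (norm x)) + f' (ln (norm x)))) * (inner x (x /\<^sub>R norm x) / norm x)) (at 0)"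
      by (rule DERIV_chain2[where f="\<lambda>y. y powr (1 - ?N) * f (ln y)", OF _ has_real_derivative_norm_line[OF x]])
         (simp only: scaleR_zero_left add_0_right, rule has_real_derivative_powr_ln[OF pos f'])
    moreover have "inner x (x /\<^sub>R norm x) / norm x = 1"
      using pos by (simp add: power2_norm_eq_inner[symmetric] power2_eq_square)
    ultimately have d: "deriv (\<lambda>t. ?p (x + t *\<^sub>R (x /\<^sub>R norm x))) 0 = norm x powr - ?N * ((1 - ?N) * f (log_norm x) + f' (log_norm x))"
      unfolding log_norm_def by (intro DERIV_imp_deriv) simp
    have e: "norm x powr (1 - ?N) = norm x powr - ?N * norm x"
      using pos by (simp add: powr_diff powr_minus divide_inverse)
    show ?thesis unfolding d unfolding e using pos by (simp add: field_simps)
  qed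
  have "(\<integral>x. (norm x * g x) * f (log_norm x) \<partial>log_measure) = (\<integral>x. norm x powr - ?N / ?s * ((norm x * g x) * f (log_norm x)) \<partial>lebesgue)"
    by (intro integral_log_measure) measurable
  also have "\<dots> = (\<integral>x. (g x * ?p x) / ?s \<partial>lebesgue)"
  proof (rule integral_cong_AE)
    show "AE x in lebesgue. norm x powr - ?N / ?s * ((norm x * g x) * f (log_norm x)) = (g x * ?p x) / ?s"
      using AE_lebesgue_neq_0
      by eventually_elim (simp add: powr_diff powr_minus divide_inverse)
  qed measurable
  also have "\<dots> = (\<integral>x. g x * ?p x \<partial>lebesgue) / ?s" by simp
  also have "\<dots> = - ((\<integral>x. u x * (deriv (\<lambda>t. ?p (x + t *\<^sub>R (x /\<^sub>R norm x))) 0 + (?N - 1) / norm x * ?p x) \<partial>lebesgue) / ?s)"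
    unfolding eq by simp
  also have "(\<integral>x. u x * (deriv (\<lambda>t. ?p (x + t *\<^sub>R (x /\<^sub>R norm x))) 0 + (?N - 1) / norm x * ?p x) \<partial>lebesgue) / ?s
     = (\<integral>x. u x * (deriv (\<lambda>t. ?p (x + t *\<^sub>R (x /\<^sub>R norm x))) 0 + (?N - 1) / norm x * ?p x) / ?s \<partial>lebesgue)" by simp
  also have "\<dots> = (\<integral>x. norm x powr - ?N / ?s * (u x * f' (log_norm x)) \<partial>lebesgue)"
  proof -
    have AE: "AE x in lebesgue. u x * (deriv (\<lambda>t. ?p (x + t *\<^sub>R (x /\<^sub>R norm x))) 0 + (?N - 1) / norm x * ?p x) / ?s
         = norm x powr - ?N / ?s * (u x * f' (log_norm x))"
      using AE_lebesgue_neq_0 by eventually_elim (subst D, auto)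
    have meas: "(\<lambda>x. norm x powr - ?N / ?s * (u x * f' (log_norm x))) \<in> borel_measurable lebesgue" by measurable
    \<comment> \<open>The formula \<open>D\<close> is available only off the origin. Measurability
      is carried over from the explicit function, which differs from this one at most at that
      point.\<close>
    have "(\<lambda>x. u x * (deriv (\<lambda>t. ?p (x + t *\<^sub>R (x /\<^sub>R norm x))) 0 + (?N - 1) / norm x * ?p x) / ?s) \<in> borel_measurable lebesgue"
    proof (rule measurable_discrete_difference[OF meas])
      fix x :: "real^'n" assume "x \<notin> {0}"
      then show "norm x powr - ?N / ?s * (u x * f' (log_norm x)) =
          u x * (deriv (\<lambda>t. ?p (x + t *\<^sub>R (x /\<^sub>R norm x))) 0 + (?N - 1) / norm x * ?p x) / ?s"
        by (subst D) auto
    qed auto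
    then show ?thesis using AE meas by (intro integral_cong_AE)
  qed
  also have "\<dots> = (\<integral>x. u x * f' (log_norm x) \<partial>log_measure)"
    by (intro integral_log_measure[symmetric]) measurable
  finally show ?thesis .
qed

section \<open>The du Bois-Reymond lemma\<close>

text \<open>\<open>W\<close> is the primitive of k along T that starts at 0, and by Fubini's theorem
  it satisfies the same weak identity as u. So u - W(T) annihilates mean-zero test functions of T,
  and after a constant is added to \<open>W\<close> the difference annihilates all bumps. The
  conclusion speaks only of integrals over preimages of intervals, since u need not be a function of
  T here.\<close>

lemma weak_primitive:
  fixes M :: "'a measure" and T u k :: "'a \<Rightarrow> real"
  assumes T[measurable]: "T \<in> borel_measurable M" and dT: "distr M borel T = lborel"
    and u[measurable]: "u \<in> borel_measurable M" and k[measurable]: "k \<in> borel_measurable M"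
    and int_u: "\<And>R. integrable M (\<lambda>x. indicator {-R..R} (T x) * u x)"
    and int_k: "\<And>R. integrable M (\<lambda>x. indicator {-R..R} (T x) * k x)"
    and weak: "\<And>R f f'. cc_smooth R f \<Longrightarrow> (\<And>t. (f has_real_derivative f' t) (at t)) \<Longrightarrow>
       (\<integral>x. k x * f (T x) \<partial>M) = - (\<integral>x. u x * f' (T x) \<partial>M)"
  obtains v where "v \<in> borel_measurable borel"
    "\<And>s t. s \<le> t \<Longrightarrow> ennreal \<bar>v t - v s\<bar> \<le> (\<integral>\<^sup>+x. ennreal (indicator {s..t} (T x) * \<bar>k x\<bar>) \<partial>M)"
    "\<And>R. integrable M (\<lambda>x. indicator {-R..R} (T x) * (u x - v (T x)))"
    "\<And>a b. a < b \<Longrightarrow> (\<integral>x. indicator {a<..<b} (T x) * (u x - v (T x)) \<partial>M) = 0"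
proof -
  interpret sigma_finite_measure M by (rule sigma_finite_of_distr_lborel[OF T dT])
  interpret P: pair_sigma_finite lborel M ..
  have int_T: "(\<integral>x. f (T x) \<partial>M) = (\<integral>t. f t \<partial>lborel)" if "f \<in> borel_measurable borel" for f :: "real \<Rightarrow> real"
    using that by (subst dT[symmetric]) (simp add: integral_distr)
  have integrable_T: "integrable M (\<lambda>x. f (T x)) \<longleftrightarrow> integrable lborel f" if "f \<in> borel_measurable borel" for f :: "real \<Rightarrow> real"
    using that by (subst dT[symmetric]) (simp add: integrable_distr_eq)
  define c where "c t x = (if 0 < T x \<and> T x \<le> t then 1 else if t < T x \<and> T x \<le> 0 then -1 else 0 :: real)" for t x
  define W where "W t = (\<integral>x. c t x * k x \<partial>M)" for t
  have c_int: "integrable M (\<lambda>x. c t x * k x)" for t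
  proof (rule Bochner_Integration.integrable_bound[OF int_k[of "\<bar>t\<bar>"]])
    show "(\<lambda>x. c t x * k x) \<in> borel_measurable M" unfolding c_def by measurable
  qed (auto simp: c_def indicator_def)
  have W_diff: "W t - W s = (\<integral>x. (if s < T x \<and> T x \<le> t then k x else 0) \<partial>M)" if "s \<le> t" for s t
  proof -
    have "W t - W s = (\<integral>x. c t x * k x - c s x * k x \<partial>M)"
      unfolding W_def by (rule Bochner_Integration.integral_diff[symmetric]) (rule c_int)+
    also have "\<dots> = (\<integral>x. (if s < T x \<and> T x \<le> t then k x else 0) \<partial>M)"
      using that by (intro Bochner_Integration.integral_cong) (auto simp: c_def)
    finally show ?thesis .
  qed
  have W_meas[measurable]: "W \<in> borel_measurable borel"
    unfolding W_def c_def by measurable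
  have W_bound: "\<bar>W t\<bar> \<le> (\<integral>x. \<bar>indicator {-R..R} (T x) * k x\<bar> \<partial>M)" if "\<bar>t\<bar> \<le> R" for t R
  proof -
    have "\<bar>W t\<bar> \<le> (\<integral>x. \<bar>c t x * k x\<bar> \<partial>M)" unfolding W_def by (rule integral_abs_bound)
    also have "\<dots> \<le> (\<integral>x. \<bar>indicator {-R..R} (T x) * k x\<bar> \<partial>M)"
      using that by (intro integral_mono integrable_abs c_int int_k) (auto simp: c_def indicator_def)
    finally show ?thesis .
  qed
  have ind_int: "integrable lborel (\<lambda>t. C * indicator {-R..R} t :: real)" for C R :: real
    by (intro integrable_mult_right integrable_real_indicator) (auto simp: emeasure_lborel_Icc_eq)
  have int_W: "integrable lborel (\<lambda>t. indicator {-R..R} t * W t)" for R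
    by (rule Bochner_Integration.integrable_bound[OF ind_int[of "\<integral>x. \<bar>indicator {-R..R} (T x) * k x\<bar> \<partial>M" R]])
       (use W_bound in \<open>auto simp: indicator_def abs_le_iff\<close>)
  \<comment> \<open>Integration by parts: f(T x) is minus the integral of f' over [T x, R], and
    exchanging the integrals brings out \<open>W\<close>.\<close>
  have fub: "(\<integral>x. k x * f (T x) \<partial>M) = - (\<integral>t. f' t * W t \<partial>lborel)"
    if f: "cc_smooth R0 f" and f': "\<And>t. (f has_real_derivative f' t) (at t)" for R0 f f'
  proof -
    \<comment> \<open>\<open>cc_smooth\<close> gives zeros only strictly beyond R0; adding 1 makes f
      and f' vanish at the end points R and -R themselves.\<close>
    define R where "R = \<bar>R0\<bar> + 1"
    obtain f2 where f2: "cc_smooth R0 f2" "\<And>t. (f has_real_derivative f2 t) (at t)" using cc_smooth_deriv[OF f] by blast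
    have "f' = f2" using f' f2(2) DERIV_unique by blast
    then have f'b: "cc_smooth R0 f'" using f2 by simp
    have [measurable]: "f \<in> borel_measurable borel" "f' \<in> borel_measurable borel"
      using cc_smooth_borel f f'b by auto
    have f0: "f t = 0" if "R \<le> \<bar>t\<bar>" for t using that by (intro cc_smooth_zero[OF f]) (auto simp: R_def)
    have f'0: "f' t = 0" if "R \<le> \<bar>t\<bar>" for t using that by (intro cc_smooth_zero[OF f'b]) (auto simp: R_def)
    have R: "0 < R" by (simp add: R_def)
    have cont: "isCont f' t" for t
      using cc_smooth_continuous[OF f'b] by (simp add: continuous_on_eq_continuous_at)
    have FTC: "(\<integral>t. f' t * indicator {a..b} t \<partial>lborel) = f b - f a" if "a \<le> b" for a b
      by (rule integral_FTC_Icc_real[OF that]) (use f' cont in auto)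
    have f'_zero: "(\<integral>t. f' t \<partial>lborel) = 0"
    proof -
      have "(\<integral>t. f' t \<partial>lborel) = (\<integral>t. f' t * indicator {-R..R} t \<partial>lborel)"
        by (intro Bochner_Integration.integral_cong) (auto simp: indicator_def intro!: f'0)
      then show ?thesis using FTC[of "-R" R] f0 R by simp
    qed
    obtain B where B: "0 \<le> B" "\<And>t. \<bar>f' t\<bar> \<le> B" using cc_smooth_bounded[OF f'b] by blast
    define G where "G t x = (if -R < T x \<and> T x \<le> t \<and> t \<le> R then f' t * k x else 0)" for t x
    have G_meas[measurable]: "(\<lambda>(t, x). G t x) \<in> borel_measurable (lborel \<Otimes>\<^sub>M M)"
      unfolding G_def by measurable
    \<comment> \<open>A product that dominates \<open>G\<close>, for the integrability required by
      Fubini's theorem.\<close>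
    define H where "H t x = (B * indicator {-R..R} t) * \<bar>indicator {-R..R} (T x) * k x\<bar>" for t x
    have H_meas[measurable]: "(\<lambda>(t, x). H t x) \<in> borel_measurable (lborel \<Otimes>\<^sub>M M)"
      unfolding H_def by measurable
    have H_int: "integrable (lborel \<Otimes>\<^sub>M M) (\<lambda>(t, x). H t x)"
    proof (rule P.Fubini_integrable[OF H_meas])
      have "(\<lambda>t. \<integral>x. norm (case (t, x) of (t, x) \<Rightarrow> H t x) \<partial>M)
         = (\<lambda>t. (B * indicator {-R..R} t) * (\<integral>x. \<bar>indicator {-R..R} (T x) * k x\<bar> \<partial>M))"
        using B(1) by (auto simp: H_def abs_mult)
      then show "integrable lborel (\<lambda>t. \<integral>x. norm (case (t, x) of (t, x) \<Rightarrow> H t x) \<partial>M)"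
        by (simp only:) (intro integrable_mult_left ind_int)
      show "AE t in lborel. integrable M (\<lambda>x. case (t, x) of (t, x) \<Rightarrow> H t x)"
        unfolding H_def by (rule AE_I2) (simp only: prod.case, intro integrable_mult_right integrable_abs int_k)
    qed
    have G_int: "integrable (lborel \<Otimes>\<^sub>M M) (\<lambda>(t, x). G t x)"
    proof (rule Bochner_Integration.integrable_bound[OF H_int G_meas])
      have "\<bar>G t x\<bar> \<le> \<bar>H t x\<bar>" for t x
        using B(1) B(2)[of t] by (auto simp: G_def H_def indicator_def abs_mult intro!: mult_right_mono)
      then show "AE z in lborel \<Otimes>\<^sub>M M. norm (case z of (t, x) \<Rightarrow> G t x) \<le> norm (case z of (t, x) \<Rightarrow> H t x)"
        by (intro AE_I2) (simp add: split_beta)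
    qed
    have inner1: "k x * f (T x) = - (\<integral>t. G t x \<partial>lborel)" for x
    proof (cases "-R < T x \<and> T x \<le> R")
      case True
      have "(\<integral>t. G t x \<partial>lborel) = (\<integral>t. k x * (f' t * indicator {T x..R} t) \<partial>lborel)"
        using True by (intro Bochner_Integration.integral_cong) (auto simp: G_def indicator_def)
      also have "\<dots> = k x * (f R - f (T x))" using True FTC[of "T x" R] by simp
      finally show ?thesis using f0[of R] R by simp
    next
      case False
      then have "(\<lambda>t. G t x) = (\<lambda>t. 0)" by (auto simp: G_def)
      moreover have "f (T x) = 0" using False by (intro f0) auto
      ultimately show ?thesis by simp
    qed
    \<comment> \<open>Mass is counted from -R instead of 0, which leaves the term W (-R) f' t; its
      integral vanishes together with that of f'.\<close>
    have inner2: "(\<integral>x. G t x \<partial>M) = f' t * (indicator {-R..R} t * W t) - W (-R) * f' t" for t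
    proof (cases "-R \<le> t \<and> t \<le> R")
      case True
      have "(\<integral>x. G t x \<partial>M) = (\<integral>x. f' t * (if -R < T x \<and> T x \<le> t then k x else 0) \<partial>M)"
        using True by (intro Bochner_Integration.integral_cong) (auto simp: G_def)
      also have "\<dots> = f' t * (W t - W (-R))" using True W_diff[of "-R" t] by simp
      finally show ?thesis using True by (simp add: algebra_simps)
    next
      case False
      then have "(\<lambda>x. G t x) = (\<lambda>x. 0)" by (auto simp: G_def)
      moreover have "f' t = 0" using False by (intro f'0) auto
      ultimately show ?thesis by simp
    qed
    have int_fW: "integrable lborel (\<lambda>t. f' t * (indicator {-R..R} t * W t))"
    proof (rule Bochner_Integration.integrable_bound[OF integrable_mult_right[OF int_W[of R], of B]])
      show "AE t in lborel. norm (f' t * (indicator {-R..R} t * W t)) \<le> norm (B * (indicator {-R..R} t * W t))"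
        using B by (auto simp: abs_mult intro!: mult_right_mono)
    qed measurable
    have "(\<integral>x. k x * f (T x) \<partial>M) = - (\<integral>x. (\<integral>t. G t x \<partial>lborel) \<partial>M)"
      by (subst inner1) simp
    also have "(\<integral>x. (\<integral>t. G t x \<partial>lborel) \<partial>M) = (\<integral>t. (\<integral>x. G t x \<partial>M) \<partial>lborel)"
      by (rule P.Fubini_integral[OF G_int])
    also have "\<dots> = (\<integral>t. f' t * (indicator {-R..R} t * W t) \<partial>lborel) - W (-R) * (\<integral>t. f' t \<partial>lborel)"
      unfolding inner2 using int_fW cc_smooth_integrable[OF f'b] by simp
    also have "(\<integral>t. f' t * (indicator {-R..R} t * W t) \<partial>lborel) = (\<integral>t. f' t * W t \<partial>lborel)"
      by (intro Bochner_Integration.integral_cong) (auto simp: indicator_def intro!: f'0)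
    finally show ?thesis using f'_zero by simp
  qed
  have int_f: "integrable M (\<lambda>x. indicator {-R..R} (T x) * (u x - W (T x)))" for R
  proof -
    have "integrable M (\<lambda>x. indicator {-R..R} (T x) * W (T x))"
      using int_W[of R] by (subst integrable_T) auto
    then have "integrable M (\<lambda>x. indicator {-R..R} (T x) * u x - indicator {-R..R} (T x) * W (T x))"
      by (intro Bochner_Integration.integrable_diff int_u)
    then show ?thesis by (simp add: right_diff_distrib)
  qed
  have int_cc: "integrable M (\<lambda>x. w x * f (T x))"
    if f: "cc_smooth R f" and w: "\<And>R. integrable M (\<lambda>x. indicator {-R..R} (T x) * w x)" and [measurable]: "w \<in> borel_measurable M" for R f w
  proof -
    obtain B where B: "0 \<le> B" "\<And>t. \<bar>f t\<bar> \<le> B" using cc_smooth_bounded[OF f] by blast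
    have [measurable]: "f \<in> borel_measurable borel" by (rule cc_smooth_borel[OF f])
    show ?thesis
    proof (rule Bochner_Integration.integrable_bound[OF integrable_mult_right[OF w[of R], of B]])
      show "AE x in M. norm (w x * f (T x)) \<le> norm (B * (indicator {-R..R} (T x) * w x))"
      proof (rule AE_I2)
        fix x
        show "norm (w x * f (T x)) \<le> norm (B * (indicator {-R..R} (T x) * w x))"
        proof (cases "T x \<in> {-R..R}")
          case True
          then show ?thesis using B mult_right_mono[OF B(2)[of "T x"], of "\<bar>w x\<bar>"] by (simp add: abs_mult mult.commute)
        next
          case False
          then have "R < \<bar>T x\<bar>" by auto
          then show ?thesis using cc_smooth_zero[OF f] by simp
        qed
      qed
    qed measurable
  qed
  have int_W': "integrable M (\<lambda>x. indicator {-R..R} (T x) * W (T x))" for R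
    using int_W[of R] by (subst integrable_T) auto
  have ortho: "(\<integral>x. (u x - W (T x)) * f' (T x) \<partial>M) = 0"
    if f': "cc_smooth R f'" and zero: "(\<integral>t. f' t \<partial>lborel) = 0" for R f'
  proof -
    obtain f where f: "cc_smooth R f" "\<And>t. (f has_real_derivative f' t) (at t)"
      using cc_smooth_primitive[OF f' zero] by blast
    have [measurable]: "f' \<in> borel_measurable borel" by (rule cc_smooth_borel[OF f'])
    have "(\<integral>x. u x * f' (T x) \<partial>M) = (\<integral>t. f' t * W t \<partial>lborel)"
      using weak[OF f] fub[OF f] by simp
    also have "\<dots> = (\<integral>x. W (T x) * f' (T x) \<partial>M)"
      by (subst int_T[symmetric]) (auto simp: mult.commute)
    finally have eq: "(\<integral>x. u x * f' (T x) \<partial>M) = (\<integral>x. W (T x) * f' (T x) \<partial>M)" .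
    have "(\<integral>x. u x * f' (T x) - W (T x) * f' (T x) \<partial>M) = 0"
      using eq by (subst Bochner_Integration.integral_diff) (auto intro!: int_cc[OF f'] int_u int_W')
    then show ?thesis by (simp add: left_diff_distrib)
  qed
  have bump_cc: "cc_smooth (max \<bar>a\<bar> \<bar>b\<bar>) (bump a b c)" if "a < b" "0 < c" for a b c
    using that by (intro cc_smooth_bump_alg bump_alg_bump) (auto simp: bump_eq)
  define I0 where "I0 = (\<integral>t. bump 0 1 1 t \<partial>lborel)"
  have I0: "I0 \<noteq> 0"
  proof
    assume "I0 = 0"
    then have "AE t in lborel. bump 0 1 1 t = 0"
      unfolding I0_def using bump_bounds[of 0 1 1] cc_smooth_integrable[OF bump_cc[of 0 1 1]]
      by (subst (asm) integral_nonneg_eq_0_iff_AE) auto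
    then have "AE t in lborel. \<not> (0 < t \<and> t < (1::real))"
      by eventually_elim (auto simp: bump_eq)
    then have "emeasure lborel {t. 0 < t \<and> t < (1::real)} = 0"
      by (subst (asm) AE_iff_measurable[OF _ refl]) auto
    moreover have "{t. 0 < t \<and> t < (1::real)} = {0<..<1}" by auto
    ultimately show False by simp
  qed
  \<comment> \<open>The constant that makes u - v(T) annihilate the reference bump on (0, 1); every
    other bump differs from a multiple of that one by a mean-zero function.\<close>
  define K where "K = (\<integral>x. (u x - W (T x)) * bump 0 1 1 (T x) \<partial>M) / I0"
  define v where "v t = W t + K" for t
  have v_meas[measurable]: "v \<in> borel_measurable borel" unfolding v_def by measurable
  have int_K: "integrable M (\<lambda>x. indicator {-R..R} (T x) * K)" for R
    using ind_int[of K R] by (subst integrable_T[where f="\<lambda>t. indicator {-R..R} t * K"]) (auto simp: mult.commute)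
  have int_v: "integrable M (\<lambda>x. indicator {-R..R} (T x) * (u x - v (T x)))" for R
    using Bochner_Integration.integrable_diff[OF int_f[of R] int_K[of R]]
    by (simp add: v_def algebra_simps)
  have f_bump: "(\<integral>x. (u x - v (T x)) * bump a b c (T x) \<partial>M) = 0" if ab: "a < b" and c: "0 < c" for a b c
  proof -
    define \<kappa> where "\<kappa> = (\<integral>t. bump a b c t \<partial>lborel) / I0"
    define \<eta> where "\<eta> t = bump a b c t + (- \<kappa>) * bump 0 1 1 t" for t
    define R where "R = max (max \<bar>a\<bar> \<bar>b\<bar>) 1"
    have \<eta>: "cc_smooth R \<eta>"
    proof (rule cc_smooth_bump_alg)
      show "\<eta> \<in> bump_alg" unfolding \<eta>_def[abs_def]
        using c by (intro bump_alg.add bump_alg.mult bump_alg.const bump_alg_bump) auto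
      fix x assume "R < \<bar>x\<bar>"
      then show "\<eta> x = 0" using ab by (auto simp: \<eta>_def R_def bump_eq)
    qed
    have i1: "integrable lborel (bump a b c)" "integrable lborel (bump 0 1 1)"
      using cc_smooth_integrable bump_cc ab c by (blast, metis cc_smooth_integrable bump_cc zero_less_one)
    have "(\<integral>t. \<eta> t \<partial>lborel) = (\<integral>t. bump a b c t \<partial>lborel) - \<kappa> * I0"
      unfolding \<eta>_def I0_def using i1 by simp
    also have "\<dots> = 0" using I0 by (simp add: \<kappa>_def)
    finally have "(\<integral>x. (u x - W (T x)) * \<eta> (T x) \<partial>M) = 0" by (rule ortho[OF \<eta>])
    moreover have i2: "integrable M (\<lambda>x. (u x - W (T x)) * bump a b c (T x))"
       "integrable M (\<lambda>x. (u x - W (T x)) * bump 0 1 1 (T x))"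
      using ab c by (auto intro!: int_cc[OF bump_cc] int_f)
    moreover have "(u x - W (T x)) * \<eta> (T x) = (u x - W (T x)) * bump a b c (T x) - \<kappa> * ((u x - W (T x)) * bump 0 1 1 (T x))" for x
      by (simp add: \<eta>_def algebra_simps)
    ultimately have "(\<integral>x. (u x - W (T x)) * bump a b c (T x) \<partial>M) = \<kappa> * (\<integral>x. (u x - W (T x)) * bump 0 1 1 (T x) \<partial>M)"
      by simp
    also have "\<dots> = K * (\<integral>t. bump a b c t \<partial>lborel)" by (simp add: \<kappa>_def K_def)
    also have "\<dots> = (\<integral>x. K * bump a b c (T x) \<partial>M)" using int_T[of "bump a b c"] by simp
    finally have e: "(\<integral>x. (u x - W (T x)) * bump a b c (T x) \<partial>M) = (\<integral>x. K * bump a b c (T x) \<partial>M)" .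
    have i3: "integrable M (\<lambda>x. K * bump a b c (T x))"
      by (rule int_cc[OF bump_cc[OF ab c] int_K]) simp
    have "(\<integral>x. (u x - v (T x)) * bump a b c (T x) \<partial>M) = (\<integral>x. (u x - W (T x)) * bump a b c (T x) - K * bump a b c (T x) \<partial>M)"
      by (intro Bochner_Integration.integral_cong) (auto simp: v_def algebra_simps)
    also have "\<dots> = 0"
      by (subst Bochner_Integration.integral_diff[OF i2(1) i3]) (simp only: e diff_self)
    finally show ?thesis .
  qed
  have interval: "(\<integral>x. indicator {a<..<b} (T x) * (u x - v (T x)) \<partial>M) = 0" if ab: "a < b" for a b
  proof -
    define R where "R = max \<bar>a\<bar> \<bar>b\<bar>"
    \<comment> \<open>With the parameter 1 / (n + 1) tending to 0, the bumps converge to the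
      indicator of the open interval.\<close>
    have "(\<lambda>n. \<integral>x. (u x - v (T x)) * bump a b (1 / real (Suc n)) (T x) \<partial>M) \<longlonglongrightarrow> (\<integral>x. indicator {a<..<b} (T x) * (u x - v (T x)) \<partial>M)"
    proof (rule integral_dominated_convergence[where w="\<lambda>x. \<bar>indicator {-R..R} (T x) * (u x - v (T x))\<bar>"])
      show "integrable M (\<lambda>x. \<bar>indicator {-R..R} (T x) * (u x - v (T x))\<bar>)" by (intro integrable_abs int_v)
      show "AE x in M. (\<lambda>n. (u x - v (T x)) * bump a b (1 / real (Suc n)) (T x)) \<longlonglongrightarrow> indicator {a<..<b} (T x) * (u x - v (T x))"
      proof (rule AE_I2)
        fix x
        have "(\<lambda>n. bump a b (1 / real (Suc n)) (T x)) \<longlonglongrightarrow> indicator {a<..<b} (T x)"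
        proof (cases "a < T x \<and> T x < b")
          case True
          have "(\<lambda>n. exp (- (1 / real (Suc n)) / ((T x - a) * (b - T x)))) \<longlonglongrightarrow> exp (- 0 / ((T x - a) * (b - T x)))"
            using True by (intro tendsto_intros LIMSEQ_Suc[OF lim_const_over_n]) auto
          then show ?thesis using True by (simp add: bump_eq[OF ab])
        next
          case False
          then show ?thesis by (auto simp: bump_eq[OF ab] indicator_def)
        qed
        then show "(\<lambda>n. (u x - v (T x)) * bump a b (1 / real (Suc n)) (T x)) \<longlonglongrightarrow> indicator {a<..<b} (T x) * (u x - v (T x))"
          by (subst mult.commute) (intro tendsto_intros)
      qed
      fix n :: nat
      show "AE x in M. norm ((u x - v (T x)) * bump a b (1 / real (Suc n)) (T x)) \<le> \<bar>indicator {-R..R} (T x) * (u x - v (T x))\<bar>"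
      proof (rule AE_I2)
        fix x
        have "bump a b (1 / real (Suc n)) (T x) \<le> indicator {a<..<b} (T x)" "0 \<le> bump a b (1 / real (Suc n)) (T x)"
          using bump_bounds[OF ab, of "1 / real (Suc n)" "T x"] by auto
        moreover have "indicator {a<..<b} (T x) \<le> (indicator {-R..R} (T x) :: real)"
          by (auto simp: indicator_def R_def)
        ultimately have "\<bar>u x - v (T x)\<bar> * bump a b (1 / real (Suc n)) (T x) \<le> \<bar>u x - v (T x)\<bar> * indicator {-R..R} (T x)"
          by (intro mult_left_mono) auto
        then show "norm ((u x - v (T x)) * bump a b (1 / real (Suc n)) (T x)) \<le> \<bar>indicator {-R..R} (T x) * (u x - v (T x))\<bar>"
          using \<open>0 \<le> bump a b (1 / real (Suc n)) (T x)\<close> by (simp add: abs_mult mult.commute)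
      qed
    qed measurable
    moreover have "(\<integral>x. (u x - v (T x)) * bump a b (1 / real (Suc n)) (T x) \<partial>M) = 0" for n
      by (rule f_bump[OF ab]) simp
    ultimately show ?thesis by (simp add: LIMSEQ_const_iff)
  qed
  have osc: "ennreal \<bar>v t - v s\<bar> \<le> (\<integral>\<^sup>+x. ennreal (indicator {s..t} (T x) * \<bar>k x\<bar>) \<partial>M)" if st: "s \<le> t" for s t
  proof -
    define R where "R = max \<bar>s\<bar> \<bar>t\<bar>"
    have i: "integrable M (\<lambda>x. (if s < T x \<and> T x \<le> t then k x else 0))"
      by (rule Bochner_Integration.integrable_bound[OF int_k[of R]]) (auto simp: indicator_def R_def)
    have "ennreal \<bar>v t - v s\<bar> = ennreal (norm (\<integral>x. (if s < T x \<and> T x \<le> t then k x else 0) \<partial>M))"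
      using W_diff[OF st] by (simp add: v_def)
    also have "\<dots> \<le> (\<integral>\<^sup>+x. ennreal (norm (if s < T x \<and> T x \<le> t then k x else 0)) \<partial>M)"
      by (rule integral_norm_bound_ennreal[OF i])
    also have "\<dots> \<le> (\<integral>\<^sup>+x. ennreal (indicator {s..t} (T x) * \<bar>k x\<bar>) \<partial>M)"
      by (intro nn_integral_mono ennreal_leI) (auto simp: indicator_def)
    finally show ?thesis .
  qed
  show ?thesis by (rule that[OF v_meas osc int_v interval])
qed

section \<open>Radial functions as profiles of ln |x|\<close>

lemma integrable_log_annulus:
  fixes u w :: "real^'n \<Rightarrow> real"
  assumes u: "L1loc_punct u" and w: "w \<in> borel_measurable lebesgue"
    and C: "\<And>x. exp (- R) \<le> norm x \<Longrightarrow> norm x \<le> exp R \<Longrightarrow> \<bar>w x\<bar> \<le> C"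
  shows "integrable log_measure (\<lambda>x. indicator {-R..R} (log_norm x) * (w x * u x))"
proof -
  let ?N = "real CARD('n)" and ?s = "sphere_area TYPE('n)"
  let ?A = "{x::real^'n. exp (- R) \<le> norm x \<and> norm x \<le> exp R}"
  have [measurable]: "u \<in> borel_measurable lebesgue" using u by (simp add: L1loc_punct_def)
  note [measurable] = w
  have cl: "closed ?A" by (intro closed_Collect_conj closed_Collect_le continuous_intros)
  have "?A \<subseteq> cball 0 (exp R)" by auto
  then have "bounded ?A" using bounded_cball bounded_subset by blast
  then have "compact ?A" using cl by (simp add: compact_eq_bounded_closed)
  moreover have "0 \<notin> ?A" by (simp add: not_le)
  ultimately have int: "integrable lebesgue (\<lambda>x. indicator ?A x * u x)"
    using u unfolding L1loc_punct_def set_integrable_def by auto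
  let ?D = "exp (?N * R) / ?s * \<bar>C\<bar>"
  show ?thesis
  proof (subst integrable_log_measure_iff)
    show "integrable lebesgue (\<lambda>x. norm x powr - ?N / ?s * (indicator {-R..R} (log_norm x) * (w x * u x)))"
    proof (rule Bochner_Integration.integrable_bound[OF integrable_mult_right[OF int, of ?D]])
      show "AE x in lebesgue. norm (norm x powr - ?N / ?s * (indicator {-R..R} (log_norm x) * (w x * u x))) \<le> norm (?D * (indicator ?A x * u x))"
        using AE_lebesgue_neq_0
      proof eventually_elim
        case (elim x)
        show ?case
        proof (cases "- R \<le> log_norm x \<and> log_norm x \<le> R")
          case True
          then have A: "exp (- R) \<le> norm x" "norm x \<le> exp R"
            using elim by (metis exp_le_cancel_iff exp_log_norm)+
          have "?N * (- R) \<le> ?N * log_norm x" using True by (intro mult_left_mono) auto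
          then have "norm x powr - ?N \<le> exp (?N * R)"
            using elim by (simp add: exp_mult_log_norm[symmetric])
          then have "norm x powr - ?N / ?s * \<bar>w x\<bar> \<le> ?D"
            using sphere_area_pos[where 'n='n] C[OF A] by (intro mult_mono divide_right_mono) auto
          then have "norm x powr - ?N / ?s * \<bar>w x\<bar> * \<bar>u x\<bar> \<le> ?D * \<bar>u x\<bar>"
            by (rule mult_right_mono) auto
          then show ?thesis
            using True A sphere_area_pos[where 'n='n] by (simp add: abs_mult mult.assoc)
        qed simp
      qed
    qed measurable
  qed measurable
qed

lemma enn2real_eqD: "enn2real x = enn2real y \<Longrightarrow> x \<noteq> \<infinity> \<Longrightarrow> y \<noteq> \<infinity> \<Longrightarrow> x = y"
  by (cases x; cases y) auto

text \<open>The obstacle is that f is only Lebesgue measurable, so its profile in ln |x| need not be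
  Borel. The images of its positive and negative parts agree on intervals, hence on Borel sets. If K
  is a compact subset of {f > 0} off the origin, its image on the line is compact, thus Borel, and
  by radiality f > 0 on the whole preimage. The negative part gives this image measure 0, hence so
  does the positive part, and K is a null set. Up to a null set, {f > 0} is a countable union of
  such K.\<close>

lemma AE_nonpos_of_interval_integrals:
  fixes f :: "real^'n \<Rightarrow> real"
  assumes f[measurable]: "f \<in> borel_measurable lebesgue"
    and rad: "\<And>x y. norm x = norm y \<Longrightarrow> x \<noteq> 0 \<Longrightarrow> f x = f y"
    and int: "\<And>R. integrable log_measure (\<lambda>x. indicator {-R..R} (log_norm x) * f x)"
    and zero: "\<And>a b. a < b \<Longrightarrow> (\<integral>x. indicator {a<..<b} (log_norm x) * f x \<partial>log_measure) = 0"
  shows "AE x in lebesgue. f x \<le> 0"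
proof -
  have [measurable]: "f \<in> borel_measurable log_measure" by (simp add: measurable_cong_sets[OF sets_log_measure refl])
  \<comment> \<open>\<open>ennreal\<close> cuts off negative values, so \<open>?\<mu> f\<close> is
    the image of the positive part and \<open>?\<mu> (\<lambda>x. - f x)\<close> that of the
    negative part.\<close>
  let ?\<mu> = "\<lambda>f. distr (density log_measure (\<lambda>x. ennreal (f x))) borel (log_norm :: real^'n \<Rightarrow> real)"
  have em: "emeasure (?\<mu> h) S = (\<integral>\<^sup>+x. ennreal (indicator S (log_norm x) * h x) \<partial>log_measure)"
    if [measurable]: "h \<in> borel_measurable log_measure" "S \<in> sets borel" for h S
  proof -
    have "emeasure (?\<mu> h) S = emeasure (density log_measure (\<lambda>x. ennreal (h x))) (log_norm -` S \<inter> UNIV)"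
      by (subst emeasure_distr) auto
    also have "\<dots> = (\<integral>\<^sup>+x. ennreal (h x) * indicator (log_norm -` S \<inter> UNIV) x \<partial>log_measure)"
    proof (rule emeasure_density)
      show "log_norm -` S \<inter> UNIV \<in> sets log_measure"
        using measurable_sets[OF log_norm_log_measure \<open>S \<in> sets borel\<close>] by simp
    qed measurable
    also have "\<dots> = (\<integral>\<^sup>+x. ennreal (indicator S (log_norm x) * h x) \<partial>log_measure)"
      by (intro nn_integral_cong) (auto simp: indicator_def)
    finally show ?thesis .
  qed
  have bd: "integrable log_measure (\<lambda>x. indicator {a<..<b} (log_norm x) * f x)" for a b
  proof -
    have "{a<..<b} \<subseteq> {-(max \<bar>a\<bar> \<bar>b\<bar>)..max \<bar>a\<bar> \<bar>b\<bar>}" by auto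
    then show ?thesis
      by (intro Bochner_Integration.integrable_bound[OF int[of "max \<bar>a\<bar> \<bar>b\<bar>"]]) (auto simp: indicator_def)
  qed
  have fin: "(\<integral>\<^sup>+x. ennreal (indicator {a<..<b} (log_norm x) * f x) \<partial>log_measure) \<noteq> \<infinity>"
    "(\<integral>\<^sup>+x. ennreal (indicator {a<..<b} (log_norm x) * - f x) \<partial>log_measure) \<noteq> \<infinity>" for a b
    using bd[of a b] unfolding real_integrable_def by auto
  have eq: "emeasure (?\<mu> f) {a<..<b} = emeasure (?\<mu> (\<lambda>x. - f x)) {a<..<b}" for a b
  proof (cases "a < b")
    case True
    let ?p = "\<integral>\<^sup>+x. ennreal (indicator {a<..<b} (log_norm x) * f x) \<partial>log_measure"
    let ?n = "\<integral>\<^sup>+x. ennreal (indicator {a<..<b} (log_norm x) * - f x) \<partial>log_measure"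
    have "enn2real ?p = enn2real ?n"
      using real_lebesgue_integral_def[OF bd[of a b]] zero[OF True] by simp
    then have "?p = ?n" by (rule enn2real_eqD[OF _ fin])
    then show ?thesis by (simp add: em)
  qed simp
  have mu: "?\<mu> f = ?\<mu> (\<lambda>x. - f x)"
  proof (rule measure_eqI_generator_eq[where E="range (\<lambda>(a, b). {a<..<b})" and \<Omega>=UNIV and A="\<lambda>i. {- real i<..<real i}"])
    show "Int_stable (range (\<lambda>(a, b). {a<..<b::real}))"
      by (auto simp: Int_stable_def)
    show "sets (?\<mu> f) = sigma_sets UNIV (range (\<lambda>(a, b). {a<..<b}))"
      "sets (?\<mu> (\<lambda>x. - f x)) = sigma_sets UNIV (range (\<lambda>(a, b). {a<..<b}))"
      by (simp_all add: borel_eq_box box_real)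
    show "(\<Union>i. {- real i<..<real i}) = UNIV"
    proof (intro equalityI subsetI UNIV_I)
      fix x :: real
      obtain i :: nat where "\<bar>x\<bar> < real i" using reals_Archimedean2 by blast
      then show "x \<in> (\<Union>i. {- real i<..<real i})" by (auto simp: abs_less_iff intro!: exI[of _ i])
    qed
    show "emeasure (?\<mu> f) {- real i<..<real i} \<noteq> \<infinity>" for i
      using fin(1)[of "- real i" "real i"] by (simp add: em)
  qed (use eq in auto)
  let ?P = "{x. x \<noteq> 0 \<and> 0 < f x}"
  have comp: "AE x in lebesgue. x \<notin> K" if K: "compact K" "K \<subseteq> ?P" for K
  proof -
    have "continuous_on K log_norm"
      unfolding log_norm_def using K(2) by (auto intro!: continuous_intros)
    then have "compact (log_norm ` K)" using K(1) by (rule compact_continuous_image)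
    then have E[measurable]: "log_norm ` K \<in> sets borel" by (simp add: compact_imp_closed)
    have pos: "0 < f x" if nz: "x \<noteq> 0" and im: "log_norm x \<in> log_norm ` K" for x
    proof -
      obtain y where y: "y \<in> K" "log_norm x = log_norm y" using im by auto
      then have "y \<noteq> 0" "0 < f y" using K by auto
      then have "norm x = norm y" using y nz exp_log_norm[of x] exp_log_norm[of y] by simp
      then show ?thesis using rad[of x y] nz \<open>0 < f y\<close> by simp
    qed
    have "emeasure (?\<mu> (\<lambda>x. - f x)) (log_norm ` K) = (\<integral>\<^sup>+x. ennreal (indicator (log_norm ` K) (log_norm x) * - f x) \<partial>log_measure)"
      by (rule em) measurable
    also have "\<dots> = (\<integral>\<^sup>+x. 0 \<partial>(log_measure :: (real^'n) measure))"
    proof (rule nn_integral_cong_AE, unfold AE_log_measure)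
      show "AE x in lebesgue. ennreal (indicator (log_norm ` K) (log_norm x) * - f x) = 0"
        using AE_lebesgue_neq_0
      proof eventually_elim
        case (elim x)
        then show ?case using pos[of x] by (auto simp: indicator_def ennreal_neg)
      qed
    qed
    finally have "emeasure (?\<mu> f) (log_norm ` K) = 0" using mu by simp
    then have "(\<integral>\<^sup>+x. ennreal (indicator (log_norm ` K) (log_norm x) * f x) \<partial>log_measure) = 0"
      by (subst (asm) em) auto
    then have "AE x in log_measure. ennreal (indicator (log_norm ` K) (log_norm x) * f x) = 0"
      by (subst (asm) nn_integral_0_iff_AE) auto
    then have "AE x in lebesgue. ennreal (indicator (log_norm ` K) (log_norm x) * f x) = 0"
      by (simp only: AE_log_measure)
    then show "AE x in lebesgue. x \<notin> K"
    proof eventually_elim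
      case (elim x)
      show ?case
      proof
        assume x: "x \<in> K"
        then have "0 < f x" using K(2) by auto
        moreover have "indicator (log_norm ` K) (log_norm x) = (1::real)" using x by (auto simp: indicator_def)
        ultimately show False using elim by (simp add: ennreal_eq_0_iff)
      qed
    qed
  qed
  have "{x \<in> space lebesgue. x \<noteq> 0 \<and> 0 < f x} \<in> sets lebesgue"
  proof -
    have "{x \<in> space lebesgue. 0 < f x} \<in> sets lebesgue" by measurable
    moreover have "{0::real^'n} \<in> sets lebesgue" by simp
    ultimately have "{x \<in> space lebesgue. 0 < f x} - {0} \<in> sets lebesgue" by (rule sets.Diff)
    moreover have "{x \<in> space lebesgue. 0 < f x} - {0} = {x \<in> space lebesgue. x \<noteq> 0 \<and> 0 < f x}" by auto
    ultimately show ?thesis by simp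
  qed
  then have "?P \<in> sets lebesgue" by simp
  then obtain C t where Ct: "fsigma C" "t \<in> null_sets lebesgue" "C \<union> t = ?P" by (rule lebesgue_set_almost_fsigma)
  obtain F :: "nat \<Rightarrow> (real^'n) set" where F: "range F \<subseteq> Collect compact" "C = \<Union>(range F)"
    using Ct(1) fsigma_Union_compact by metis
  have "AE x in lebesgue. x \<notin> F n" for n
    using F Ct(3) by (intro comp) auto
  then have "AE x in lebesgue. \<forall>n. x \<notin> F n" by (simp add: AE_all_countable)
  moreover have "AE x in lebesgue. x \<notin> t" by (rule AE_not_in[OF Ct(2)])
  ultimately show ?thesis using AE_lebesgue_neq_0
  proof eventually_elim
    case (elim x)
    then have "x \<notin> ?P" using F(2) Ct(3) by auto
    then show ?case using elim by auto
  qed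
qed

text \<open>The difference u - v(ln |x|) depends only on |x|, so
  \<open>AE_nonpos_of_interval_integrals\<close>, applied to it and to its negative, gives equality
  almost everywhere. Only u is asked to be radial; g enters through |x| |g(x)|.\<close>

theorem radial_representation:
  fixes u g :: "real^'n \<Rightarrow> real"
  assumes ru: "radial u" and rd: "radial_deriv u g"
  obtains v where "fibred_primitive log_measure log_norm (\<lambda>x. norm x * \<bar>g x\<bar>) v"
    "AE x in lebesgue. u x = v (log_norm x)"
proof -
  have L: "L1loc_punct u" "L1loc_punct g" using rd by (auto simp: radial_deriv_def)
  have m: "u \<in> borel_measurable lebesgue" "g \<in> borel_measurable lebesgue"
    using L by (auto simp: L1loc_punct_def)
  have um[measurable]: "u \<in> borel_measurable log_measure" and gm[measurable]: "g \<in> borel_measurable log_measure"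
    using m by (simp_all add: measurable_cong_sets[OF sets_log_measure refl])
  have nm[measurable]: "(norm :: real^'n \<Rightarrow> real) \<in> borel_measurable log_measure"
    by (simp add: measurable_cong_sets[OF sets_log_measure refl])
  have iu: "integrable log_measure (\<lambda>x. indicator {-R..R} (log_norm x) * u x)" for R
    using integrable_log_annulus[OF L(1), of "\<lambda>x. 1" R 1] by simp
  have ig: "integrable log_measure (\<lambda>x. indicator {-R..R} (log_norm x) * (norm x * g x))" for R
    by (rule integrable_log_annulus[OF L(2)]) auto
  have wk: "(\<integral>x. (norm x * g x) * f (log_norm x) \<partial>log_measure) = - (\<integral>x. u x * f' (log_norm x) \<partial>log_measure)"
    if "cc_smooth R f" "\<And>t. (f has_real_derivative f' t) (at t)" for R f f'
    by (rule radial_deriv_log_test[OF rd that m])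
  obtain v where v: "v \<in> borel_measurable borel"
    "\<And>s t. s \<le> t \<Longrightarrow> ennreal \<bar>v t - v s\<bar> \<le> (\<integral>\<^sup>+x. ennreal (indicator {s..t} (log_norm x) * \<bar>norm x * g x\<bar>) \<partial>(log_measure :: (real^'n) measure))"
    "\<And>R. integrable log_measure (\<lambda>x. indicator {-R..R} (log_norm x) * (u x - v (log_norm x)))"
    "\<And>a b. a < b \<Longrightarrow> (\<integral>x. indicator {a<..<b} (log_norm x) * (u x - v (log_norm x)) \<partial>log_measure) = 0"
    by (rule weak_primitive[OF log_norm_log_measure distr_log_measure um _ iu ig wk]) auto
  note [measurable] = v(1) m
  have eq: "norm x = norm y \<Longrightarrow> u x - v (log_norm x) = u y - v (log_norm y)" for x y
    using ru unfolding radial_def log_norm_def by metis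
  have "AE x in lebesgue. u x - v (log_norm x) \<le> 0"
    by (rule AE_nonpos_of_interval_integrals[OF _ eq v(3,4)]) measurable
  moreover have "AE x in lebesgue. - (u x - v (log_norm x)) \<le> 0"
  proof (rule AE_nonpos_of_interval_integrals)
    show "integrable log_measure (\<lambda>x. indicator {-R..R} (log_norm x) * - (u x - v (log_norm x)))" for R
      using Bochner_Integration.integrable_minus[OF v(3)[of R]] by (simp only: mult_minus_right)
    show "(\<integral>x. indicator {a<..<b} (log_norm x) * - (u x - v (log_norm x)) \<partial>log_measure) = 0" if "a < b" for a b
    proof -
      have "(\<integral>x. - (indicator {a<..<b} (log_norm x) * (u x - v (log_norm x))) \<partial>log_measure) = 0"
        using v(4)[OF that] by (subst Bochner_Integration.integral_minus) simp
      then show ?thesis by (simp only: mult_minus_right)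
    qed
    show "- (u x - v (log_norm x)) = - (u y - v (log_norm y))" if "norm x = norm y" for x y
      by (simp only: eq[OF that])
  qed measurable
  ultimately have AE: "AE x in lebesgue. u x = v (log_norm x)" by eventually_elim simp
  have "fibred_primitive log_measure log_norm (\<lambda>x. norm x * \<bar>g x\<bar>) v"
  proof (intro fibred_primitive.intro fibred_primitive_axioms.intro sigma_finite_log_measure distr_log_measure)
    show "ennreal \<bar>v t - v s\<bar> \<le> (\<integral>\<^sup>+x. ennreal (indicator {s..t} (log_norm x) * (norm x * \<bar>g x\<bar>)) \<partial>(log_measure :: (real^'n) measure))"
      if "s \<le> t" for s t
      using v(2)[OF that] by (simp add: abs_mult)
  qed (use v(1) in auto)
  then show ?thesis using AE that by blast
qed

text \<open>The factor |x| taken into the integrand accounts for d - s in place of d, which is how b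
  - p arises in the exponent \<beta>.\<close>

lemma wint_radial_deriv:
  fixes g :: "real^'n \<Rightarrow> real"
  assumes g: "g \<in> borel_measurable lebesgue" and k: "k * s = d - s + real CARD('n)"
  shows "wint d s g = ennreal (sphere_area TYPE('n)) *
     (\<integral>\<^sup>+x. ennreal (exp (k * s * log_norm x) * (norm x * \<bar>g x\<bar>) powr s) \<partial>log_measure)"
proof -
  have "(\<integral>\<^sup>+x. ennreal (exp ((d + real CARD('n)) * log_norm x) * \<bar>g x\<bar> powr s) \<partial>log_measure)
    = (\<integral>\<^sup>+x. ennreal (exp (k * s * log_norm x) * (norm x * \<bar>g x\<bar>) powr s) \<partial>log_measure)"
  proof (rule nn_integral_cong_AE, unfold AE_log_measure)
    show "AE x in lebesgue. ennreal (exp ((d + real CARD('n)) * log_norm x) * \<bar>g x\<bar> powr s) = ennreal (exp (k * s * log_norm x) * (norm x * \<bar>g x\<bar>) powr s)"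
      using AE_lebesgue_neq_0
    proof eventually_elim
      case (elim x)
      have "norm x powr s = exp (s * log_norm x)" using elim by (simp add: exp_mult_log_norm)
      then have "exp (k * s * log_norm x) * (norm x * \<bar>g x\<bar>) powr s = exp (k * s * log_norm x + s * log_norm x) * \<bar>g x\<bar> powr s"
        by (simp add: powr_mult exp_add)
      also have "k * s * log_norm x + s * log_norm x = (d + real CARD('n)) * log_norm x"
        by (simp add: k algebra_simps)
      finally show ?case by simp
    qed
  qed
  then show ?thesis using wint_eq_log_measure[OF g] by simp
qed

section \<open>Radial functions with a smooth profile\<close>

text \<open>\<open>test_fun\<close> supplies partial derivatives only, while the radial derivative
  needs a direction that varies with x. The increment h is switched on one coordinate at a time,
  \<open>m S h\<close> keeping those in S; each new coordinate costs one application of the mean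
  value theorem and an error e / 2.\<close>

lemma has_derivative_of_continuous_partials:
  fixes f :: "real^'n \<Rightarrow> real" and f' :: "'n \<Rightarrow> real^'n \<Rightarrow> real"
  assumes f': "\<And>i x. ((\<lambda>t. f (x + t *\<^sub>R axis i 1)) has_real_derivative f' i x) (at 0)"
    and cont: "\<And>i. continuous_on UNIV (f' i)"
  shows "(f has_derivative (\<lambda>h. (\<chi> i. f' i x) \<bullet> h)) (at x)"
proof -
  define m where "m S h = (\<chi> i. if i \<in> S then h $ i else 0)" for S and h :: "real^'n"
  have line: "((\<lambda>t. f (y + t *\<^sub>R axis i 1)) has_real_derivative f' i (y + t *\<^sub>R axis i 1)) (at t)" for y i t
  proof -
    have "((\<lambda>s. f ((y + t *\<^sub>R axis i 1) + s *\<^sub>R axis i 1)) has_real_derivative f' i (y + t *\<^sub>R axis i 1)) (at 0)"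
      by (rule f')
    then have "((\<lambda>s. f (y + (s + t) *\<^sub>R axis i 1)) has_real_derivative f' i (y + t *\<^sub>R axis i 1)) (at 0)"
      by (simp add: algebra_simps)
    then show ?thesis
      using DERIV_shift[of "\<lambda>t. f (y + t *\<^sub>R axis i 1)" "f' i (y + t *\<^sub>R axis i 1)" 0 t] by simp
  qed
  have claim: "\<forall>e>0. \<exists>d>0. \<forall>h. norm h < d \<longrightarrow> \<bar>f (x + m S h) - f x - (\<Sum>i\<in>S. f' i x * h $ i)\<bar> \<le> e * norm h"
    if "finite S" for S
    using that
  proof (induction S)
    case empty
    have "m {} h = 0" for h by (simp add: m_def vec_eq_iff)
    then show ?case by (auto intro!: exI[of _ 1])
  next
    case (insert i S)
    show ?case
    proof (intro allI impI)
      fix e :: real assume e: "0 < e"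
      obtain d1 where d1: "0 < d1" "\<And>h. norm h < d1 \<Longrightarrow> \<bar>f (x + m S h) - f x - (\<Sum>i\<in>S. f' i x * h $ i)\<bar> \<le> e / 2 * norm h"
        using insert.IH e half_gt_zero by meson
      have "isCont (f' i) x" using cont[of i] by (simp add: continuous_on_eq_continuous_at)
      then obtain d2 where d2: "0 < d2" "\<And>y. dist y x < d2 \<Longrightarrow> dist (f' i y) (f' i x) < e / 2"
        unfolding continuous_at_eps_delta using e by (meson half_gt_zero)
      show "\<exists>d>0. \<forall>h. norm h < d \<longrightarrow> \<bar>f (x + m (insert i S) h) - f x - (\<Sum>i\<in>insert i S. f' i x * h $ i)\<bar> \<le> e * norm h"
      proof (intro exI[of _ "min d1 d2"] conjI allI impI)
        fix h :: "real^'n" assume h: "norm h < min d1 d2"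
        define y where "y = x + m S h"
        define c where "c = h $ i"
        have "m (insert i S) h = m S h + c *\<^sub>R axis i 1"
          using insert.hyps by (auto simp: m_def c_def vec_eq_iff axis_def)
        then have y': "x + m (insert i S) h = y + c *\<^sub>R axis i 1" by (simp add: y_def)
        have "((\<lambda>s. f (y + (s * c) *\<^sub>R axis i 1)) has_real_derivative f' i (y + (s * c) *\<^sub>R axis i 1) * c) (at s)" for s
          by (rule DERIV_chain2[where f="\<lambda>t. f (y + t *\<^sub>R axis i 1)", OF line]) (auto intro!: derivative_eq_intros)
        then obtain z where z: "0 < z" "z < 1" "f (y + (1 * c) *\<^sub>R axis i 1) - f (y + (0 * c) *\<^sub>R axis i 1) = (1 - 0) * (f' i (y + (z * c) *\<^sub>R axis i 1) * c)"
          using MVT2[of 0 1 "\<lambda>s. f (y + (s * c) *\<^sub>R axis i 1)" "\<lambda>s. f' i (y + (s * c) *\<^sub>R axis i 1) * c"] by auto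
        have "norm (m S h + (z * c) *\<^sub>R axis i 1) \<le> norm h"
        proof (rule norm_le_componentwise_cart)
          fix j
          show "norm ((m S h + (z * c) *\<^sub>R axis i 1) $ j) \<le> norm (h $ j)"
            using z insert.hyps by (auto simp: m_def c_def axis_def abs_mult intro!: mult_left_le_one_le)
        qed
        then have "dist (y + (z * c) *\<^sub>R axis i 1) x < d2"
          using h by (simp add: y_def dist_norm algebra_simps)
        then have "\<bar>f' i (y + (z * c) *\<^sub>R axis i 1) - f' i x\<bar> \<le> e / 2"
          using d2(2) by (fastforce simp: dist_real_def)
        then have "\<bar>(f' i (y + (z * c) *\<^sub>R axis i 1) - f' i x) * c\<bar> \<le> e / 2 * norm h"
          unfolding abs_mult using component_le_norm_cart[of h i] e by (intro mult_mono) (auto simp: c_def)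
        moreover have "\<bar>f y - f x - (\<Sum>i\<in>S. f' i x * h $ i)\<bar> \<le> e / 2 * norm h"
          unfolding y_def using h by (intro d1(2)) auto
        moreover have "f (x + m (insert i S) h) - f x - (\<Sum>i\<in>insert i S. f' i x * h $ i)
           = (f y - f x - (\<Sum>i\<in>S. f' i x * h $ i)) + (f' i (y + (z * c) *\<^sub>R axis i 1) - f' i x) * c"
          using z(3) insert.hyps unfolding y' by (simp add: c_def algebra_simps)
        ultimately show "\<bar>f (x + m (insert i S) h) - f x - (\<Sum>i\<in>insert i S. f' i x * h $ i)\<bar> \<le> e * norm h"
          by linarith
      qed (use d1 d2 in auto)
    qed
  qed
  have mU: "m UNIV h = h" for h by (simp add: m_def vec_eq_iff)
  show ?thesis
    unfolding has_derivative_at_alt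
  proof (intro conjI allI impI)
    show "bounded_linear (\<lambda>h. (\<chi> i. f' i x) \<bullet> h)" by (rule bounded_linear_inner_right)
    fix e :: real assume "0 < e"
    then obtain d where d: "0 < d" "\<And>h. norm h < d \<Longrightarrow> \<bar>f (x + h) - f x - (\<Sum>i\<in>UNIV. f' i x * h $ i)\<bar> \<le> e * norm h"
      using claim[of UNIV] unfolding mU by auto
    show "\<exists>d>0. \<forall>y. norm (y - x) < d \<longrightarrow> norm (f y - f x - (\<chi> i. f' i x) \<bullet> (y - x)) \<le> e * norm (y - x)"
      using d(1) d(2)[of "y - x" for y] by (intro exI[of _ d]) (auto simp: inner_vec_def)
  qed
qed

lemma test_fun_gradient:
  fixes \<phi> :: "real^'n \<Rightarrow> real"
  assumes "test_fun \<phi>"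
  obtains G r R where "\<And>x. (\<phi> has_derivative (\<lambda>h. G x \<bullet> h)) (at x)" "continuous_on UNIV G" "continuous_on UNIV \<phi>"
    "0 < r" "\<And>x. norm x < r \<or> R < norm x \<Longrightarrow> \<phi> x = 0 \<and> G x = 0"
proof -
  from assms obtain S where S: "\<phi> \<in> S" "\<forall>h\<in>S. continuous_on UNIV h"
     "\<forall>h\<in>S. \<forall>i. \<exists>h'\<in>S. \<forall>x. ((\<lambda>t. h (x + t *\<^sub>R axis i 1)) has_real_derivative h' x) (at 0)"
    unfolding test_fun_def smooth_fun_def by blast
  have "\<exists>h'. continuous_on UNIV h' \<and> (\<forall>x. ((\<lambda>t. \<phi> (x + t *\<^sub>R axis i 1)) has_real_derivative h' x) (at 0))" for i
    using S(3)[rule_format, OF S(1), of i] S(2) by auto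
  then have "\<exists>f'. \<forall>i. continuous_on UNIV (f' i) \<and> (\<forall>x. ((\<lambda>t. \<phi> (x + t *\<^sub>R axis i 1)) has_real_derivative f' i x) (at 0))"
    by (intro choice allI)
  then obtain f' where f': "\<And>i. continuous_on UNIV (f' i)" "\<And>i x. ((\<lambda>t. \<phi> (x + t *\<^sub>R axis i 1)) has_real_derivative f' i x) (at 0)" by auto
  define G where "G x = (\<chi> i. f' i x)" for x
  have G: "(\<phi> has_derivative (\<lambda>h. G x \<bullet> h)) (at x)" for x
    unfolding G_def using has_derivative_of_continuous_partials[OF f'(2,1)] .
  have cG: "continuous_on UNIV G" unfolding G_def[abs_def] by (intro continuous_on_vec_lambda f'(1))
  let ?K = "closure {x. \<phi> x \<noteq> 0}"
  have K: "compact ?K" "0 \<notin> ?K" using assms by (auto simp: test_fun_def)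
  obtain R where R: "\<And>x. x \<in> ?K \<Longrightarrow> norm x \<le> R" using compact_imp_bounded[OF K(1)] unfolding bounded_iff by auto
  have "open (- ?K)" "0 \<in> - ?K" using K by auto
  then obtain r where r: "0 < r" "ball 0 r \<subseteq> - ?K" by (rule openE)
  have zero: "\<phi> x = 0" if "norm x < r \<or> R < norm x" for x
  proof (rule ccontr)
    assume "\<phi> x \<noteq> 0"
    then have "x \<in> ?K" by (intro subsetD[OF closure_subset]) simp
    then have "x \<notin> ball 0 r" "norm x \<le> R" using r R by auto
    then show False using that by auto
  qed
  have zeroG: "G x = 0" if "norm x < r \<or> R < norm x" for x
  proof -
    have "open ({x::real^'n. norm x < r} \<union> {x. R < norm x})"
      by (intro open_Un open_Collect_less continuous_intros)
    then have "(\<phi> has_derivative (\<lambda>h. 0)) (at x)"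
      by (rule has_derivative_transform_within_open[OF has_derivative_const]) (use that zero in auto)
    then have "(\<lambda>h. G x \<bullet> h) = (\<lambda>h. 0)" by (rule has_derivative_unique[OF G])
    from fun_cong[OF this, of "G x"] have "G x \<bullet> G x = 0" .
    then show ?thesis by simp
  qed
  have "continuous_on UNIV \<phi>" using S by blast
  then show ?thesis by (rule that[OF G cG _ r(1)]) (rule conjI[OF zero zeroG])
qed

section \<open>Dilation invariance and the radial derivative of a profile\<close>

lemma integral_lborel_scale:
  fixes f :: "'a::euclidean_space \<Rightarrow> real"
  assumes [measurable]: "f \<in> borel_measurable borel" and c: "0 < c"
  shows "(\<integral>x. c ^ DIM('a) * f (c *\<^sub>R x) \<partial>lborel) = (\<integral>x. f x \<partial>lborel)"
    and "integrable lborel f \<Longrightarrow> integrable lborel (\<lambda>x. c ^ DIM('a) * f (c *\<^sub>R x))"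
proof -
  have L: "lborel = density (distr lborel borel (\<lambda>x::'a. 0 + c *\<^sub>R x)) (\<lambda>_. \<bar>c\<bar> ^ DIM('a))"
    using c by (intro lborel_affine) auto
  show "(\<integral>x. c ^ DIM('a) * f (c *\<^sub>R x) \<partial>lborel) = (\<integral>x. f x \<partial>lborel)"
    using c by (subst (2) L) (simp add: integral_density integral_distr)
  assume "integrable lborel f"
  then show "integrable lborel (\<lambda>x. c ^ DIM('a) * f (c *\<^sub>R x))"
    using c by (subst (asm) L) (simp add: integrable_density integrable_distr_eq)
qed

lemma powr_minus_of_nat: "0 < x \<Longrightarrow> x powr - real n = inverse (x ^ n)"
  by (simp add: powr_minus powr_realpow)

lemma powr_minus_mult_power: "0 < x \<Longrightarrow> 0 < n \<Longrightarrow> x powr - real n * x ^ (n - 1) = 1 / x"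
  by (cases n) (simp_all add: powr_minus_of_nat divide_inverse del: of_nat_Suc)

text \<open>The integral of |x|^{-N} \<Phi>(e^s x) does not depend on s, so its derivative at s = 0,
  the integral of |x|^{-N} \<Psi>(x), vanishes. This takes the place of polar coordinates followed
  by one-dimensional integration by parts.\<close>

lemma integral_radial_derivative_eq_0:
  fixes \<Phi> \<Psi> :: "real^'n \<Rightarrow> real"
  assumes m[measurable]: "\<Phi> \<in> borel_measurable borel" "\<Psi> \<in> borel_measurable borel"
    and r: "0 < r" and zero: "\<And>x. norm x < r \<or> R < norm x \<Longrightarrow> \<Phi> x = 0"
    and B: "\<And>x. \<bar>\<Phi> x\<bar> \<le> B" "\<And>x. \<bar>\<Psi> x\<bar> \<le> B"
    and deriv: "\<And>x s. ((\<lambda>s. \<Phi> (exp s *\<^sub>R x)) has_real_derivative \<Psi> (exp s *\<^sub>R x)) (at s)"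
  shows "(\<integral>x. norm x powr - real CARD('n) * \<Psi> x \<partial>lborel) = 0"
proof -
  let ?N = "CARD('n)"
  let ?w = "\<lambda>x::real^'n. norm x powr - real ?N"
  have B0: "0 \<le> B" using B(1)[of 0] by linarith
  have dom: "\<bar>?w x * y\<bar> \<le> C powr - real ?N * B * indicator (cball 0 R) x"
    if "\<bar>y\<bar> \<le> B" "norm x < C \<or> R < norm x \<Longrightarrow> y = 0" "0 < C" for x :: "real^'n" and y C
  proof (cases "norm x < C \<or> R < norm x")
    case True then show ?thesis using that B0 by (auto simp: indicator_def)
  next
    case False
    then have "?w x \<le> C powr - real ?N" using that by (intro powr_mono2') auto
    then show ?thesis using False that B0 by (auto simp: abs_mult intro!: mult_mono)
  qed
  have int_dom: "integrable lborel (\<lambda>x::real^'n. C * indicator (cball 0 R) x)" for C :: real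
    by (intro integrable_mult_right integrable_real_indicator) (use emeasure_compact_finite[of "cball (0::real^'n) R"] in auto)
  have int\<Phi>: "integrable lborel (\<lambda>x. ?w x * \<Phi> x)"
    by (rule Bochner_Integration.integrable_bound[OF int_dom[of "r powr - real ?N * B"]])
       (use dom[OF B(1) zero r] B0 in \<open>auto simp: abs_mult\<close>)
  have scale: "c ^ DIM(real^'n) * (?w (c *\<^sub>R x) * \<Phi> (c *\<^sub>R x)) = ?w x * \<Phi> (c *\<^sub>R x)" if "0 < c" for c x
  proof (cases "x = 0")
    case False
    then show ?thesis using that
      by (simp add: powr_mult powr_minus_of_nat)
  qed simp
  have eq: "(\<integral>x. ?w x * \<Phi> (c *\<^sub>R x) \<partial>lborel) = (\<integral>x. ?w x * \<Phi> x \<partial>lborel)"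
    and int\<Phi>c: "integrable lborel (\<lambda>x. ?w x * \<Phi> (c *\<^sub>R x))" if c: "0 < c" for c
  proof -
    have fs: "(\<lambda>x. c ^ DIM(real^'n) * (?w (c *\<^sub>R x) * \<Phi> (c *\<^sub>R x))) = (\<lambda>x. ?w x * \<Phi> (c *\<^sub>R x))"
      by (rule ext, rule scale[OF c])
    have m: "(\<lambda>x. ?w x * \<Phi> x) \<in> borel_measurable borel" by measurable
    show "(\<integral>x. ?w x * \<Phi> (c *\<^sub>R x) \<partial>lborel) = (\<integral>x. ?w x * \<Phi> x \<partial>lborel)"
      using integral_lborel_scale(1)[OF m c] unfolding fs .
    show "integrable lborel (\<lambda>x. ?w x * \<Phi> (c *\<^sub>R x))"
      using integral_lborel_scale(2)[OF m c int\<Phi>] unfolding fs .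
  qed
  define h where "h n = 1 / real (Suc n)" for n
  have h: "0 < h n" "h n \<le> 1" for n by (auto simp: h_def)
  have h0: "h \<longlonglongrightarrow> 0" unfolding h_def using LIMSEQ_Suc[OF lim_const_over_n] .
  define D where "D n x = (\<Phi> (exp (h n) *\<^sub>R x) - \<Phi> x) / h n" for n x
  have D_meas[measurable]: "D n \<in> borel_measurable borel" for n unfolding D_def by measurable
  have "(\<lambda>n. \<integral>x. ?w x * D n x \<partial>lborel) \<longlonglongrightarrow> (\<integral>x. ?w x * \<Psi> x \<partial>lborel)"
  \<comment> \<open>For 0 < h n <= 1 the dilated function can be nonzero only where |x| >= r / e,
    which keeps the dominating function away from the singularity of the weight.\<close>
  proof (rule integral_dominated_convergence[where w="\<lambda>x. (r / exp 1) powr - real ?N * B * indicator (cball 0 R) x"])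
    show "AE x in lborel. (\<lambda>n. ?w x * D n x) \<longlonglongrightarrow> ?w x * \<Psi> x"
    proof (rule AE_I2)
      fix x
      have "((\<lambda>t. (\<Phi> (exp (0 + t) *\<^sub>R x) - \<Phi> (exp 0 *\<^sub>R x)) / t) \<longlongrightarrow> \<Psi> (exp 0 *\<^sub>R x)) (at 0)"
        using deriv[of x 0] unfolding DERIV_def .
      moreover have "filterlim h (at 0) sequentially"
        using h0 by (simp add: filterlim_at h_def)
      ultimately have "(\<lambda>n. (\<Phi> (exp (0 + h n) *\<^sub>R x) - \<Phi> (exp 0 *\<^sub>R x)) / h n) \<longlonglongrightarrow> \<Psi> (exp 0 *\<^sub>R x)"
        by (rule filterlim_compose)
      then have "(\<lambda>n. D n x) \<longlonglongrightarrow> \<Psi> x" by (simp add: D_def)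
      then show "(\<lambda>n. ?w x * D n x) \<longlonglongrightarrow> ?w x * \<Psi> x" by (intro tendsto_intros)
    qed
    fix n
    show "AE x in lborel. norm (?w x * D n x) \<le> (r / exp 1) powr - real ?N * B * indicator (cball 0 R) x"
    proof (rule AE_I2)
      fix x :: "real^'n"
      have D0: "D n x = 0" if "norm x < r / exp 1 \<or> R < norm x"
      proof -
        have e: "1 \<le> exp (h n)" "exp (h n) \<le> exp 1" using h[of n] by auto
        from that have "norm (exp (h n) *\<^sub>R x) < r \<or> R < norm (exp (h n) *\<^sub>R x)"
        proof
          assume "norm x < r / exp 1"
          then have "exp 1 * norm x < r" by (simp add: field_simps)
          moreover have "exp (h n) * norm x \<le> exp 1 * norm x" using e by (intro mult_right_mono) auto
          ultimately show ?thesis by simp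
        next
          assume "R < norm x"
          moreover have "1 * norm x \<le> exp (h n) * norm x" using e by (intro mult_right_mono) auto
          ultimately show ?thesis by simp
        qed
        moreover have "norm x < r \<or> R < norm x"
        proof -
          have "r / exp 1 \<le> r" using r by (simp add: field_simps)
          then show ?thesis using that by auto
        qed
        ultimately show ?thesis using zero by (simp add: D_def)
      qed
      have "\<bar>D n x\<bar> \<le> B"
      proof -
        obtain z where "0 < z" "z < h n" "\<Phi> (exp (h n) *\<^sub>R x) - \<Phi> (exp 0 *\<^sub>R x) = (h n - 0) * \<Psi> (exp z *\<^sub>R x)"
          using MVT2[of 0 "h n" "\<lambda>s. \<Phi> (exp s *\<^sub>R x)" "\<lambda>s. \<Psi> (exp s *\<^sub>R x)"] h deriv by auto
        then have "D n x = \<Psi> (exp z *\<^sub>R x)" using h[of n] by (simp add: D_def)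
        then show ?thesis using B by simp
      qed
      then show "norm (?w x * D n x) \<le> (r / exp 1) powr - real ?N * B * indicator (cball 0 R) x"
        using dom[of "D n x" x "r / exp 1"] D0 r by simp
    qed
  next
    show "(\<lambda>x. ?w x * \<Psi> x) \<in> borel_measurable lborel" by simp
    show "(\<lambda>x. ?w x * D n x) \<in> borel_measurable lborel" for n by simp
    show "integrable lborel (\<lambda>x::real^'n. (r / exp 1) powr - real ?N * B * indicator (cball 0 R) x)" by (rule int_dom)
  qed
  moreover have "(\<integral>x. ?w x * D n x \<partial>lborel) = 0" for n
  proof -
    have "(\<integral>x. ?w x * D n x \<partial>lborel) = (\<integral>x. (?w x * \<Phi> (exp (h n) *\<^sub>R x) - ?w x * \<Phi> x) / h n \<partial>lborel)"
      by (intro Bochner_Integration.integral_cong) (auto simp: D_def diff_divide_distrib right_diff_distrib)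
    also have "\<dots> = ((\<integral>x. ?w x * \<Phi> (exp (h n) *\<^sub>R x) \<partial>lborel) - (\<integral>x. ?w x * \<Phi> x \<partial>lborel)) / h n"
      using int\<Phi> int\<Phi>c[of "exp (h n)"] by simp
    also have "\<dots> = 0" using eq[of "exp (h n)"] by simp
    finally show ?thesis .
  qed
  ultimately show ?thesis by (simp add: LIMSEQ_const_iff)
qed

lemma integrable_lebesgue_compact:
  fixes f :: "real^'n \<Rightarrow> real"
  assumes "continuous_on K f" "compact K"
  shows "integrable lebesgue (\<lambda>x. indicator K x *\<^sub>R f x)"
  using borel_integrable_compact[OF assms(2,1)] by (simp add: integrable_completion if_distrib indicator_def cong: if_cong)

lemma L1loc_punct_continuous:
  fixes f :: "real^'n \<Rightarrow> real"
  assumes "f \<in> borel_measurable borel" "continuous_on (- {0}) f"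
  shows "L1loc_punct f"
  unfolding L1loc_punct_def set_integrable_def
proof (intro conjI allI impI)
  show "f \<in> borel_measurable lebesgue" by (rule borel_imp_lebesgue[OF assms(1)])
  fix K :: "(real^'n) set" assume K: "compact K \<and> 0 \<notin> K"
  then have "continuous_on K f" using assms(2) by (elim continuous_on_subset) auto
  then show "integrable lebesgue (\<lambda>x. indicator K x *\<^sub>R f x)" using K by (intro integrable_lebesgue_compact) auto
qed

lemma continuous_on_log_norm: "0 \<notin> A \<Longrightarrow> continuous_on A log_norm"
  unfolding log_norm_def by (auto intro!: continuous_intros)

lemma radial_deriv_log_profile:
  fixes V V' :: "real \<Rightarrow> real"
  assumes V: "\<And>t. (V has_real_derivative V' t) (at t)" and V': "continuous_on UNIV V'"
  shows "radial_deriv (\<lambda>x::real^'n. V (log_norm x)) (\<lambda>x. V' (log_norm x) / norm x)"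
    (is "radial_deriv ?u ?g")
proof -
  let ?N = "real CARD('n)"
  have cV: "continuous_on UNIV V" by (meson V DERIV_isCont continuous_at_imp_continuous_on)
  have [measurable]: "V \<in> borel_measurable borel" "V' \<in> borel_measurable borel"
    using cV V' by (auto intro: borel_measurable_continuous_onI)
  have VT: "continuous_on A ?u" "continuous_on A (\<lambda>x. V' (log_norm x))" if "0 \<notin> A" for A :: "(real^'n) set"
    by (auto intro!: continuous_on_compose2[OF cV] continuous_on_compose2[OF V'] continuous_on_log_norm that)
  have Lu: "L1loc_punct ?u" by (intro L1loc_punct_continuous VT) auto
  have Lg: "L1loc_punct ?g" by (intro L1loc_punct_continuous continuous_intros VT) auto
  have main: "(\<integral>x. ?g x * \<phi> x \<partial>lebesgue) =
        - (\<integral>x. ?u x * (deriv (\<lambda>t. \<phi> (x + t *\<^sub>R (x /\<^sub>R norm x))) 0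
                        + (?N - 1) / norm x * \<phi> x) \<partial>lebesgue)" if tf: "test_fun \<phi>" for \<phi> :: "real^'n \<Rightarrow> real"
  proof -
    obtain G r R where G: "\<And>x. (\<phi> has_derivative (\<lambda>h. G x \<bullet> h)) (at x)" "continuous_on UNIV G" "continuous_on UNIV \<phi>"
      and r: "0 < r" and zero: "\<And>x. norm x < r \<or> R < norm x \<Longrightarrow> \<phi> x = 0 \<and> G x = 0"
      using test_fun_gradient[OF tf] by blast
    have [measurable]: "G \<in> borel_measurable borel" "\<phi> \<in> borel_measurable borel"
      using G by (auto intro: borel_measurable_continuous_onI)
    have 0: "\<phi> 0 = 0" "G 0 = 0" using zero[of 0] r by auto
    let ?A = "{x::real^'n. r \<le> norm x \<and> norm x \<le> R}"
    have "closed ?A" by (intro closed_Collect_conj closed_Collect_le continuous_intros)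
    moreover have "bounded ?A" by (rule bounded_subset[OF bounded_cball[of 0 R]]) auto
    ultimately have A: "compact ?A" by (simp add: compact_eq_bounded_closed)
    have A0: "0 \<notin> ?A" using r by auto
    have cont: "continuous_on ?A \<phi>" "continuous_on ?A G" using G continuous_on_subset by blast+
    have d: "deriv (\<lambda>t. \<phi> (x + t *\<^sub>R (x /\<^sub>R norm x))) 0 = G x \<bullet> (x /\<^sub>R norm x)" for x
    proof (rule DERIV_imp_deriv)
      have "((\<lambda>t. x + t *\<^sub>R (x /\<^sub>R norm x)) has_derivative (\<lambda>t. t *\<^sub>R (x /\<^sub>R norm x))) (at 0)"
        by (auto intro!: derivative_eq_intros)
      from has_derivative_compose[OF this, of \<phi> "\<lambda>h. G x \<bullet> h"] G(1)[of x]
      have "((\<lambda>t. \<phi> (x + t *\<^sub>R (x /\<^sub>R norm x))) has_derivative (\<lambda>t. G x \<bullet> (t *\<^sub>R (x /\<^sub>R norm x)))) (at 0)"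
        by simp
      then show "((\<lambda>t. \<phi> (x + t *\<^sub>R (x /\<^sub>R norm x))) has_real_derivative G x \<bullet> (x /\<^sub>R norm x)) (at 0)"
        unfolding has_field_derivative_def by (rule has_derivative_eq_rhs) (simp add: fun_eq_iff)
    qed
    let ?h = "\<lambda>x. ?u x * (G x \<bullet> (x /\<^sub>R norm x) + (?N - 1) / norm x * \<phi> x)"
    have int_ann: "integrable lebesgue f" if "continuous_on ?A f" "\<And>x. x \<notin> ?A \<Longrightarrow> f x = 0" for f :: "real^'n \<Rightarrow> real"
    proof -
      have "indicator ?A x *\<^sub>R f x = f x" for x
        by (cases "x \<in> ?A") (simp_all only: that(2) indicator_simps scaleR_one scaleR_zero_right not_False_eq_True)
      then have "(\<lambda>x. indicator ?A x *\<^sub>R f x) = f" by (rule ext)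
      then show ?thesis using integrable_lebesgue_compact[OF that(1) A] by (simp only:)
    qed
    have off: "\<phi> x = 0" "G x = 0" if "x \<notin> ?A" for x using zero[of x] that by auto
    have nz: "\<forall>x\<in>?A. norm x \<noteq> 0" using r by auto
    have i1: "integrable lebesgue (\<lambda>x. ?g x * \<phi> x)"
    proof (rule int_ann)
      show "continuous_on ?A (\<lambda>x. ?g x * \<phi> x)" by (intro continuous_intros cont VT A0 nz)
    qed (simp only: off mult_zero_right not_False_eq_True)
    have i2: "integrable lebesgue ?h"
    proof (rule int_ann)
      show "continuous_on ?A ?h" by (intro continuous_intros cont VT A0 nz)
    qed (simp only: off inner_zero_left mult_zero_right add_0_right not_False_eq_True)
    \<comment> \<open>\<open>\<Psi>\<close> is the derivative of \<open>\<Phi>\<close> along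
      dilations. The factor |x|^{N-1} is chosen so that its own derivative produces the term (N - 1)
      / |x|; then |x|^{-N} \<Psi> is the sum of the two integrands of the distributional
      identity.\<close>
    define \<Phi> where "\<Phi> x = ?u x * \<phi> x * norm x ^ (CARD('n) - 1)" for x
    define \<Psi> where "\<Psi> x = (V' (log_norm x) * \<phi> x + ?u x * (G x \<bullet> x) + (?N - 1) * ?u x * \<phi> x) * norm x ^ (CARD('n) - 1)" for x
    have "continuous_on ?A \<Phi>" "continuous_on ?A \<Psi>"
      unfolding \<Phi>_def[abs_def] \<Psi>_def[abs_def] by (intro continuous_intros cont VT A0)+
    then have "bounded (\<Phi> ` ?A)" "bounded (\<Psi> ` ?A)"
      using compact_imp_bounded[OF compact_continuous_image[OF _ A]] by blast+
    then obtain B1 B2 where "\<forall>y\<in>\<Phi> ` ?A. norm y \<le> B1" "\<forall>y\<in>\<Psi> ` ?A. norm y \<le> B2"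
      unfolding bounded_iff by blast
    then have B: "\<And>x. x \<in> ?A \<Longrightarrow> \<bar>\<Phi> x\<bar> \<le> B1" "\<And>x. x \<in> ?A \<Longrightarrow> \<bar>\<Psi> x\<bar> \<le> B2"
      by auto
    have z\<Phi>: "\<Phi> x = 0" "\<Psi> x = 0" if "norm x < r \<or> R < norm x" for x
      using zero[OF that] by (auto simp: \<Phi>_def \<Psi>_def)
    have "(\<integral>x. norm x powr - real CARD('n) * \<Psi> x \<partial>lborel) = 0"
    proof (rule integral_radial_derivative_eq_0[where r=r and R=R and B="max 0 (max B1 B2)" and \<Phi>=\<Phi>])
      show "\<bar>\<Phi> x\<bar> \<le> max 0 (max B1 B2)" "\<bar>\<Psi> x\<bar> \<le> max 0 (max B1 B2)" for x
        using B[of x] z\<Phi>[of x] by (cases "x \<in> ?A"; auto)+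
      show "\<Phi> \<in> borel_measurable borel" "\<Psi> \<in> borel_measurable borel"
        unfolding \<Phi>_def \<Psi>_def by measurable
      fix x :: "real^'n" and s :: real
      show "((\<lambda>s. \<Phi> (exp s *\<^sub>R x)) has_real_derivative \<Psi> (exp s *\<^sub>R x)) (at s)"
      proof (cases "x = 0")
        case True then show ?thesis by (simp add: \<Phi>_def \<Psi>_def 0)
      next
        case False
        have T: "log_norm (exp s *\<^sub>R x) = s + log_norm x" for s
          using False by (simp add: log_norm_def ln_mult)
        have d1: "((\<lambda>s. V (s + log_norm x)) has_real_derivative V' (s + log_norm x)) (at s)"
          using DERIV_shift[of V "V' (s + log_norm x)" s "log_norm x"] V by simp
        have d2: "((\<lambda>s. \<phi> (exp s *\<^sub>R x)) has_real_derivative G (exp s *\<^sub>R x) \<bullet> (exp s *\<^sub>R x)) (at s)"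
        proof -
          have "((\<lambda>s. exp s *\<^sub>R x) has_derivative (\<lambda>t. (t * exp s) *\<^sub>R x)) (at s)"
            by (auto intro!: derivative_eq_intros)
          from has_derivative_compose[OF this G(1)]
          show ?thesis
            unfolding has_field_derivative_def by (rule has_derivative_eq_rhs) (simp add: fun_eq_iff)
        qed
        have d3: "((\<lambda>s. norm (exp s *\<^sub>R x) ^ (CARD('n) - 1)) has_real_derivative (?N - 1) * norm (exp s *\<^sub>R x) ^ (CARD('n) - 1)) (at s)"
        proof -
          have "norm (exp s *\<^sub>R x) ^ (CARD('n) - 1) = exp ((?N - 1) * s) * norm x ^ (CARD('n) - 1)" for s
            by (simp add: power_mult_distrib exp_of_nat_mult[symmetric] of_nat_diff Suc_leI)
          then show ?thesis by (auto intro!: derivative_eq_intros)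
        qed
        show ?thesis
          unfolding \<Phi>_def \<Psi>_def T
          using DERIV_mult[OF DERIV_mult[OF d1 d2] d3] by (simp add: algebra_simps)
      qed
    qed (fact r, fact z\<Phi>(1))
    moreover have "norm x powr - real CARD('n) * \<Psi> x = ?g x * \<phi> x + ?h x" for x
    proof (cases "x = 0")
      case False
      have "norm x powr - real CARD('n) * norm x ^ (CARD('n) - 1) = 1 / norm x"
        using False by (intro powr_minus_mult_power) auto
      then have "norm x powr - real CARD('n) * \<Psi> x = (V' (log_norm x) * \<phi> x + ?u x * (G x \<bullet> x) + (?N - 1) * ?u x * \<phi> x) * (1 / norm x)"
        unfolding \<Psi>_def by (subst mult.left_commute) (simp only:)
      also have "\<dots> = ?g x * \<phi> x + ?h x"
        by (simp add: divide_inverse ring_distribs mult_ac)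
      finally show ?thesis .
    qed (simp add: 0)
    ultimately have "(\<integral>x. ?g x * \<phi> x + ?h x \<partial>lborel) = 0" by simp
    moreover have "(\<lambda>x. ?g x * \<phi> x + ?h x) \<in> borel_measurable borel" by measurable
    ultimately have "(\<integral>x. ?g x * \<phi> x + ?h x \<partial>lebesgue) = 0" by (simp add: integral_completion)
    then have "(\<integral>x. ?g x * \<phi> x \<partial>lebesgue) + (\<integral>x. ?h x \<partial>lebesgue) = 0"
      using i1 i2 by simp
    then show ?thesis unfolding d by simp
  qed
  show ?thesis unfolding radial_deriv_def using Lu Lg main by blast
qed

section \<open>Embeddings of radial functions\<close>

lemma in_wL_wint: "in_wL d s u \<Longrightarrow> 0 < s \<Longrightarrow> wint d s u = ennreal (wnorm d s u powr s)"
  by (simp add: in_wL_def wnorm_def powr_powr)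

lemma wnorm_nonneg: "0 \<le> wnorm d s u"
  by (simp add: wnorm_def)

lemma in_wL_wnorm_leI:
  assumes "u \<in> borel_measurable lebesgue" "wint d s u \<le> ennreal (X powr s)" "0 \<le> X" "0 < s"
  shows "in_wL d s u" "wnorm d s u \<le> X"
proof -
  show "in_wL d s u"
    using assms(1,2) unfolding in_wL_def by (auto intro: le_less_trans)
  have "enn2real (wint d s u) \<le> X powr s" using assms(2) by (intro enn2real_leI) auto
  then have "enn2real (wint d s u) powr (1 / s) \<le> (X powr s) powr (1 / s)"
    using assms(4) by (intro powr_mono2) auto
  then show "wnorm d s u \<le> X" using assms(3,4) by (simp add: wnorm_def powr_powr)
qed

text \<open>\<open>pw\<close> takes 0^0 to be 1 whereas \<open>0 powr 0 = 0\<close>;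
  \<open>pw\<close> is the value obtained as a limit of powers of positive numbers.\<close>

lemma tendsto_powr_pw:
  assumes "0 \<le> x" "0 \<le> s"
  shows "((\<lambda>e. (x + e) powr s) \<longlongrightarrow> pw x s) (at_right 0)"
proof (cases "s = 0")
  case True
  have "eventually (\<lambda>e. 1 = (x + e) powr s) (at_right 0)"
    unfolding eventually_at_right_field using assms(1) True by (intro exI[of _ 1]) auto
  then show ?thesis using True by (auto simp: pw_def intro: Lim_transform_eventually[OF tendsto_const])
next
  case False
  have "((\<lambda>e. x + e) \<longlongrightarrow> x + 0) (at_right 0)" by (intro tendsto_intros)
  then have "((\<lambda>e. (x + e) powr s) \<longlongrightarrow> x powr s) (at_right 0)"
    using assms False unfolding add_0_right
    by (intro tendsto_powr') (auto simp: eventually_at_right_field intro!: exI[of _ 1])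
  then show ?thesis using False by (simp add: pw_def)
qed

text \<open>Estimates are first proved with the norms enlarged by e > 0, which permits division by
  them; then e tends to 0.\<close>

lemma le_pw_mult_limit:
  assumes le: "\<And>e. 0 < e \<Longrightarrow> w \<le> C * ((x + e) powr s * (y + e) powr t)"
    and nn: "0 \<le> x" "0 \<le> y" "0 \<le> s" "0 \<le> t"
  shows "w \<le> C * (pw x s * pw y t)"
proof (rule tendsto_lowerbound)
  show "((\<lambda>e. C * ((x + e) powr s * (y + e) powr t)) \<longlongrightarrow> C * (pw x s * pw y t)) (at_right 0)"
    using nn by (intro tendsto_intros tendsto_powr_pw)
  show "eventually (\<lambda>e. w \<le> C * ((x + e) powr s * (y + e) powr t)) (at_right 0)"
    unfolding eventually_at_right_field using le by (intro exI[of _ 1]) auto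
qed simp

lemma pw_mult: "0 \<le> x \<Longrightarrow> 0 \<le> y \<Longrightarrow> pw (x * y) s = pw x s * pw y s"
  by (simp add: pw_def powr_mult)

lemma pw_mult_le_add:
  assumes "0 \<le> x" "0 \<le> y" "0 \<le> s" "s \<le> 1"
  shows "pw x s * pw y (1 - s) \<le> x + y"
proof -
  consider "s = 0" | "s = 1" | "s \<noteq> 0" "1 - s \<noteq> 0" by fastforce
  then show ?thesis
  proof cases
    case 3
    have "x powr s * y powr (1 - s) \<le> s * x + (1 - s) * y"
      by (rule powr_mult_le_convex_comb) (use assms in auto)
    also have "\<dots> \<le> 1 * x + 1 * y" using assms by (intro add_mono mult_right_mono) auto
    finally show ?thesis using 3 by (simp add: pw_def)
  qed (use assms in \<open>auto simp: pw_def\<close>)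
qed

section \<open>Transfer of the line estimates to \<open>R^N\<close>\<close>

lemma inW_profile:
  fixes u g :: "real^'n \<Rightarrow> real"
  assumes ru: "radial u" and w: "inW a q b p u g"
    and \<alpha>: "\<alpha> * q = a + real CARD('n)" and \<beta>: "\<beta> * p = b - p + real CARD('n)"
    and p: "1 \<le> p" and q: "0 < q"
  obtains v where "fibred_primitive log_measure log_norm (\<lambda>x. norm x * \<bar>g x\<bar>) v"
    "expint \<alpha> q v = ennreal ((sphere_area TYPE('n) powr - (1 / q) * wnorm a q u) powr q)"
    "(\<integral>\<^sup>+x. ennreal (exp (\<beta> * p * log_norm x) * (norm x * \<bar>g x\<bar>) powr p) \<partial>log_measure)
       = ennreal ((sphere_area TYPE('n) powr - (1 / p) * wnorm b p g) powr p)"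
    "\<And>c r \<gamma>. \<gamma> * r = c + real CARD('n) \<Longrightarrow> wint c r u = ennreal (sphere_area TYPE('n)) * expint \<gamma> r v"
proof -
  let ?s = "sphere_area TYPE('n)"
  have s: "0 < ?s" by (rule sphere_area_pos)
  have rd: "radial_deriv u g" and iu: "in_wL a q u" and ig: "in_wL b p g" using w by (auto simp: inW_def)
  have m: "u \<in> borel_measurable lebesgue" "g \<in> borel_measurable lebesgue" using iu ig by (auto simp: in_wL_def)
  obtain v where v: "fibred_primitive log_measure log_norm (\<lambda>x. norm x * \<bar>g x\<bar>) v"
    "AE x in lebesgue. u x = v (log_norm x)" using radial_representation[OF ru rd] .
  interpret F: fibred_primitive log_measure log_norm "\<lambda>x. norm x * \<bar>g x\<bar>" v by (rule v(1))
  have wu: "wint c r u = ennreal ?s * expint \<gamma> r v" if "\<gamma> * r = c + real CARD('n)" for c r \<gamma>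
    by (rule wint_log_norm[OF m(1) F.v_meas v(2) that])
  have cancel: "X = ennreal ((?s powr - (1 / k) * y) powr k)"
    if "ennreal ?s * X = ennreal (y powr k)" "0 < k" "0 \<le> y" for X k y
  proof -
    have "X = ennreal (1 / ?s) * (ennreal ?s * X)"
      using s by (simp add: mult.assoc[symmetric] ennreal_mult[symmetric])
    also have "\<dots> = ennreal ((?s powr - (1 / k) * y) powr k)"
    proof -
      have "(?s powr - (1 / k)) powr k = ?s powr - 1" using that(2) by (simp add: powr_powr)
      also have "\<dots> = 1 / ?s" using s by (simp add: powr_minus_divide)
      finally show ?thesis using that s by (simp add: ennreal_mult[symmetric] powr_mult)
    qed
    finally show ?thesis .
  qed
  show ?thesis
  proof (rule that[OF v(1) _ _ wu])
    show "expint \<alpha> q v = ennreal ((?s powr - (1 / q) * wnorm a q u) powr q)"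
      using wu[OF \<alpha>] in_wL_wint[OF iu q] q wnorm_nonneg by (intro cancel) auto
    show "(\<integral>\<^sup>+x. ennreal (exp (\<beta> * p * log_norm x) * (norm x * \<bar>g x\<bar>) powr p) \<partial>log_measure)
       = ennreal ((?s powr - (1 / p) * wnorm b p g) powr p)"
      using wint_radial_deriv[OF m(2) \<beta>] in_wL_wint[OF ig] p wnorm_nonneg by (intro cancel) auto
  qed
qed

text \<open>The divisor l has to dominate only the derivative norm y, while the integral of v is
  rescaled exactly; callers are free to normalise one norm or both.\<close>

lemma fibred_primitive_normalise:
  assumes fp: "fibred_primitive M T h v" and l: "0 < l" and p: "0 < p" and q: "0 < q"
    and U: "expint \<alpha> q v = ennreal (x powr q)" "0 \<le> x"
    and H: "(\<integral>\<^sup>+x. ennreal (exp (\<beta> * p * T x) * h x powr p) \<partial>M) = ennreal (y powr p)" "0 \<le> y" "y \<le> l"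
  shows "fibred_primitive M T (\<lambda>x. h x / l) (\<lambda>t. v t / l)"
    "expint \<alpha> q (\<lambda>t. v t / l) = ennreal ((x / l) powr q)"
    "(\<integral>\<^sup>+x. ennreal (exp (\<beta> * p * T x) * (h x / l) powr p) \<partial>M) \<le> 1"
    "expint \<gamma> r v = ennreal (l powr r) * expint \<gamma> r (\<lambda>t. v t / l)"
proof -
  interpret F: fibred_primitive M T h v by fact
  show "fibred_primitive M T (\<lambda>x. h x / l) (\<lambda>t. v t / l)" by (rule fibred_primitive_scale[OF fp l])
  have pd: "(z / l) powr k = l powr - k * z powr k" if "0 \<le> z" for z k
    using that l unfolding powr_minus_divide by (simp add: powr_divide)
  show "expint \<alpha> q (\<lambda>t. v t / l) = ennreal ((x / l) powr q)"
    using expint_scale[OF F.v_meas l, of \<alpha> q] U by (simp add: ennreal_mult[symmetric] pd)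
  have "(\<integral>\<^sup>+x. ennreal (exp (\<beta> * p * T x) * (h x / l) powr p) \<partial>M) = (\<integral>\<^sup>+x. ennreal (l powr - p) * ennreal (exp (\<beta> * p * T x) * h x powr p) \<partial>M)"
    by (intro nn_integral_cong) (simp add: pd F.h_nonneg ennreal_mult[symmetric] mult_ac)
  also have "\<dots> = ennreal (l powr - p) * ennreal (y powr p)"
    using H by (subst nn_integral_cmult) auto
  also have "\<dots> = ennreal ((y / l) powr p)" using H by (simp add: pd ennreal_mult[symmetric])
  also have "(y / l) powr p \<le> 1" using H l p by (intro powr_le1) auto
  then have "ennreal ((y / l) powr p) \<le> 1" by simp
  finally show "(\<integral>\<^sup>+x. ennreal (exp (\<beta> * p * T x) * (h x / l) powr p) \<partial>M) \<le> 1" .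
  show "expint \<gamma> r v = ennreal (l powr r) * expint \<gamma> r (\<lambda>t. v t / l)"
    using l by (simp add: expint_scale mult.assoc[symmetric] ennreal_mult[symmetric] powr_add[symmetric])
qed

lemma wint_scaled_le:
  assumes w: "wint c r u = ennreal \<sigma> * expint \<gamma> r v" and s: "expint \<gamma> r v = ennreal (l powr r) * E" and E: "E \<le> ennreal (K powr r)"
    and nn: "0 < \<sigma>" "0 < l" "0 \<le> K" "0 < r"
  shows "wint c r u \<le> ennreal ((\<sigma> powr (1 / r) * K * l) powr r)"
proof -
  have "wint c r u \<le> ennreal \<sigma> * (ennreal (l powr r) * ennreal (K powr r))"
    unfolding w s by (intro mult_left_mono E) auto
  also have "\<dots> = ennreal ((\<sigma> powr (1 / r) * K * l) powr r)"
    using nn by (simp add: ennreal_mult[symmetric] powr_mult powr_powr mult_ac)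
  finally show ?thesis .
qed

theorem radial_embedding_subcritical:
  assumes p: "1 \<le> p" and q: "0 < q" and r: "0 < r"
    and \<alpha>: "\<alpha> * q = a + real CARD('n)" and \<beta>: "\<beta> * p = b - p + real CARD('n)" and \<gamma>: "\<gamma> * r = c + real CARD('n)"
    and cases: "(\<alpha> < \<gamma> \<and> \<gamma> < \<beta> \<and> (\<gamma> < 0 \<or> 0 \<le> \<alpha>)) \<or> (\<beta> < \<gamma> \<and> \<gamma> < \<alpha> \<and> (0 < \<gamma> \<or> \<alpha> \<le> 0))"
    and th: "(1 - q / r) / (q * (1 - 1 / p) + 1) \<le> (\<gamma> - \<alpha>) / (\<beta> - \<alpha>)"
  shows "radial_embeds TYPE('n::finite) a b c p q r"
proof -
  let ?s = "sphere_area TYPE('n)"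
  have s: "0 < ?s" by (rule sphere_area_pos)
  obtain K where K: "0 \<le> K" and bd: "\<And>(M::(real^'n) measure) T h v. fibred_primitive M T h v \<Longrightarrow> expint \<alpha> q v \<le> 1 \<Longrightarrow>
     (\<integral>\<^sup>+x. ennreal (exp (\<beta> * p * T x) * h x powr p) \<partial>M) \<le> 1 \<Longrightarrow> expint \<gamma> r v \<le> ennreal K"
    using subcritical_expint_bound[OF p q r cases th] by metis
  let ?C = "?s powr (1 / r) * K powr (1 / r)"
  have C0: "0 \<le> ?C" by simp
  have main: "in_wL c r u \<and> wnorm c r u \<le> ?C * (?s powr - (1 / q) + ?s powr - (1 / p)) * (wnorm a q u + wnorm b p g)"
    if ru: "radial u" and w: "inW a q b p u g" for u g :: "real^'n \<Rightarrow> real"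
  proof -
    obtain v where v: "fibred_primitive log_measure log_norm (\<lambda>x. norm x * \<bar>g x\<bar>) v"
      "expint \<alpha> q v = ennreal ((?s powr - (1 / q) * wnorm a q u) powr q)"
      "(\<integral>\<^sup>+x. ennreal (exp (\<beta> * p * log_norm x) * (norm x * \<bar>g x\<bar>) powr p) \<partial>log_measure)
         = ennreal ((?s powr - (1 / p) * wnorm b p g) powr p)"
      "\<And>c r \<gamma>. \<gamma> * r = c + real CARD('n) \<Longrightarrow> wint c r u = ennreal ?s * expint \<gamma> r v"
      by (rule inW_profile[OF ru w \<alpha> \<beta> p q]) blast
    have m: "u \<in> borel_measurable lebesgue" using w by (simp add: inW_def in_wL_def)
    let ?x = "?s powr - (1 / q) * wnorm a q u" and ?y = "?s powr - (1 / p) * wnorm b p g"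
    have xy: "0 \<le> ?x" "0 \<le> ?y" by (simp_all add: wnorm_nonneg)
    have le: "wint c r u \<le> ennreal ((?C * (?x + ?y + e)) powr r)" if e: "0 < e" for e
    proof -
      \<comment> \<open>Dividing by the sum makes both source integrals at most 1; e keeps the
        divisor positive when both norms vanish.\<close>
      let ?l = "?x + ?y + e"
      have l: "0 < ?l" "?y \<le> ?l" "?x \<le> ?l" using xy e by auto
      have p0: "0 < p" using p by simp
      note N = fibred_primitive_normalise[OF v(1) l(1) p0 q v(2) xy(1) v(3) xy(2) l(2)]
      have "(?x / ?l) powr q \<le> 1" using xy l q by (intro powr_le1) (auto simp: divide_le_eq)
      then have "expint \<alpha> q (\<lambda>t. v t / ?l) \<le> 1" unfolding N(2) by simp
      from bd[OF N(1) this N(3)] have "expint \<gamma> r (\<lambda>t. v t / ?l) \<le> ennreal ((K powr (1 / r)) powr r)"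
        using K r by (simp add: powr_powr)
      from wint_scaled_le[OF v(4)[OF \<gamma>] N(4) this s l(1) _ r] show ?thesis by simp
    qed
    have fin: "in_wL c r u"
      by (rule in_wL_wnorm_leI(1)[OF m le[of 1]]) (use xy r in auto)
    have "wnorm c r u \<le> ?C * (?x + ?y)"
    proof -
      \<comment> \<open>The exponents 1 and 0 bring the additive bound into the form of
        \<open>le_pw_mult_limit\<close>.\<close>
      have "wnorm c r u \<le> ?C * ((?x + ?y + e) powr 1 * (1 + e) powr 0)" if "0 < e" for e
        using in_wL_wnorm_leI(2)[OF m le[OF that] _ r] that xy by simp
      then have "wnorm c r u \<le> ?C * (pw (?x + ?y) 1 * pw 1 0)"
        by (rule le_pw_mult_limit) (use xy in auto)
      then show ?thesis using xy by (simp add: pw_def)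
    qed
    also have "\<dots> \<le> ?C * ((?s powr - (1 / q) + ?s powr - (1 / p)) * (wnorm a q u + wnorm b p g))"
      using C0 wnorm_nonneg[of a q u] wnorm_nonneg[of b p g]
      by (intro mult_left_mono) (auto simp: algebra_simps intro!: add_nonneg_nonneg)
    finally show ?thesis using fin by (simp only: mult.assoc)
  qed
  then show ?thesis unfolding radial_embeds_def by blast
qed

text \<open>The normalisation divides by the derivative norm only: on the line
  \<open>Hardy_expint\<close> asks merely that the weighted integral of v be finite, so the norm of
  u stays out of the bound.\<close>

theorem radial_Hardy_embedding:
  assumes p: "1 \<le> p" and q: "0 < q" and pr: "p \<le> r"
    and \<alpha>: "\<alpha> * q = a + real CARD('n)" and \<beta>: "\<beta> * p = b - p + real CARD('n)" and c: "\<beta> * r = c + real CARD('n)"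
    and sgn: "0 \<le> \<alpha> \<and> 0 < \<beta> \<or> \<alpha> \<le> 0 \<and> \<beta> < 0"
  shows "\<exists>C>0. \<forall>(u::real^'n \<Rightarrow> real) g. radial u \<and> inW a q b p u g \<longrightarrow> in_wL c r u \<and> wnorm c r u \<le> C * wnorm b p g"
proof -
  let ?s = "sphere_area TYPE('n)"
  have s: "0 < ?s" by (rule sphere_area_pos)
  have r: "0 < r" using p pr by simp
  define K where "K = \<bar>\<beta>\<bar> powr (- (1 - 1 / p) * (r - p) - p)"
  have K: "0 < K" using sgn by (auto simp: K_def)
  let ?C = "?s powr (1 / r) * K powr (1 / r)"
  have C0: "0 < ?C" using s K by simp
  have main: "in_wL c r u \<and> wnorm c r u \<le> ?C * ?s powr - (1 / p) * wnorm b p g"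
    if ru: "radial u" and w: "inW a q b p u g" for u g :: "real^'n \<Rightarrow> real"
  proof -
    obtain v where v: "fibred_primitive log_measure log_norm (\<lambda>x. norm x * \<bar>g x\<bar>) v"
      "expint \<alpha> q v = ennreal ((?s powr - (1 / q) * wnorm a q u) powr q)"
      "(\<integral>\<^sup>+x. ennreal (exp (\<beta> * p * log_norm x) * (norm x * \<bar>g x\<bar>) powr p) \<partial>log_measure)
         = ennreal ((?s powr - (1 / p) * wnorm b p g) powr p)"
      "\<And>c r \<gamma>. \<gamma> * r = c + real CARD('n) \<Longrightarrow> wint c r u = ennreal ?s * expint \<gamma> r v"
      by (rule inW_profile[OF ru w \<alpha> \<beta> p q]) blast
    have m: "u \<in> borel_measurable lebesgue" using w by (simp add: inW_def in_wL_def)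
    let ?x = "?s powr - (1 / q) * wnorm a q u" and ?y = "?s powr - (1 / p) * wnorm b p g"
    have xy: "0 \<le> ?x" "0 \<le> ?y" by (simp_all add: wnorm_nonneg)
    have le: "wint c r u \<le> ennreal ((?C * (?y + e)) powr r)" if e: "0 < e" for e
    proof -
      let ?l = "?y + e"
      have l: "0 < ?l" "?y \<le> ?l" using xy e by auto
      have p0: "0 < p" using p by simp
      note N = fibred_primitive_normalise[OF v(1) l(1) p0 q v(2) xy(1) v(3) xy(2) l(2)]
      have "expint \<alpha> q (\<lambda>t. v t / ?l) < \<infinity>" unfolding N(2) by simp
      from Hardy_expint[OF N(1) p q pr sgn this N(3)] have "expint \<beta> r (\<lambda>t. v t / ?l) \<le> ennreal ((K powr (1 / r)) powr r)"
        using K r by (simp add: powr_powr K_def)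
      from wint_scaled_le[OF v(4)[OF c] N(4) this s l(1) _ r] show ?thesis by simp
    qed
    have fin: "in_wL c r u"
      by (rule in_wL_wnorm_leI(1)[OF m le[of 1]]) (use xy r in auto)
    have "wnorm c r u \<le> ?C * ((?y + e) powr 1 * (1 + e) powr 0)" if "0 < e" for e
      using in_wL_wnorm_leI(2)[OF m le[OF that] _ r] that xy by simp
    then have "wnorm c r u \<le> ?C * (pw ?y 1 * pw 1 0)"
      by (rule le_pw_mult_limit) (use xy in auto)
    then show ?thesis using fin xy by (simp add: pw_def mult.assoc)
  qed
  then show ?thesis using C0 s by (intro exI[of _ "?C * ?s powr - (1 / p)"]) auto
qed

theorem radial_Gagliardo_Nirenberg:
  assumes p: "1 \<le> p" and q: "0 < q" and qr: "q < r"
    and a: "a = - real CARD('n)" and b: "b = p - real CARD('n)"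
  defines "\<theta> \<equiv> (1 - q / r) / (q * (1 - 1 / p) + 1)"
  shows "\<exists>C>0. \<forall>(u::real^'n \<Rightarrow> real) g. radial u \<and> inW a q b p u g \<longrightarrow>
     in_wL a r u \<and> wnorm a r u \<le> C * pw (wnorm b p g) \<theta> * pw (wnorm a q u) (1 - \<theta>)"
proof -
  let ?s = "sphere_area TYPE('n)"
  have s: "0 < ?s" by (rule sphere_area_pos)
  have r: "0 < r" using q qr by simp
  have den: "1 \<le> q * (1 - 1 / p) + 1" using p q by simp
  have num: "0 < 1 - q / r" "1 - q / r < 1" using q qr by auto
  have \<theta>: "0 \<le> \<theta>" "\<theta> \<le> 1"
  proof -
    show "0 \<le> \<theta>" unfolding \<theta>_def using num den by (intro divide_nonneg_pos) linarith+
    show "\<theta> \<le> 1" unfolding \<theta>_def using num den by (subst divide_le_eq_1_pos) linarith+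
  qed
  define K where "K = (1 + 2 powr (1 / q)) powr (r - q)"
  have "1 + 2 powr (1 / q) \<noteq> (0::real)" by (metis add_pos_nonneg less_irrefl powr_ge_zero zero_less_one)
  then have K: "0 < K" by (simp add: K_def)
  let ?C = "?s powr (1 / r) * K powr (1 / r)"
  have C0: "0 < ?C" using s K by simp
  have main: "in_wL a r u \<and> wnorm a r u \<le> ?C * (pw (?s powr - (1 / p)) \<theta> * pw (?s powr - (1 / q)) (1 - \<theta>)) * pw (wnorm b p g) \<theta> * pw (wnorm a q u) (1 - \<theta>)"
    if ru: "radial u" and w: "inW a q b p u g" for u g :: "real^'n \<Rightarrow> real"
  proof -
    obtain v where v: "fibred_primitive log_measure log_norm (\<lambda>x. norm x * \<bar>g x\<bar>) v"
      "expint 0 q v = ennreal ((?s powr - (1 / q) * wnorm a q u) powr q)"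
      "(\<integral>\<^sup>+x. ennreal (exp (0 * p * log_norm x) * (norm x * \<bar>g x\<bar>) powr p) \<partial>log_measure)
         = ennreal ((?s powr - (1 / p) * wnorm b p g) powr p)"
      "\<And>c r \<gamma>. \<gamma> * r = c + real CARD('n) \<Longrightarrow> wint c r u = ennreal ?s * expint \<gamma> r v"
      by (rule inW_profile[OF ru w _ _ p q, of 0 0]) (simp add: a, simp add: b, blast)
    have m: "u \<in> borel_measurable lebesgue" using w by (simp add: inW_def in_wL_def)
    let ?x = "?s powr - (1 / q) * wnorm a q u" and ?y = "?s powr - (1 / p) * wnorm b p g"
    have xy: "0 \<le> ?x" "0 \<le> ?y" by (simp_all add: wnorm_nonneg)
    have le: "wint a r u \<le> ennreal ((?C * ((?y + e) powr \<theta> * (?x + e) powr (1 - \<theta>))) powr r)" if e: "0 < e" for e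
    proof -
      \<comment> \<open>The derivative norm is normalised to at most 1 and ?Q is the ratio of the
        enlarged norms; ?Q^{1-\<theta>} times ?l then splits into the powers \<theta> and 1 -
        \<theta> of these norms.\<close>
      let ?l = "?y + e" and ?Q = "(?x + e) / (?y + e)"
      have l: "0 < ?l" "?y \<le> ?l" using xy e by auto
      have p0: "0 < p" using p by simp
      note N = fibred_primitive_normalise[OF v(1) l(1) p0 q v(2) xy(1) v(3) xy(2) l(2)]
      interpret F: fibred_primitive log_measure log_norm "\<lambda>x. norm x * \<bar>g x\<bar> / ?l" "\<lambda>t. v t / ?l" by (rule N(1))
      have Q: "0 < ?Q" using xy e by (intro divide_pos_pos) auto
      have "(?x / ?l) powr q \<le> ?Q powr q" using xy l q e by (intro powr_mono2 divide_right_mono) auto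
      then have "expint 0 q (\<lambda>t. v t / ?l) \<le> ennreal (?Q powr q)" unfolding N(2) by (rule ennreal_leI)
      from F.unweighted_expint_bound[OF p q qr Q this] N(3)
      have "expint 0 r (\<lambda>t. v t / ?l) \<le> ennreal (K * ?Q powr (r * (1 - \<theta>)))"
        by (simp add: K_def \<theta>_def)
      also have "K * ?Q powr (r * (1 - \<theta>)) = (K powr (1 / r) * ?Q powr (1 - \<theta>)) powr r"
        using K Q r by (simp add: powr_mult powr_powr mult.commute)
      finally have "wint a r u \<le> ennreal ((?s powr (1 / r) * (K powr (1 / r) * ?Q powr (1 - \<theta>)) * ?l) powr r)"
        by (intro wint_scaled_le[OF v(4) N(4) _ s l(1) _ r]) (use a in auto)
      also have "?s powr (1 / r) * (K powr (1 / r) * ?Q powr (1 - \<theta>)) * ?l = ?C * ((?y + e) powr \<theta> * (?x + e) powr (1 - \<theta>))"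
      proof -
        have swap: "L = A * B \<Longrightarrow> X * B = Y \<Longrightarrow> X * L = A * Y" for L A B X Y :: real by auto
        have "?l = ?l powr \<theta> * ?l powr (1 - \<theta>)" using l by (subst powr_add[symmetric]) simp
        moreover have "?Q powr (1 - \<theta>) * ?l powr (1 - \<theta>) = (?x + e) powr (1 - \<theta>)"
          using xy e l by (subst powr_mult[symmetric]) auto
        ultimately have "?Q powr (1 - \<theta>) * ?l = ?l powr \<theta> * (?x + e) powr (1 - \<theta>)"
          by (rule swap)
        then show ?thesis by (simp only: mult.assoc)
      qed
      finally show ?thesis .
    qed
    have fin: "in_wL a r u"
      by (rule in_wL_wnorm_leI(1)[OF m le[of 1]]) (use r in auto)
    have "wnorm a r u \<le> ?C * ((?y + e) powr \<theta> * (?x + e) powr (1 - \<theta>))" if "0 < e" for e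
      by (rule in_wL_wnorm_leI(2)[OF m le[OF that] _ r]) simp
    then have "wnorm a r u \<le> ?C * (pw ?y \<theta> * pw ?x (1 - \<theta>))"
      by (rule le_pw_mult_limit) (use xy \<theta> in auto)
    also have "\<dots> = ?C * (pw (?s powr - (1 / p)) \<theta> * pw (?s powr - (1 / q)) (1 - \<theta>)) * pw (wnorm b p g) \<theta> * pw (wnorm a q u) (1 - \<theta>)"
      by (simp add: pw_mult wnorm_nonneg mult_ac)
    finally show ?thesis using fin by blast
  qed
  have "0 < pw (?s powr - (1 / p)) \<theta> * pw (?s powr - (1 / q)) (1 - \<theta>)"
    using s by (simp add: pw_def)
  then show ?thesis
    using C0 main by (intro exI[of _ "?C * (pw (?s powr - (1 / p)) \<theta> * pw (?s powr - (1 / q)) (1 - \<theta>))"]) auto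
qed

text \<open>Hardy's inequality with target exponent p bounds the norm of u with weight |x|^{b-p}.
  Hoelder's inequality between this norm and the given norm of u reaches every r between p and q;
  since \<alpha> is common to both, the weights interpolate to |x|^c.\<close>

theorem radial_interpolation:
  assumes p: "1 \<le> p" and q: "0 < q" and pq: "p \<noteq> q" and r: "min p q \<le> r" "r \<le> max p q"
    and \<alpha>: "\<alpha> * q = a + real CARD('n)" and \<beta>: "\<alpha> * p = b - p + real CARD('n)" and c: "\<alpha> * r = c + real CARD('n)"
    and nz: "\<alpha> \<noteq> 0"
  defines "\<theta> \<equiv> p * (r - q) / (r * (p - q))"
  shows "0 \<le> \<theta>" "\<theta> \<le> 1" "\<exists>C>0. \<forall>(u::real^'n \<Rightarrow> real) g. radial u \<and> inW a q b p u g \<longrightarrow>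
     in_wL c r u \<and> wnorm c r u \<le> C * pw (wnorm b p g) \<theta> * pw (wnorm a q u) (1 - \<theta>)"
proof -
  have r0: "0 < r" using p q r by (auto simp: min_def split: if_splits)
  have p0: "0 < p" using p by simp
  \<comment> \<open>The solution of l p + (1 - l) q = r. It interpolates the integrals; passing to
    norms turns it into \<theta> = l p / r.\<close>
  define l where "l = (r - q) / (p - q)"
  have l: "0 \<le> l" "l \<le> 1" and lr: "l * p + (1 - l) * q = r"
  proof -
    show "0 \<le> l" using r pq by (cases "p < q") (auto simp: l_def divide_nonpos_neg divide_nonneg_pos)
    show "l \<le> 1" using r pq by (cases "p < q") (auto simp: l_def divide_le_eq)
    have "l * (p - q) = r - q" using pq by (simp add: l_def)
    then show "l * p + (1 - l) * q = r" by (simp add: algebra_simps)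
  qed
  have \<theta>: "\<theta> = l * p / r" by (simp add: \<theta>_def l_def mult.commute)
  have \<theta>': "1 - \<theta> = (1 - l) * q / r"
  proof -
    have "(1 - l) * q = r - l * p" using lr by simp
    then show ?thesis using r0 by (simp add: \<theta> field_simps)
  qed
  show t0: "0 \<le> \<theta>" using l p r0 by (simp add: \<theta>)
  have "0 \<le> 1 - \<theta>" unfolding \<theta>' using l q r0 by simp
  then show t1: "\<theta> \<le> 1" by simp
  have "0 \<le> \<alpha> \<and> 0 < \<alpha> \<or> \<alpha> \<le> 0 \<and> \<alpha> < 0" using nz by auto
  moreover have "\<alpha> * p = (b - p) + real CARD('n)" using \<beta> by simp
  ultimately obtain C1 where C1: "0 < C1" and H: "\<And>(u::real^'n \<Rightarrow> real) g. radial u \<Longrightarrow> inW a q b p u g \<Longrightarrow>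
      in_wL (b - p) p u \<and> wnorm (b - p) p u \<le> C1 * wnorm b p g"
    using radial_Hardy_embedding[OF p q order_refl \<alpha> \<beta>, of "b - p"] by blast
  have c': "c = l * (b - p) + (1 - l) * a"
  proof -
    have "c + real CARD('n) = \<alpha> * (l * p + (1 - l) * q)" using c lr by simp
    also have "\<dots> = l * (\<alpha> * p) + (1 - l) * (\<alpha> * q)" by (simp add: algebra_simps)
    also have "\<dots> = l * (b - p) + (1 - l) * a + real CARD('n)" unfolding \<alpha> \<beta> by (simp add: algebra_simps)
    finally show ?thesis by simp
  qed
  have main: "in_wL c r u \<and> wnorm c r u \<le> pw C1 \<theta> * pw (wnorm b p g) \<theta> * pw (wnorm a q u) (1 - \<theta>)"
    if ru: "radial u" and w: "inW a q b p u g" for u g :: "real^'n \<Rightarrow> real"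
  proof -
    have m[measurable]: "u \<in> borel_measurable lebesgue" and iu: "in_wL a q u" using w by (auto simp: inW_def in_wL_def)
    note Hu = H[OF ru w]
    have le: "wint c r u \<le> ennreal (((C1 * wnorm b p g + e) powr \<theta> * (wnorm a q u + e) powr (1 - \<theta>)) powr r)" if e: "0 < e" for e
    proof -
      have "wint c r u = (\<integral>\<^sup>+x. ennreal ((norm x powr (b - p) * \<bar>u x\<bar> powr p) powr l * (norm x powr a * \<bar>u x\<bar> powr q) powr (1 - l)) \<partial>lebesgue)"
        unfolding wint_def
      proof (intro nn_integral_cong arg_cong[where f=ennreal])
        fix x
        have "(norm x powr (b - p) * \<bar>u x\<bar> powr p) powr l * (norm x powr a * \<bar>u x\<bar> powr q) powr (1 - l)
          = (norm x powr ((b - p) * l) * norm x powr (a * (1 - l))) * (\<bar>u x\<bar> powr (p * l) * \<bar>u x\<bar> powr (q * (1 - l)))"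
          by (simp add: powr_mult powr_powr mult_ac)
        also have "\<dots> = norm x powr ((b - p) * l + a * (1 - l)) * \<bar>u x\<bar> powr (p * l + q * (1 - l))"
          by (simp only: powr_add)
        also have "(b - p) * l + a * (1 - l) = c" using c' by (simp add: mult.commute)
        also have "p * l + q * (1 - l) = r" using lr by (simp add: mult.commute)
        finally show "norm x powr c * \<bar>u x\<bar> powr r = (norm x powr (b - p) * \<bar>u x\<bar> powr p) powr l * (norm x powr a * \<bar>u x\<bar> powr q) powr (1 - l)"
          by simp
      qed
      also have "\<dots> \<le> ennreal (((C1 * wnorm b p g + e) powr p) powr l * ((wnorm a q u + e) powr q) powr (1 - l))"
      proof (rule nn_integral_Holder_powr_pos)
        have A: "0 < C1 * wnorm b p g + e" "0 < wnorm a q u + e"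
          using e C1 wnorm_nonneg[of b p g] wnorm_nonneg[of a q u] by (auto intro!: add_nonneg_pos)
        then show "0 < (C1 * wnorm b p g + e) powr p" "0 < (wnorm a q u + e) powr q" by auto
        have "(\<integral>\<^sup>+x. ennreal (norm x powr (b - p) * \<bar>u x\<bar> powr p) \<partial>lebesgue) = ennreal (wnorm (b - p) p u powr p)"
          using in_wL_wint[of "b - p" p u] Hu p0 by (simp add: wint_def)
        also have "\<dots> \<le> ennreal ((C1 * wnorm b p g + e) powr p)"
          using Hu e p0 wnorm_nonneg[of "b - p" p u] by (intro ennreal_leI powr_mono2) auto
        finally show "(\<integral>\<^sup>+x. ennreal (norm x powr (b - p) * \<bar>u x\<bar> powr p) \<partial>lebesgue) \<le> ennreal ((C1 * wnorm b p g + e) powr p)" .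
        have "(\<integral>\<^sup>+x. ennreal (norm x powr a * \<bar>u x\<bar> powr q) \<partial>lebesgue) = ennreal (wnorm a q u powr q)"
          using in_wL_wint[OF iu q] by (simp add: wint_def)
        also have "\<dots> \<le> ennreal ((wnorm a q u + e) powr q)"
          using e q wnorm_nonneg[of a q u] by (intro ennreal_leI powr_mono2) auto
        finally show "(\<integral>\<^sup>+x. ennreal (norm x powr a * \<bar>u x\<bar> powr q) \<partial>lebesgue) \<le> ennreal ((wnorm a q u + e) powr q)" .
      qed (use l in \<open>auto, measurable\<close>)
      also have "((C1 * wnorm b p g + e) powr p) powr l * ((wnorm a q u + e) powr q) powr (1 - l)
         = ((C1 * wnorm b p g + e) powr \<theta> * (wnorm a q u + e) powr (1 - \<theta>)) powr r"
        unfolding \<theta>' using r0 by (simp add: \<theta> powr_mult powr_powr mult.commute)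
      finally show ?thesis .
    qed
    have fin: "in_wL c r u"
      by (rule in_wL_wnorm_leI(1)[OF m le[of 1]]) (use r0 in auto)
    have "wnorm c r u \<le> 1 * ((C1 * wnorm b p g + e) powr \<theta> * (wnorm a q u + e) powr (1 - \<theta>))" if "0 < e" for e
      using in_wL_wnorm_leI(2)[OF m le[OF that] _ r0] by simp
    then have "wnorm c r u \<le> 1 * (pw (C1 * wnorm b p g) \<theta> * pw (wnorm a q u) (1 - \<theta>))"
      by (rule le_pw_mult_limit) (use C1 t0 t1 in \<open>auto simp: wnorm_nonneg\<close>)
    then show ?thesis using fin C1 by (simp add: pw_mult wnorm_nonneg)
  qed
  then show "\<exists>C>0. \<forall>(u::real^'n \<Rightarrow> real) g. radial u \<and> inW a q b p u g \<longrightarrow>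
     in_wL c r u \<and> wnorm c r u \<le> C * pw (wnorm b p g) \<theta> * pw (wnorm a q u) (1 - \<theta>)"
    using C1 by (intro exI[of _ "pw C1 \<theta>"]) (auto simp: pw_def)
qed

text \<open>A C^1 profile V yields the radial function V(ln |x|) with radial derivative V'(ln |x|) /
  |x|; the change of variables contributes only powers of the area of the sphere.\<close>

theorem radial_embeds_imp_profile_embeds:
  assumes emb: "radial_embeds TYPE('n::finite) a b c p q r" and p: "1 \<le> p" and q: "0 < q" and r: "0 < r"
    and \<alpha>: "\<alpha> * q = a + real CARD('n)" and \<beta>: "\<beta> * p = b - p + real CARD('n)" and \<gamma>: "\<gamma> * r = c + real CARD('n)"
  shows "\<exists>C. profile_embeds \<alpha> \<beta> \<gamma> p q r C"
proof -
  let ?s = "sphere_area TYPE('n)"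
  have s: "0 < ?s" by (rule sphere_area_pos)
  have p0: "0 < p" using p by simp
  obtain C where C: "\<And>(u::real^'n \<Rightarrow> real) g. radial u \<Longrightarrow> inW a q b p u g \<Longrightarrow> wnorm c r u \<le> C * (wnorm a q u + wnorm b p g)"
    and fin: "\<And>(u::real^'n \<Rightarrow> real) g. radial u \<Longrightarrow> inW a q b p u g \<Longrightarrow> in_wL c r u"
    using emb unfolding radial_embeds_def by blast
  \<comment> \<open>|C| + 1 appears because \<open>radial_embeds\<close> does not say that its
    constant is positive.\<close>
  let ?D = "?s powr - (1 / r) * (\<bar>C\<bar> + 1) * (?s powr (1 / q) + ?s powr (1 / p))"
  have "profile_embeds \<alpha> \<beta> \<gamma> p q r ?D"
    unfolding profile_embeds_def
  proof (intro conjI allI impI)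
    have "0 < \<bar>C\<bar> + 1" "0 < ?s powr (1 / q) + ?s powr (1 / p)" using s by (auto intro: add_pos_pos)
    then show "0 < ?D" using s by (intro mult_pos_pos) auto
    fix V V' :: "real \<Rightarrow> real" and A B :: real
    assume V: "\<forall>t. (V has_real_derivative V' t) (at t)" and V': "continuous_on UNIV V'" and AB: "0 \<le> A" "0 \<le> B"
      and eA: "expint \<alpha> q V \<le> ennreal (A powr q)" and eB: "expint \<beta> p V' \<le> ennreal (B powr p)"
    let ?u = "\<lambda>x::real^'n. V (log_norm x)" and ?g = "\<lambda>x::real^'n. V' (log_norm x) / norm x"
    have cV: "continuous_on UNIV V" using V by (meson DERIV_isCont continuous_at_imp_continuous_on)
    have [measurable]: "V \<in> borel_measurable borel" "V' \<in> borel_measurable borel"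
      using cV V' by (auto intro: borel_measurable_continuous_onI)
    have rd: "radial_deriv ?u ?g" by (rule radial_deriv_log_profile) (use V V' in auto)
    have mu: "?u \<in> borel_measurable lebesgue" and mg: "?g \<in> borel_measurable lebesgue" by measurable
    have ru: "radial ?u" by (auto simp: radial_def log_norm_def)
    have wu: "wint d k ?u = ennreal ?s * expint \<kappa> k V" if "\<kappa> * k = d + real CARD('n)" for d k \<kappa>
      by (rule wint_log_norm[OF mu _ _ that]) auto
    have "(\<integral>\<^sup>+x. ennreal (exp (\<beta> * p * log_norm x) * (norm x * \<bar>?g x\<bar>) powr p) \<partial>(log_measure :: (real^'n) measure))
      = (\<integral>\<^sup>+x. ennreal (exp (\<beta> * p * log_norm x) * \<bar>V' (log_norm x)\<bar> powr p) \<partial>(log_measure :: (real^'n) measure))"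
    proof (rule nn_integral_cong_AE, unfold AE_log_measure)
      show "AE x in lebesgue. ennreal (exp (\<beta> * p * log_norm x) * (norm x * \<bar>?g x\<bar>) powr p) = ennreal (exp (\<beta> * p * log_norm (x::real^'n)) * \<bar>V' (log_norm x)\<bar> powr p)"
        using AE_lebesgue_neq_0 by eventually_elim (simp add: abs_divide)
    qed
    also have "\<dots> = expint \<beta> p V'"
      unfolding expint_def by (subst distr_log_measure[where 'n='n, symmetric]) (simp add: nn_integral_distr)
    finally have wg: "wint b p ?g = ennreal ?s * expint \<beta> p V'"
      using wint_radial_deriv[OF mg \<beta>] by simp
    have bnd: "ennreal ?s * X \<le> ennreal ((?s powr (1 / k) * Y) powr k)" if "X \<le> ennreal (Y powr k)" "0 < k" "0 \<le> Y" for X k Y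
    proof -
      have "ennreal ?s * X \<le> ennreal ?s * ennreal (Y powr k)" by (intro mult_left_mono that) auto
      also have "\<dots> = ennreal ((?s powr (1 / k) * Y) powr k)"
        using s that by (simp add: ennreal_mult[symmetric] powr_mult powr_powr)
      finally show ?thesis .
    qed
    have u1: "in_wL a q ?u" "wnorm a q ?u \<le> ?s powr (1 / q) * A"
      using in_wL_wnorm_leI[OF mu, of a q "?s powr (1 / q) * A"] bnd[OF eA q AB(1)] wu[OF \<alpha>] q AB by auto
    have g1: "in_wL b p ?g" "wnorm b p ?g \<le> ?s powr (1 / p) * B"
      using in_wL_wnorm_leI[OF mg, of b p "?s powr (1 / p) * B"] bnd[OF eB p0 AB(2)] wg p0 AB by auto
    have w: "inW a q b p ?u ?g"
      using rd u1 g1 by (auto simp: inW_def radial_deriv_def)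
    have "wnorm c r ?u \<le> C * (wnorm a q ?u + wnorm b p ?g)" by (rule C[OF ru w])
    also have "\<dots> \<le> (\<bar>C\<bar> + 1) * (?s powr (1 / q) * A + ?s powr (1 / p) * B)"
      using u1 g1 wnorm_nonneg[of a q ?u] wnorm_nonneg[of b p ?g] by (intro mult_mono add_mono) auto
    also have "\<dots> \<le> (\<bar>C\<bar> + 1) * ((?s powr (1 / q) + ?s powr (1 / p)) * (A + B))"
      using AB by (intro mult_left_mono) (auto simp: algebra_simps intro!: add_nonneg_nonneg)
    finally have wle: "wnorm c r ?u \<le> (\<bar>C\<bar> + 1) * ((?s powr (1 / q) + ?s powr (1 / p)) * (A + B))" .
    have "expint \<gamma> r V = ennreal (1 / ?s) * (ennreal ?s * expint \<gamma> r V)"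
      using s by (simp add: mult.assoc[symmetric] ennreal_mult[symmetric])
    also have "\<dots> = ennreal (1 / ?s) * ennreal (wnorm c r ?u powr r)"
      using in_wL_wint[OF fin[OF ru w] r] wu[OF \<gamma>] by simp
    also have "\<dots> \<le> ennreal (1 / ?s) * ennreal (((\<bar>C\<bar> + 1) * ((?s powr (1 / q) + ?s powr (1 / p)) * (A + B))) powr r)"
      using wle r wnorm_nonneg by (intro mult_left_mono ennreal_leI powr_mono2) auto
    also have "\<dots> = ennreal ((?D * (A + B)) powr r)"
    proof -
      have "(?s powr - (1 / r)) powr r = ?s powr - 1" using r by (simp add: powr_powr)
      then have "(?s powr - (1 / r)) powr r = 1 / ?s" using s by (simp add: powr_minus_divide)
      moreover have "?D * (A + B) = ?s powr - (1 / r) * ((\<bar>C\<bar> + 1) * ((?s powr (1 / q) + ?s powr (1 / p)) * (A + B)))"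
        by (simp only: mult.assoc)
      moreover have "0 \<le> (\<bar>C\<bar> + 1) * ((?s powr (1 / q) + ?s powr (1 / p)) * (A + B))"
        using AB by (intro mult_nonneg_nonneg add_nonneg_nonneg) auto
      ultimately show ?thesis using s by (simp only: powr_mult powr_ge_zero) (simp add: ennreal_mult[symmetric])
    qed
    finally show "expint \<gamma> r V \<le> ennreal ((?D * (A + B)) powr r)" .
  qed
  then show ?thesis by blast
qed

section \<open>The characterisation\<close>

lemma radial_embeds_of_interpolation:
  assumes "\<exists>C>0. \<forall>(u::real^'n \<Rightarrow> real) g. radial u \<and> inW a q b p u g \<longrightarrow>
     in_wL c r u \<and> wnorm c r u \<le> C * pw (wnorm b p g) \<theta> * pw (wnorm a q u) (1 - \<theta>)" and "0 \<le> \<theta>" "\<theta> \<le> 1"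
  shows "radial_embeds TYPE('n::finite) a b c p q r"
proof -
  obtain C where C: "0 < C" and *: "\<And>(u::real^'n \<Rightarrow> real) g. radial u \<Longrightarrow> inW a q b p u g \<Longrightarrow>
     in_wL c r u \<and> wnorm c r u \<le> C * pw (wnorm b p g) \<theta> * pw (wnorm a q u) (1 - \<theta>)" using assms(1) by blast
  have "wnorm c r u \<le> C * (wnorm a q u + wnorm b p g)" if "radial u" "inW a q b p u g" for u g :: "real^'n \<Rightarrow> real"
  proof -
    have "wnorm c r u \<le> C * (pw (wnorm b p g) \<theta> * pw (wnorm a q u) (1 - \<theta>))" using *[OF that] by (simp add: mult.assoc)
    also have "\<dots> \<le> C * (wnorm b p g + wnorm a q u)"
      using C assms(2,3) by (intro mult_left_mono pw_mult_le_add wnorm_nonneg) auto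
    finally show ?thesis by (simp add: add.commute)
  qed
  then show ?thesis unfolding radial_embeds_def using * by blast
qed

theorem theorem4p7:
  fixes a b c p q r :: real
  defines "N \<equiv> real CARD('n)"
  defines "c0 \<equiv> r * (a + N) / q - N"
  defines "c1 \<equiv> r * (b - p + N) / p - N"
  defines "\<theta>c \<equiv> (c - c0) / (c1 - c0)"
  defines "\<theta>b \<equiv> (1 - q / r) / (q * (1 - 1 / p) + 1)"
  assumes "1 \<le> p" and "0 < q" and "0 < r"
  shows
   "(radial_embeds TYPE('n) a b c p q r \<longleftrightarrow>
      (((a \<le> -N \<and> b - p \<le> -N) \<or> (a \<ge> -N \<and> b - p \<ge> -N)) \<and> (a + N) / q \<noteq> (b - p + N) / p
         \<and> min c0 c1 < c \<and> c < max c0 c1 \<and> \<theta>c \<ge> \<theta>b)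
    \<or> (((a < -N \<and> b - p > -N) \<or> (a > -N \<and> b - p < -N))
         \<and> min c0 (-N) < c \<and> c < max c0 (-N) \<and> \<theta>c \<ge> \<theta>b)
    \<or> (r \<ge> p \<and> ((a \<le> -N \<and> b - p < -N) \<or> (a \<ge> -N \<and> b - p > -N)) \<and> c = c1)
    \<or> ((r = q \<and> c = a) \<or> (p \<noteq> q \<and> min p q \<le> r \<and> r \<le> max p q
         \<and> (a + N) / q = (b - p + N) / p \<and> (a + N) / q \<noteq> 0 \<and> c = c0))
    \<or> (a = -N \<and> b = p - N \<and> r > q \<and> c = -N))
   \<and> ((r \<ge> p \<and> ((a \<le> -N \<and> b - p < -N) \<or> (a \<ge> -N \<and> b - p > -N)) \<and> c = c1) \<longrightarrow>
        (\<exists>C>0. \<forall>(u::real^'n \<Rightarrow> real) g. radial u \<and> inW a q b p u g \<longrightarrow>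
            in_wL c r u \<and> wnorm c r u \<le> C * wnorm b p g))
   \<and> (((r = q \<and> c = a) \<or> (p \<noteq> q \<and> min p q \<le> r \<and> r \<le> max p q
         \<and> (a + N) / q = (b - p + N) / p \<and> (a + N) / q \<noteq> 0 \<and> c = c0)) \<longrightarrow>
        (let \<theta> = (if r = q \<and> c = a then 0 else p * (r - q) / (r * (p - q))) in
         \<exists>C>0. \<forall>(u::real^'n \<Rightarrow> real) g. radial u \<and> inW a q b p u g \<longrightarrow>
            in_wL c r u \<and> wnorm c r u \<le> C * pw (wnorm b p g) \<theta> * pw (wnorm a q u) (1 - \<theta>)))
   \<and> ((a = -N \<and> b = p - N \<and> r > q \<and> c = -N) \<longrightarrow>
        (\<exists>C>0. \<forall>(u::real^'n \<Rightarrow> real) g. radial u \<and> inW a q b p u g \<longrightarrow>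
            in_wL (-N) r u \<and> wnorm (-N) r u \<le> C * pw (wnorm (p - N) p g) \<theta>b * pw (wnorm (-N) q u) (1 - \<theta>b)))"
proof -
  define \<alpha> where "\<alpha> = (a + N) / q"
  define \<beta> where "\<beta> = (b - p + N) / p"
  define \<gamma> where "\<gamma> = (c + N) / r"
  note p = \<open>1 \<le> p\<close> and q = \<open>0 < q\<close> and r = \<open>0 < r\<close>
  have p0: "0 < p" using p by simp
  have \<alpha>: "\<alpha> * q = a + real CARD('n)" using q by (simp add: \<alpha>_def N_def)
  have \<beta>: "\<beta> * p = b - p + real CARD('n)" using p0 by (simp add: \<beta>_def N_def)
  have \<gamma>: "\<gamma> * r = c + real CARD('n)" using r by (simp add: \<gamma>_def N_def)
  \<comment> \<open>c^0, c^1, c and -N are the images of \<alpha>, \<beta>, \<gamma> and 0 under the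
    increasing map taking x to r x - N, so order relations carry over in both directions.\<close>
  have c0: "c0 = r * \<alpha> - N" by (simp add: c0_def \<alpha>_def)
  have c1: "c1 = r * \<beta> - N" by (simp add: c1_def \<beta>_def)
  have c: "c = r * \<gamma> - N" using r by (simp add: \<gamma>_def)
  have aN: "a \<le> -N \<longleftrightarrow> \<alpha> \<le> 0" "a \<ge> -N \<longleftrightarrow> 0 \<le> \<alpha>" "a < -N \<longleftrightarrow> \<alpha> < 0" "a > -N \<longleftrightarrow> 0 < \<alpha>" "a = -N \<longleftrightarrow> \<alpha> = 0"
    using q by (auto simp: \<alpha>_def divide_le_0_iff zero_le_divide_iff divide_less_0_iff zero_less_divide_iff)
  have bN: "b - p \<le> -N \<longleftrightarrow> \<beta> \<le> 0" "b - p \<ge> -N \<longleftrightarrow> 0 \<le> \<beta>" "b - p < -N \<longleftrightarrow> \<beta> < 0" "b - p > -N \<longleftrightarrow> 0 < \<beta>" "b = p - N \<longleftrightarrow> \<beta> = 0"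
    using p0 by (auto simp: \<beta>_def divide_le_0_iff zero_le_divide_iff divide_less_0_iff zero_less_divide_iff)
  have lt: "r * x - N < r * y - N \<longleftrightarrow> x < y" "r * x - N = r * y - N \<longleftrightarrow> x = y"
    "- N < r * y - N \<longleftrightarrow> 0 < y" "r * y - N < - N \<longleftrightarrow> y < 0" "r * y - N = - N \<longleftrightarrow> y = 0" for x y
    using r by (auto simp: zero_less_mult_iff mult_less_0_iff)
  have mm: "min c0 c1 < c \<and> c < max c0 c1 \<longleftrightarrow> min \<alpha> \<beta> < \<gamma> \<and> \<gamma> < max \<alpha> \<beta>"
    "min c0 (- N) < c \<and> c < max c0 (- N) \<longleftrightarrow> min \<alpha> 0 < \<gamma> \<and> \<gamma> < max \<alpha> 0"
    unfolding min_less_iff_disj less_max_iff_disj c0 c1 c lt by auto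
  have eqs: "c = c1 \<longleftrightarrow> \<gamma> = \<beta>" "c = c0 \<longleftrightarrow> \<gamma> = \<alpha>" "c = - N \<longleftrightarrow> \<gamma> = 0"
    unfolding c0 c1 c lt by (rule refl)+
  have ca: "r = q \<and> c = a \<longleftrightarrow> r = q \<and> \<gamma> = \<alpha>"
    using q by (auto simp: \<alpha>_def \<gamma>_def)
  have \<theta>c: "\<theta>c = (\<gamma> - \<alpha>) / (\<beta> - \<alpha>)"
  proof -
    have "\<theta>c = (r * (\<gamma> - \<alpha>)) / (r * (\<beta> - \<alpha>))" unfolding \<theta>c_def c0 c1 c by (simp add: right_diff_distrib)
    then show ?thesis using r by simp
  qed
  let ?i = "((\<alpha> \<le> 0 \<and> \<beta> \<le> 0) \<or> (0 \<le> \<alpha> \<and> 0 \<le> \<beta>)) \<and> \<alpha> \<noteq> \<beta> \<and> (min \<alpha> \<beta> < \<gamma> \<and> \<gamma> < max \<alpha> \<beta>) \<and> \<theta>b \<le> (\<gamma> - \<alpha>) / (\<beta> - \<alpha>)"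
  let ?ii = "((\<alpha> < 0 \<and> 0 < \<beta>) \<or> (0 < \<alpha> \<and> \<beta> < 0)) \<and> (min \<alpha> 0 < \<gamma> \<and> \<gamma> < max \<alpha> 0) \<and> \<theta>b \<le> (\<gamma> - \<alpha>) / (\<beta> - \<alpha>)"
  let ?iii = "p \<le> r \<and> ((\<alpha> \<le> 0 \<and> \<beta> < 0) \<or> (0 \<le> \<alpha> \<and> 0 < \<beta>)) \<and> \<gamma> = \<beta>"
  let ?iv = "(r = q \<and> \<gamma> = \<alpha>) \<or> (p \<noteq> q \<and> min p q \<le> r \<and> r \<le> max p q \<and> \<alpha> = \<beta> \<and> \<alpha> \<noteq> 0 \<and> \<gamma> = \<alpha>)"
  let ?v = "\<alpha> = 0 \<and> \<beta> = 0 \<and> q < r \<and> \<gamma> = 0"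
  let ?emb = "radial_embeds TYPE('n) a b c p q r"
  let ?\<theta> = "if r = q \<and> c = a then 0 else p * (r - q) / (r * (p - q))"
  have iii: "\<exists>C>0. \<forall>(u::real^'n \<Rightarrow> real) g. radial u \<and> inW a q b p u g \<longrightarrow> in_wL c r u \<and> wnorm c r u \<le> C * wnorm b p g"
    if h: ?iii
    by (rule radial_Hardy_embedding[OF p q _ \<alpha> \<beta>]) (use h \<gamma> in auto)
  have iv: "0 \<le> ?\<theta> \<and> ?\<theta> \<le> 1 \<and> (\<exists>C>0. \<forall>(u::real^'n \<Rightarrow> real) g. radial u \<and> inW a q b p u g \<longrightarrow>
      in_wL c r u \<and> wnorm c r u \<le> C * pw (wnorm b p g) ?\<theta> * pw (wnorm a q u) (1 - ?\<theta>))" if h: ?iv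
  proof (cases "r = q \<and> c = a")
    case True
    \<comment> \<open>Here \<theta> = 0 and \<open>pw\<close> with exponent 0 is 1 for every base,
      so the estimate is an identity with C = 1.\<close>
    then show ?thesis by (auto simp: inW_def pw_def wnorm_nonneg intro!: exI[of _ 1])
  next
    case False
    then have h': "p \<noteq> q" "min p q \<le> r" "r \<le> max p q" "\<alpha> = \<beta>" "\<alpha> \<noteq> 0" "\<gamma> = \<alpha>" using h ca by auto
    have \<beta>': "\<alpha> * p = b - p + real CARD('n)" and \<gamma>': "\<alpha> * r = c + real CARD('n)" using \<beta> \<gamma> h' by auto
    show ?thesis
      using radial_interpolation[OF p q h'(1-3) \<alpha> \<beta>' \<gamma>' h'(5)] by (simp only: False if_False)
  qed
  have v: "\<exists>C>0. \<forall>(u::real^'n \<Rightarrow> real) g. radial u \<and> inW a q b p u g \<longrightarrow>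
      in_wL a r u \<and> wnorm a r u \<le> C * pw (wnorm b p g) \<theta>b * pw (wnorm a q u) (1 - \<theta>b)" if h: ?v
  proof -
    have "a = - real CARD('n)" "b = p - real CARD('n)" using h \<alpha> \<beta> by auto
    then show ?thesis unfolding \<theta>b_def using h by (intro radial_Gagliardo_Nirenberg p q) auto
  qed
  have \<theta>b01: "0 \<le> \<theta>b" "\<theta>b \<le> 1" if "q < r"
  proof -
    have d: "1 \<le> q * (1 - 1 / p) + 1" using p q by simp
    have n: "0 < 1 - q / r" "1 - q / r < 1" using q r that by auto
    show "0 \<le> \<theta>b" unfolding \<theta>b_def using n d by (intro divide_nonneg_pos) linarith+
    show "\<theta>b \<le> 1" unfolding \<theta>b_def using n d by (subst divide_le_eq_1_pos) linarith+
  qed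
  have nec: "?i \<or> ?ii \<or> ?iii \<or> ?iv \<or> ?v" if emb: ?emb
  proof -
    obtain C where "profile_embeds \<alpha> \<beta> \<gamma> p q r C"
      using radial_embeds_imp_profile_embeds[OF emb p q r \<alpha> \<beta> \<gamma>] by blast
    from profile_embeds_necessary[OF this p q r] show ?thesis
      unfolding \<theta>b_def by (simp only: conj_assoc disj_assoc)
  qed
  have suf: ?emb if h: "?i \<or> ?ii \<or> ?iii \<or> ?iv \<or> ?v"
    using h
  proof (elim disjE)
    assume i: ?i
    show ?emb
    proof (rule radial_embedding_subcritical[OF p q r \<alpha> \<beta> \<gamma>])
      \<comment> \<open>In the ordering \<alpha> < \<gamma> < \<beta>, nonpositive exponents give
        \<gamma> < 0 and nonnegative ones give 0 <= \<alpha>; the other ordering is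
        symmetric.\<close>
      show "\<alpha> < \<gamma> \<and> \<gamma> < \<beta> \<and> (\<gamma> < 0 \<or> 0 \<le> \<alpha>) \<or> \<beta> < \<gamma> \<and> \<gamma> < \<alpha> \<and> (0 < \<gamma> \<or> \<alpha> \<le> 0)"
        using i by (cases "\<alpha> \<le> \<beta>") (auto simp: min_def max_def)
    qed (use i in \<open>simp add: \<theta>b_def\<close>)
  next
    assume ii: ?ii
    show ?emb
    proof (rule radial_embedding_subcritical[OF p q r \<alpha> \<beta> \<gamma>])
      \<comment> \<open>With opposite signs, \<gamma> strictly between \<alpha> and 0 also lies
        between \<alpha> and \<beta>, and its sign is that of \<alpha>.\<close>
      show "\<alpha> < \<gamma> \<and> \<gamma> < \<beta> \<and> (\<gamma> < 0 \<or> 0 \<le> \<alpha>) \<or> \<beta> < \<gamma> \<and> \<gamma> < \<alpha> \<and> (0 < \<gamma> \<or> \<alpha> \<le> 0)"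
        using ii by (cases "\<alpha> < 0") (auto simp: min_def max_def)
    qed (use ii in \<open>simp add: \<theta>b_def\<close>)
  next
    assume h: ?iii
    obtain C where C: "0 < C" and *: "\<And>(u::real^'n \<Rightarrow> real) g. radial u \<Longrightarrow> inW a q b p u g \<Longrightarrow>
        in_wL c r u \<and> wnorm c r u \<le> C * wnorm b p g" using iii[OF h] by blast
    have "wnorm c r u \<le> C * (wnorm a q u + wnorm b p g)" if "radial u" "inW a q b p u g" for u g :: "real^'n \<Rightarrow> real"
    proof -
      have "wnorm c r u \<le> C * wnorm b p g" using *[OF that] by blast
      also have "\<dots> \<le> C * (wnorm a q u + wnorm b p g)" using C wnorm_nonneg[of a q u] by (intro mult_left_mono) auto
      finally show ?thesis .
    qed
    then show ?emb unfolding radial_embeds_def using * by blast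
  next
    assume h: "r = q \<and> \<gamma> = \<alpha>"
    show ?emb using iv[OF disjI1[OF h]] by (intro radial_embeds_of_interpolation) blast+
  next
    assume h: "p \<noteq> q \<and> min p q \<le> r \<and> r \<le> max p q \<and> \<alpha> = \<beta> \<and> \<alpha> \<noteq> 0 \<and> \<gamma> = \<alpha>"
    show ?emb using iv[OF disjI2[OF h]] by (intro radial_embeds_of_interpolation) blast+
  next
    assume h: ?v
    then have "c = a" using \<alpha> \<gamma> by auto
    then show ?emb using v[OF h] \<theta>b01 h by (intro radial_embeds_of_interpolation[where \<theta>=\<theta>b]) auto
  qed
  have nz: "(a + N) / q = \<alpha>" "(b - p + N) / p = \<beta>" by (simp_all add: \<alpha>_def \<beta>_def)
  have v': "\<exists>C>0. \<forall>(u::real^'n \<Rightarrow> real) g. radial u \<and> inW a q b p u g \<longrightarrow>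
      in_wL (- N) r u \<and> wnorm (- N) r u \<le> C * pw (wnorm (p - N) p g) \<theta>b * pw (wnorm (- N) q u) (1 - \<theta>b)" if h: ?v
  proof -
    have "a = - N" "b = p - N" using h aN bN by auto
    then show ?thesis using v[OF h] by simp
  qed
  have R: "(((a \<le> -N \<and> b - p \<le> -N) \<or> (a \<ge> -N \<and> b - p \<ge> -N)) \<and> (a + N) / q \<noteq> (b - p + N) / p
         \<and> min c0 c1 < c \<and> c < max c0 c1 \<and> \<theta>c \<ge> \<theta>b) \<longleftrightarrow> ?i"
    "(((a < -N \<and> b - p > -N) \<or> (a > -N \<and> b - p < -N))
         \<and> min c0 (-N) < c \<and> c < max c0 (-N) \<and> \<theta>c \<ge> \<theta>b) \<longleftrightarrow> ?ii"
    "(r \<ge> p \<and> ((a \<le> -N \<and> b - p < -N) \<or> (a \<ge> -N \<and> b - p > -N)) \<and> c = c1) \<longleftrightarrow> ?iii"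
    "((r = q \<and> c = a) \<or> (p \<noteq> q \<and> min p q \<le> r \<and> r \<le> max p q
         \<and> (a + N) / q = (b - p + N) / p \<and> (a + N) / q \<noteq> 0 \<and> c = c0)) \<longleftrightarrow> ?iv"
    "(a = -N \<and> b = p - N \<and> r > q \<and> c = -N) \<longleftrightarrow> ?v"
    unfolding nz aN bN eqs ca \<theta>c using mm by blast+
  show ?thesis
    unfolding R Let_def
    by (intro conjI iffI impI; (erule nec | erule suf | erule iii | erule v' | rule conjunct2[OF conjunct2[OF iv]], assumption))
qed

end
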